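(* For $A\in\mathcal{A}_{n,1}$ let $A'=\Lambda^{-1}(\xi(\Lambda(A)))$. Then $A\mapsto A'$ is an involution of $\mathcal{A}_{n,1}$ and, for every $A\in\mathcal{A}_{n,1}$: (1) the opening row has the same index $k$ in $A$ and in $A'$, and rows $1$ to $k$ of $A$ and $A'$ coincide; in particular $r(A)=r(A')$; (2) $i(A')=i(A)$ and $J(A')=J(A)$; (3) $E(A')=B(A)$ and $B(A')=E(A)$; (4) $(\overline{A})'=\overline{A'}$.
   Context: An alternating sign matrix (ASM) of order $n$ is an $n\times n$ matrix $A=(a_{ij})$ with entries in $\{-1,0,1\}$ such that in every row and every column the nonzero entries alternate in sign, the first and the last nonzero entries being $1$. $\mathcal{A}_{n,s}$ denotes the set of order-$n$ ASMs having exactly $s$ entries equal to $-1$ (so $\mathcal{A}_{n,0}$ is the set of $n\times n$ permutation matrices). For an ASM $A=(a_{ij})$: $r(A)$ is the number of entries of the first row lying to the left of its unique nonzero entry (which is a $1$); $i(A)=\sum a_{ij}a_{k\ell}$, the sum over all pairs of positions with $k>i$ and $\ell<j$ (number of inversions); $\overline{A}=(a_{i,n+1-j})$ is the vertical reflection of $A$. Let $A\in\mathcal{A}_{n,1}$. The opening column is the column containing the unique $-1$; the closing row is the row containing the $-1$; the opening row is the row of the $1$ of the opening column lying above the $-1$. The columns strictly to the left (resp. right) of the opening column form the left side (resp. right side). The closing row contains exactly two $1$'s, one in each side; the one in the right side is the closing $1$ and its column is the closing column. The rows strictly between the opening row and the closing row are the enclosed rows. $A$ is neutral if there are no enclosed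 rows; otherwise $A$ is positive if the $1$ of the lowest enclosed row lies in the right side, and negative if it lies in the left side. $\mathcal{A}_{n,1}^{+},\mathcal{A}_{n,1}^{0},\mathcal{A}_{n,1}^{-}$ denote the sets of positive, neutral, negative elements of $\mathcal{A}_{n,1}$; $A$ is negative iff $\overline{A}$ is positive. For $A\in\mathcal{A}_{n,1}^{+}\cup\mathcal{A}_{n,1}^{0}$: the charged cell is the intersection of the enclosed rows with the right side; the extended neutral cell is the intersection of the rows from the opening row to the closing row (inclusive) with the left side. The leading $1$ is the highest $1$ in the left side strictly below the opening row; its column is the leading column; the leading cell consists of the entries strictly below the opening row and strictly between the leading column and the opening column, and $\ell(A)$ is the sum of its entries. The closing cell consists of the entries strictly below the closing row and strictly between the opening column and the closing column, and $c(A)$ is the sum of its entries; the extended closing cell consists of the entries strictly below the closing row in the columns from the opening column to the closing column inclusive. Parameters: if $A$ is positive, $E(A)$ is the sum of the entries of the charged cell; if $A$ is neutral, $E(A)=0$; if $A$ is negative, $E(A)=-E(\overline{A})$. For $A\in\mathcal{A}_{n,1}^{+}\cup\mathcal{A}_{n,1}^{0}$, $B(A)=c(A)-\ell(A)$ and $J(A)=c(A)+\ell(A)+|E(A)|+1$; for $A\in\mathcal{A}_{n,1}^{-}$, $B(A)=-B(\overline{A})$ and $J(A)=J(\overline{A})$. Horizontal displacement: for an $m\times q$ $(0,1)$-matrix $P$ whose nonzero columns are $j_1<\dots<j_t$ with $j_1=1$ and $j_t<q$, $H(P)$ is the $m\times q$ matrix whose column $j_{s+1}$ equals column $j_s$ of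 $P$ for $1\le s\le t$ (where $j_{t+1}=q$), all other columns being zero. Vertical displacement: for an $m\times q$ $(0,1)$-matrix $P$ whose nonzero rows are $i_1<\dots<i_t$ with $i_1>1$ and $i_t=m$, $V(P)$ is the $m\times q$ matrix whose row $i_{s-1}$ equals row $i_s$ of $P$ for $1\le s\le t$ (where $i_0=1$), all other rows being zero. Partial discharging procedure: for $A\in\mathcal{A}_{n,1}^{+}\cup\mathcal{A}_{n,1}^{0}$, $\delta(A)$ is obtained by applying successively the following steps (all cells, rows and columns referring to the positions they occupy in $A$): (1) replace the $-1$ and the closing $1$ by $0$; (2) replace the submatrix occupying the extended closing cell by its image under $H$; (3) replace the submatrix occupying the extended neutral cell by its image under $V$; (4) lower the entries of the extended neutral cell and of the charged cell by one row: in the left side, for each row $t$ strictly below the opening row up to and including the closing row, the left part of row $t$ becomes the former left part of row $t-1$, and the left part of the opening row becomes zero; in the right side, for each row $t$ from two rows below the opening row up to and including the closing row, the right part of row $t$ becomes the former right part of row $t-1$, and the right part of the row immediately below the opening row becomes zero. The complete discharging procedure is $\Delta(A)=(k,\delta(A),c(A),E(A))$, where $k$ is the index of the opening row of $A$. It is known that $\Delta$ is injective on $\mathcal{A}_{n,1}^{+}\cup\mathcal{A}_{n,1}^{0}$, and that whenever $\Delta(A)=(k,P,c,E)$, there is a unique $N\in\mathcal{A}_{n,1}^{+}\cup\mathcal{A}_{n,1}^{0}$ with $\Delta(N)=(k,P,c+E,0)$, and this $N$ is neutral. Neutralizing procedure $\Lambda$: for $A\in\mathcal{A}_{n,1}^{+}\cup\mathcal{A}_{n,1}^{0}$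 with $\Delta(A)=(k,P,c,E)$, $\Lambda(A)=(N,E)$ where $N$ is the unique element with $\Delta(N)=(k,P,c+E,0)$. For $A\in\mathcal{A}_{n,1}^{-}$, write $\Lambda(\overline{A})=(M,-E)$ and set $\Lambda(A)=(\overline{M},E)$. It is known that $\Lambda$ is a bijection from $\mathcal{A}_{n,1}$ onto $\mathcal{N}_{n,1}=\{(N,E)\,:\,N\in\mathcal{A}_{n,1}^{0},\ E\in\mathbb{Z},\ -\ell(N)\le E\le c(N)\}$. The map $\xi:\mathcal{N}_{n,1}\to\mathcal{N}_{n,1}$ is defined by $\xi(N,E)=(N,\,c(N)-\ell(N)-E)$. *)

theory Defs
  imports Main
begin

text \<open>Matrices of order n are functions nat => nat => int, indexed 1..n in both
  coordinates, and required to vanish outside {1..n} x {1..n}.\<close>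

type_synonym mat = "nat \<Rightarrow> nat \<Rightarrow> int"

definition alt_seq :: "int list \<Rightarrow> bool" where
  "alt_seq xs = (let ys = filter (\<lambda>x. x \<noteq> 0) xs in
     ys \<noteq> [] \<and> hd ys = 1 \<and> last ys = 1 \<and>
     (\<forall>k. Suc k < length ys \<longrightarrow> ys ! Suc k = - (ys ! k)))"

definition is_asm :: "nat \<Rightarrow> mat \<Rightarrow> bool" where
  "is_asm n A =
    ((\<forall>i j. A i j \<in> {-1, 0, 1}) \<and>
     (\<forall>i j. \<not> (i \<in> {1..n} \<and> j \<in> {1..n}) \<longrightarrow> A i j = 0) \<and>
     (\<forall>i\<in>{1..n}. alt_seq (map (\<lambda>j. A i j) [1..<n+1])) \<and>
     (\<forall>j\<in>{1..n}. alt_seq (map (\<lambda>i. A i j) [1..<n+1])))"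

definition asms :: "nat \<Rightarrow> nat \<Rightarrow> mat set" where
  "asms n s = {A. is_asm n A \<and> card {(i,j). i \<in> {1..n} \<and> j \<in> {1..n} \<and> A i j = -1} = s}"

abbreviation asm1 :: "nat \<Rightarrow> mat set" where
  "asm1 n \<equiv> asms n 1"

definition rpar :: "nat \<Rightarrow> mat \<Rightarrow> nat" where
  "rpar n A = card {j \<in> {1..n}. j < (THE j0. j0 \<in> {1..n} \<and> A 1 j0 \<noteq> 0)}"

definition ipar :: "nat \<Rightarrow> mat \<Rightarrow> int" where
  "ipar n A = (\<Sum>i\<in>{1..n}. \<Sum>j\<in>{1..n}. \<Sum>k\<in>{i+1..n}. \<Sum>l\<in>{1..<j}. A i j * A k l)"

definition vrefl :: "nat \<Rightarrow> mat \<Rightarrow> mat" where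
  "vrefl n A = (\<lambda>i j. if 1 \<le> j \<and> j \<le> n then A i (n + 1 - j) else 0)"

definition minus_pos :: "nat \<Rightarrow> mat \<Rightarrow> nat \<times> nat" where
  "minus_pos n A = (THE p. fst p \<in> {1..n} \<and> snd p \<in> {1..n} \<and> A (fst p) (snd p) = -1)"

definition closing_row :: "nat \<Rightarrow> mat \<Rightarrow> nat" where
  "closing_row n A = fst (minus_pos n A)"

definition opening_col :: "nat \<Rightarrow> mat \<Rightarrow> nat" where
  "opening_col n A = snd (minus_pos n A)"

definition opening_row :: "nat \<Rightarrow> mat \<Rightarrow> nat" where
  "opening_row n A = (THE i. 1 \<le> i \<and> i < closing_row n A \<and> A i (opening_col n A) = 1)"

definition closing_col :: "nat \<Rightarrow> mat \<Rightarrow> nat" where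
  "closing_col n A = (THE j. opening_col n A < j \<and> j \<le> n \<and> A (closing_row n A) j = 1)"

definition neutral :: "nat \<Rightarrow> mat \<Rightarrow> bool" where
  "neutral n A = (closing_row n A = opening_row n A + 1)"

text \<open>The lowest enclosed row is closing_row - 1.\<close>
definition positive :: "nat \<Rightarrow> mat \<Rightarrow> bool" where
  "positive n A = (opening_row n A + 1 < closing_row n A \<and>
     (\<exists>j. opening_col n A < j \<and> j \<le> n \<and> A (closing_row n A - 1) j = 1))"

definition negative :: "nat \<Rightarrow> mat \<Rightarrow> bool" where
  "negative n A = (opening_row n A + 1 < closing_row n A \<and>
     (\<exists>j. 1 \<le> j \<and> j < opening_col n A \<and> A (closing_row n A - 1) j = 1))"

definition leading_row :: "nat \<Rightarrow> mat \<Rightarrow> nat" where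
  "leading_row n A = (LEAST i. opening_row n A < i \<and>
      (\<exists>j. 1 \<le> j \<and> j < opening_col n A \<and> A i j = 1))"

definition leading_col :: "nat \<Rightarrow> mat \<Rightarrow> nat" where
  "leading_col n A = (THE j. 1 \<le> j \<and> j < opening_col n A \<and> A (leading_row n A) j = 1)"

definition lpar :: "nat \<Rightarrow> mat \<Rightarrow> int" where
  "lpar n A = (\<Sum>i\<in>{opening_row n A + 1..n}. \<Sum>j\<in>{leading_col n A + 1..<opening_col n A}. A i j)"

definition cpar :: "nat \<Rightarrow> mat \<Rightarrow> int" where
  "cpar n A = (\<Sum>i\<in>{closing_row n A + 1..n}. \<Sum>j\<in>{opening_col n A + 1..<closing_col n A}. A i j)"

definition charge :: "nat \<Rightarrow> mat \<Rightarrow> int" where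
  "charge n A = (\<Sum>i\<in>{opening_row n A + 1..<closing_row n A}. \<Sum>j\<in>{opening_col n A + 1..n}. A i j)"

definition Epar :: "nat \<Rightarrow> mat \<Rightarrow> int" where
  "Epar n A = (if positive n A then charge n A
               else if neutral n A then 0
               else - charge n (vrefl n A))"

definition Bpar :: "nat \<Rightarrow> mat \<Rightarrow> int" where
  "Bpar n A = (if negative n A then - (cpar n (vrefl n A) - lpar n (vrefl n A))
               else cpar n A - lpar n A)"

definition Jpar :: "nat \<Rightarrow> mat \<Rightarrow> int" where
  "Jpar n A = (if negative n A
                then cpar n (vrefl n A) + lpar n (vrefl n A) + \<bar>Epar n (vrefl n A)\<bar> + 1
                else cpar n A + lpar n A + \<bar>Epar n A\<bar> + 1)"

definition Hdisp :: "nat \<Rightarrow> nat \<Rightarrow> mat \<Rightarrow> mat" where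
  "Hdisp m q P = (\<lambda>i j.
     let L = sorted_list_of_set {j' \<in> {1..q}. \<exists>i'\<in>{1..m}. P i' j' \<noteq> 0};
         L' = tl L @ [q]
     in if 1 \<le> i \<and> i \<le> m \<and> 1 \<le> j \<and> j \<le> q
        then (\<Sum>s<length L. if L' ! s = j then P i (L ! s) else 0) else 0)"

definition Vdisp :: "nat \<Rightarrow> nat \<Rightarrow> mat \<Rightarrow> mat" where
  "Vdisp m q P = (\<lambda>i j.
     let L = sorted_list_of_set {i' \<in> {1..m}. \<exists>j'\<in>{1..q}. P i' j' \<noteq> 0};
         L' = 1 # butlast L
     in if 1 \<le> i \<and> i \<le> m \<and> 1 \<le> j \<and> j \<le> q
        then (\<Sum>s<length L. if L' ! s = i then P (L ! s) j else 0) else 0)"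

definition delta :: "nat \<Rightarrow> mat \<Rightarrow> mat" where
  "delta n A = (
     let cr = closing_row n A; oc = opening_col n A; ro = opening_row n A; cc = closing_col n A;
         A1 = (\<lambda>i j. if i = cr \<and> (j = oc \<or> j = cc) then 0 else A i j);
         m2 = n - cr; q2 = cc - oc + 1;
         P2 = (\<lambda>i j. if 1 \<le> i \<and> i \<le> m2 \<and> 1 \<le> j \<and> j \<le> q2 then A1 (cr + i) (oc - 1 + j) else 0);
         H2 = Hdisp m2 q2 P2;
         A2 = (\<lambda>i j. if cr < i \<and> i \<le> n \<and> oc \<le> j \<and> j \<le> cc then H2 (i - cr) (j - oc + 1) else A1 i j);
         m3 = cr - ro + 1; q3 = oc - 1;
         P3 = (\<lambda>i j. if 1 \<le> i \<and> i \<le> m3 \<and> 1 \<le> j \<and> j \<le> q3 then A2 (ro - 1 + i) j else 0);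
         V3 = Vdisp m3 q3 P3;
         A3 = (\<lambda>i j. if ro \<le> i \<and> i \<le> cr \<and> 1 \<le> j \<and> j < oc then V3 (i - ro + 1) j else A2 i j)
     in (\<lambda>t j.
          if 1 \<le> j \<and> j < oc \<and> ro + 1 \<le> t \<and> t \<le> cr then A3 (t - 1) j
          else if 1 \<le> j \<and> j < oc \<and> t = ro then 0
          else if oc < j \<and> j \<le> n \<and> ro + 2 \<le> t \<and> t \<le> cr then A3 (t - 1) j
          else if oc < j \<and> j \<le> n \<and> t = ro + 1 then 0
          else A3 t j))"

definition Delta :: "nat \<Rightarrow> mat \<Rightarrow> nat \<times> mat \<times> int \<times> int" where
  "Delta n A = (opening_row n A, delta n A, cpar n A, Epar n A)"

definition Lambda_pn :: "nat \<Rightarrow> mat \<Rightarrow> mat \<times> int" where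
  "Lambda_pn n A =
     ((THE N. N \<in> asm1 n \<and> (positive n N \<or> neutral n N) \<and>
              Delta n N = (opening_row n A, delta n A, cpar n A + Epar n A, 0)),
      Epar n A)"

definition Lambda :: "nat \<Rightarrow> mat \<Rightarrow> mat \<times> int" where
  "Lambda n A = (if negative n A
                 then (vrefl n (fst (Lambda_pn n (vrefl n A))), - snd (Lambda_pn n (vrefl n A)))
                 else Lambda_pn n A)"

definition Nset :: "nat \<Rightarrow> (mat \<times> int) set" where
  "Nset n = {(N, E). N \<in> asm1 n \<and> neutral n N \<and> - lpar n N \<le> E \<and> E \<le> cpar n N}"

definition xi :: "nat \<Rightarrow> mat \<times> int \<Rightarrow> mat \<times> int" where
  "xi n p = (fst p, cpar n (fst p) - lpar n (fst p) - snd p)"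

definition prime_map :: "nat \<Rightarrow> mat \<Rightarrow> mat" where
  "prime_map n A = inv_into (asm1 n) (Lambda n) (xi n (Lambda n A))"

end

theory Submission
  imports Defs
begin

text \<open>An alternating sign matrix with a single \<open>-1\<close>, in position \<open>(m, b)\<close>, is a sum of unit matrices at
  \<open>(i, \<sigma> i)\<close> for a function \<open>\<sigma>\<close> that takes the value \<open>b\<close> twice, at the opening row \<open>k\<close> and below \<open>m\<close>,
  and misses the closing column \<open>d\<close>, plus the unit matrix at \<open>(m, d)\<close> minus the one at \<open>(m, b)\<close>. In
  these terms the discharging procedure maps a positive or neutral matrix to a permutation \<open>\<pi>\<close>: the
  values in \<open>[b, d)\<close> below row \<open>m\<close> are replaced by their successors in \<open>(b, d]\<close>, and between rows \<open>k\<close> and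
  \<open>m\<close> every entry of the left side moves up past the run of right entries just above it. Hence \<open>\<pi> k = b\<close>
  is a descent of \<open>\<pi>\<close>, the closing row is the row of the \<open>E\<close>-th entry of \<open>\<pi>\<close> below \<open>k\<close> that exceeds
  \<open>b\<close> (or \<open>k + 1\<close> if \<open>E = 0\<close>), and \<open>d\<close> is the \<open>(c + 1)\<close>-st smallest value exceeding \<open>b\<close> below the closing row. So \<open>(k, \<pi>, c, E)\<close>
  determines the matrix, and it occurs as soon as \<open>c, E \<ge> 0\<close> and \<open>c + E\<close> is smaller than the number of
  values exceeding \<open>b\<close> below row \<open>k\<close>. Moreover \<open>\<ell>\<close> depends only on \<open>(k, \<pi>)\<close>, and the number of
  inversions is that of \<open>\<pi>\<close> plus \<open>c + E + 1\<close>; both are therefore unchanged when \<open>c\<close> is traded for \<open>E\<close>.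
  Negative matrices reduce to positive ones, since reflection exchanges \<open>c\<close> and \<open>\<ell>\<close> on neutral
  matrices and \<open>i(A) + i(vrefl A)\<close> is the same for all \<open>A\<close>.\<close>

section \<open>Alternating sequences\<close>

text \<open>Nonzero entries alternate, starting and ending with 1, exactly when all partial sums lie
  in {0, 1} and the total is 1. The argument \<open>s\<close> accumulates the sum read so
  far.\<close>

fun partial_sums_ok :: "int \<Rightarrow> int list \<Rightarrow> bool" where
  "partial_sums_ok s [] \<longleftrightarrow> s = 1"
| "partial_sums_ok s (x # xs) \<longleftrightarrow> s \<in> {0, 1} \<and> partial_sums_ok (s + x) xs"

lemma partial_sums_ok_imp: "partial_sums_ok s xs \<Longrightarrow> s \<in> {0, 1}"
  by (cases xs) auto

text \<open>A zero leaves \<open>s\<close> unchanged, and the test on \<open>s\<close> that is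
  skipped with it follows from the remaining list.\<close>

lemma partial_sums_ok_filter:
  "partial_sums_ok s (filter (\<lambda>x. x \<noteq> 0) xs) \<longleftrightarrow> partial_sums_ok s xs"
  by (induction xs arbitrary: s) (auto dest: partial_sums_ok_imp)

text \<open>Without zeros the sum is forced: from 0 only the entry 1 is possible, from 1 only -1.
  The next entry is therefore \<open>1 - 2 * s\<close>.\<close>

lemma partial_sums_ok_signs:
  assumes "set ys \<subseteq> {-1, 1}" "s \<in> {0, 1}"
  shows "partial_sums_ok s ys \<longleftrightarrow>
    (if ys = [] then s = 1
     else hd ys = 1 - 2 * s \<and> last ys = 1 \<and> (\<forall>k. Suc k < length ys \<longrightarrow> ys ! Suc k = - (ys ! k)))"
  using assms
proof (induction ys arbitrary: s)
  case (Cons y ys)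
  show ?case
  proof (cases "s + y \<in> {0, 1}")
    case True
    have IH: "partial_sums_ok (s + y) ys \<longleftrightarrow>
      (if ys = [] then s + y = 1
       else hd ys = 1 - 2 * (s + y) \<and> last ys = 1 \<and> (\<forall>k. Suc k < length ys \<longrightarrow> ys ! Suc k = - (ys ! k)))"
      using Cons.prems True by (intro Cons.IH) auto
    have y: "y = 1 - 2 * s" using True Cons.prems by auto
    have all: "(\<forall>k. Suc k < length (y # ys) \<longrightarrow> (y # ys) ! Suc k = - ((y # ys) ! k)) \<longleftrightarrow>
        (ys \<noteq> [] \<longrightarrow> hd ys = - y) \<and> (\<forall>k. Suc k < length ys \<longrightarrow> ys ! Suc k = - (ys ! k))"
      by (auto simp: nth_Cons hd_conv_nth split: nat.splits)
    show ?thesis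
      using Cons.prems unfolding all partial_sums_ok.simps IH
      by (auto simp: y)
  next
    case False
    then have "\<not> partial_sums_ok (s + y) ys" using partial_sums_ok_imp by blast
    moreover have "y \<noteq> 1 - 2 * s" using False Cons.prems by auto
    ultimately show ?thesis by auto
  qed
qed auto

lemma alt_seq_iff_partial_sums_ok:
  assumes "set xs \<subseteq> {-1, 0, 1}"
  shows "alt_seq xs \<longleftrightarrow> partial_sums_ok 0 xs"
proof -
  have "set (filter (\<lambda>x. x \<noteq> 0) xs) \<subseteq> {-1, 1}" using assms by auto
  from partial_sums_ok_signs[OF this, of 0] show ?thesis
    by (auto simp: alt_seq_def Let_def partial_sums_ok_filter)
qed

lemma partial_sums_ok_map_upt:
  "p \<le> n + 1 \<Longrightarrow> partial_sums_ok s (map f [p..<n + 1]) \<longleftrightarrow>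
    (\<forall>q\<in>{p..n + 1}. s + sum f {p..<q} \<in> {0, 1}) \<and> s + sum f {p..<n + 1} = 1"
proof (induction "n + 1 - p" arbitrary: p s)
  case 0
  then show ?case by auto
next
  case (Suc x)
  then have p: "p < n + 1" by simp
  have up: "[p..<n + 1] = p # [Suc p..<n + 1]" using p by (simp add: upt_conv_Cons)
  have IH: "partial_sums_ok (s + f p) (map f [Suc p..<n + 1]) \<longleftrightarrow>
    (\<forall>q\<in>{Suc p..n + 1}. s + f p + sum f {Suc p..<q} \<in> {0, 1}) \<and> s + f p + sum f {Suc p..<n + 1} = 1"
    using Suc.hyps p by (intro Suc.hyps(1)) auto
  have s: "s + f p + sum f {Suc p..<q} = s + sum f {p..<q}" if "p < q" for q
    using that by (simp add: sum.atLeast_Suc_lessThan)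
  have all: "(\<forall>q\<in>{Suc p..n + 1}. s + f p + sum f {Suc p..<q} \<in> {0, 1}) \<longleftrightarrow>
      (\<forall>q\<in>{Suc p..n + 1}. s + sum f {p..<q} \<in> {0, 1})"
    using s by (metis Suc_le_lessD atLeastAtMost_iff)
  have i: "{p..n + 1} = insert p {Suc p..n + 1}" using p by auto
  show ?case
    unfolding up i list.map partial_sums_ok.simps IH all s[OF p] by simp
qed

lemma alt_seq_map_iff:
  assumes "\<And>j. f j \<in> {-1, 0, 1}"
  shows "alt_seq (map f [1..<n + 1]) \<longleftrightarrow>
    (\<forall>q\<le>n. sum f {1..q} \<in> {0, 1}) \<and> sum f {1..n} = 1"
proof -
  have "alt_seq (map f [1..<n + 1]) \<longleftrightarrow> partial_sums_ok 0 (map f [1..<n + 1])"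
    using assms by (intro alt_seq_iff_partial_sums_ok) auto
  also have "\<dots> \<longleftrightarrow> (\<forall>q\<in>{1..n + 1}. sum f {1..<q} \<in> {0, 1}) \<and> sum f {1..<n + 1} = 1"
    by (subst partial_sums_ok_map_upt) auto
  also have "(\<forall>q\<in>{1..n + 1}. sum f {1..<q} \<in> {0, 1}) \<longleftrightarrow> (\<forall>q\<le>n. sum f {1..<Suc q} \<in> {0, 1})"
  proof (intro iffI allI ballI impI)
    fix q assume *: "\<forall>q\<le>n. sum f {1..<Suc q} \<in> {0, 1}" and "q \<in> {1..n + 1}"
    then show "sum f {1..<q} \<in> {0, 1}" by (cases q) auto
  next
    fix q assume "\<forall>q\<in>{1..n + 1}. sum f {1..<q} \<in> {0, 1}" "q \<le> n"
    then show "sum f {1..<Suc q} \<in> {0, 1}" by (simp del: sum.op_ivl_Suc)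
  qed
  finally show ?thesis by (simp add: atLeastLessThanSuc_atLeastAtMost)
qed

lemma sum_01_eq_1_ex1:
  assumes "finite I" "\<And>i. i \<in> I \<Longrightarrow> f i \<in> {0, 1 :: int}" "sum f I = 1"
  shows "\<exists>!i. i \<in> I \<and> f i = 1"
proof -
  have "sum f I = (\<Sum>i\<in>{i \<in> I. f i = 1}. 1)"
    using assms by (intro sum.mono_neutral_cong_right) auto
  then have "card {i \<in> I. f i = 1} = 1" using assms by simp
  then obtain x where "{i \<in> I. f i = 1} = {x}" by (meson card_1_singletonE)
  then have "i \<in> I \<and> f i = 1 \<longleftrightarrow> i = x" for i by blast
  then show ?thesis by simp
qed

lemma alt_seq_no_minus:
  assumes "\<And>j. f j \<in> {-1, 0, 1 :: int}" "alt_seq (map f [1..<n + 1])" "\<And>j. j \<in> {1..n} \<Longrightarrow> f j \<noteq> -1"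
  shows "\<exists>!j. j \<in> {1..n} \<and> f j = 1"
proof (rule sum_01_eq_1_ex1)
  show "sum f {1..n} = 1" using assms(2) unfolding alt_seq_map_iff[OF assms(1)] by blast
qed (use assms in auto)

text \<open>At \<open>p\<close> the partial sum must drop from 1 to 0, so the entries before
  \<open>p\<close> and those after \<open>p\<close> each sum to 1; they are all 0 or 1.\<close>

lemma alt_seq_one_minus:
  assumes "\<And>j. f j \<in> {-1, 0, 1 :: int}" "alt_seq (map f [1..<n + 1])"
    and p: "p \<in> {1..n}" "f p = -1" and u: "\<And>j. j \<in> {1..n} \<Longrightarrow> f j = -1 \<Longrightarrow> j = p"
  shows "\<exists>!j. j \<in> {1..<p} \<and> f j = 1" "\<exists>!j. j \<in> {p<..n} \<and> f j = 1"
proof -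
  have S: "\<And>q. q \<le> n \<Longrightarrow> sum f {1..q} \<in> {0, 1}" "sum f {1..n} = 1"
    using assms(2) unfolding alt_seq_map_iff[OF assms(1)] by blast+
  have "{1..p} = insert p {1..<p}" using p by auto
  then have *: "sum f {1..p} = sum f {1..<p} - 1" using p by simp
  have "{1..<p} = {1..p - 1}" using p by auto
  then have "sum f {1..<p} \<in> {0, 1}" using S(1)[of "p - 1"] p by auto
  moreover have "sum f {1..p} \<in> {0, 1}" using S(1)[of p] p by auto
  ultimately have 1: "sum f {1..<p} = 1" "sum f {1..p} = 0" using * by auto
  have "{1..n} = {1..p} \<union> {p<..n}" using p by auto
  then have "sum f {1..n} = sum f {1..p} + sum f {p<..n}"
    by (simp add: sum.union_disjoint ivl_disj_int)
  then have 2: "sum f {p<..n} = 1" using S(2) 1 by simp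
  have "f j \<noteq> -1" if "j \<in> {1..n}" "j \<noteq> p" for j using u that by blast
  then have 01: "f j \<in> {0, 1}" if "j \<in> {1..n}" "j \<noteq> p" for j
    using assms(1)[of j] that by auto
  show "\<exists>!j. j \<in> {1..<p} \<and> f j = 1" using 1(1) p by (intro sum_01_eq_1_ex1 01) auto
  show "\<exists>!j. j \<in> {p<..n} \<and> f j = 1" using 2 p by (intro sum_01_eq_1_ex1 01) auto
qed

section \<open>Coding an alternating sign matrix with a single -1 by a function\<close>

text \<open>Row \<open>i \<noteq> m\<close> has its only 1 in column \<open>\<sigma> i\<close>; row \<open>m\<close> has 1 in columns \<open>\<sigma> m\<close> and \<open>d\<close>
  and -1 in column \<open>b\<close>.\<close>

definition code_mat :: "nat \<Rightarrow> nat \<Rightarrow> nat \<Rightarrow> nat \<Rightarrow> (nat \<Rightarrow> nat) \<Rightarrow> mat" where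
  "code_mat n m b d \<sigma> = (\<lambda>i j. of_bool (i \<in> {1..n} \<and> \<sigma> i = j) +
     of_bool (i = m) * (of_bool (j = d) - of_bool (j = b)))"

lemma sum_of_bool_eq_right:
  "finite S \<Longrightarrow> (\<Sum>j\<in>S. of_bool (P \<and> x = j)) = (of_bool (P \<and> x \<in> S) :: int)"
  by (cases P) (auto simp: of_bool_def)

lemma sum_of_bool_eq_left:
  "finite S \<Longrightarrow> (\<Sum>j\<in>S. of_bool (j = x)) = (of_bool (x \<in> S) :: int)"
  by (auto simp: of_bool_def)

lemma sum_of_bool_card: "finite I \<Longrightarrow> (\<Sum>i\<in>I. of_bool (P i)) = int (card {i \<in> I. P i})"
  by (simp add: of_bool_def sum.If_cases Int_def)

text \<open>These conditions make the coded matrix an alternating sign matrix. Rows \<open>k\<close>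
  and some row below \<open>m\<close> share column \<open>b\<close>, whence injectivity only away
  from \<open>k\<close>; column \<open>d\<close> gets its 1 from row \<open>m\<close> as a second
  entry, whence \<open>\<sigma>\<close> misses \<open>d\<close>.\<close>

locale coded_asm =
  fixes n k m b d :: nat and \<sigma> :: "nat \<Rightarrow> nat"
  assumes k_pos: "1 \<le> k" and k_less_m: "k < m" and m_le_n: "m \<le> n"
    and \<sigma>_k: "\<sigma> k = b" and \<sigma>_m: "\<sigma> m < b" and b_less_d: "b < d" and d_le_n: "d \<le> n"
    and \<sigma>_range: "i \<in> {1..n} \<Longrightarrow> \<sigma> i \<in> {1..n}"
    and \<sigma>_neq_d: "i \<in> {1..n} \<Longrightarrow> \<sigma> i \<noteq> d"
    and \<sigma>_inj: "inj_on \<sigma> ({1..n} - {k})"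
    and b_below: "\<exists>i\<in>{m<..n}. \<sigma> i = b"
begin

abbreviation A :: mat where "A \<equiv> code_mat n m b d \<sigma>"

lemma k_in: "k \<in> {1..n}" and m_in: "m \<in> {1..n}" and k_neq_m: "k \<noteq> m"
  using k_pos k_less_m m_le_n by auto

lemma b_in: "b \<in> {1..n}"
  using \<sigma>_range[OF k_in] \<sigma>_k by simp

lemma \<sigma>_bounds: "1 \<le> i \<Longrightarrow> i \<le> n \<Longrightarrow> 1 \<le> \<sigma> i" "1 \<le> i \<Longrightarrow> i \<le> n \<Longrightarrow> \<sigma> i \<le> n"
  using \<sigma>_range[of i] by auto

lemma \<sigma>_image: "\<sigma> ` ({1..n} - {k}) = {1..n} - {d}"
proof (rule card_subset_eq)
  show "\<sigma> ` ({1..n} - {k}) \<subseteq> {1..n} - {d}" using \<sigma>_range \<sigma>_neq_d by blast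
  have "d \<in> {1..n}" using b_less_d d_le_n by auto
  then show "card (\<sigma> ` ({1..n} - {k})) = card ({1..n} - {d})"
    using k_in by (subst card_image[OF \<sigma>_inj]) simp
qed auto

lemma \<sigma>_injD: "i \<in> {1..n} \<Longrightarrow> i' \<in> {1..n} \<Longrightarrow> \<sigma> i = \<sigma> i' \<Longrightarrow> i \<noteq> k \<Longrightarrow> i' \<noteq> k \<Longrightarrow> i = i'"
  using \<sigma>_inj by (auto dest: inj_onD)

text \<open>By injectivity away from \<open>k\<close>, the row below \<open>m\<close> is the only
  other one with value \<open>b\<close>.\<close>

lemma \<sigma>_eq_b_le_m: "i \<in> {1..m} \<Longrightarrow> \<sigma> i = b \<longleftrightarrow> i = k"
proof -
  assume i: "i \<in> {1..m}"
  obtain k' where k': "k' \<in> {m<..n}" "\<sigma> k' = b" using b_below by blast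
  then show ?thesis using \<sigma>_injD[of i k'] i \<sigma>_k k_less_m m_le_n by auto
qed

lemma A_outside: "\<not> (i \<in> {1..n} \<and> j \<in> {1..n}) \<Longrightarrow> A i j = 0"
  using \<sigma>_range[of i] m_in b_in b_less_d d_le_n by (auto simp: code_mat_def)

lemma A_eq_minus: "A i j = -1 \<longleftrightarrow> i = m \<and> j = b"
  using \<sigma>_m b_less_d by (auto simp: code_mat_def of_bool_def)

lemma A_eq_1: "A i j = 1 \<longleftrightarrow> i \<in> {1..n} \<and> \<sigma> i = j \<or> i = m \<and> j = d"
  using \<sigma>_m b_less_d \<sigma>_neq_d[OF m_in] by (auto simp: code_mat_def of_bool_def)

lemma A_values: "A i j \<in> {-1, 0, 1}"
  using \<sigma>_neq_d[OF m_in] by (auto simp: code_mat_def of_bool_def)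

lemma row_sum:
  "finite S \<Longrightarrow> sum (A i) S = of_bool (i \<in> {1..n} \<and> \<sigma> i \<in> S) +
     of_bool (i = m) * (of_bool (d \<in> S) - of_bool (b \<in> S))"
  unfolding code_mat_def sum.distrib sum_distrib_left[symmetric] sum_subtractf
  by (simp only: sum_of_bool_eq_left sum_of_bool_eq_right)

text \<open>Column \<open>b\<close> reads 1, -1, 1 from top to bottom; every other column has a
  single 1, which for column \<open>d\<close> is the closing 1 in row \<open>m\<close>.\<close>

lemma column_cases:
  assumes j: "j \<in> {1..n}"
  obtains i0 where "i0 \<in> {1..n}" "\<And>i. A i j = of_bool (i = i0)"
  | k' where "j = b" "k' \<in> {m<..n}" "\<And>i. A i j = of_bool (i = k) + of_bool (i = k') - of_bool (i = m)"
proof (cases "j = d")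
  case True
  then have "A i j = of_bool (i = m)" for i
    using \<sigma>_neq_d[of i] b_less_d by (auto simp: code_mat_def)
  with that(1) m_in show thesis by blast
next
  case False
  with j have "j \<in> \<sigma> ` ({1..n} - {k})" unfolding \<sigma>_image by simp
  then obtain i0 where i0: "i0 \<in> {1..n} - {k}" "\<sigma> i0 = j" by (elim imageE) auto
  show thesis
  proof (cases "j = b")
    case True
    obtain k' where k': "k' \<in> {m<..n}" "\<sigma> k' = b" using b_below by blast
    then have k'n: "k' \<in> {1..n}" using m_in by auto
    have "i \<in> {1..n} \<and> \<sigma> i = b \<longleftrightarrow> i = k \<or> i = k'" for i
      using k' k'n \<sigma>_injD[of i k'] k_less_m k_in \<sigma>_k by auto
    then have "A i j = of_bool (i = k) + of_bool (i = k') - of_bool (i = m)" for i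
      using True k' k_less_m b_less_d by (auto simp: code_mat_def)
    with that(2) True k' show thesis by blast
  next
    case jb: False
    have "i \<in> {1..n} \<and> \<sigma> i = j \<longleftrightarrow> i = i0" for i
      using i0 jb \<sigma>_injD[of i i0] \<sigma>_k by (cases "i = k") auto
    then have "A i j = of_bool (i = i0)" for i
      using jb False by (simp add: code_mat_def)
    with that(1) i0 show thesis by blast
  qed
qed

lemma row_alt: "i \<in> {1..n} \<Longrightarrow> alt_seq (map (A i) [1..<n + 1])"
  unfolding alt_seq_map_iff[OF A_values]
  using \<sigma>_range[of i] \<sigma>_m b_less_d d_le_n b_in \<sigma>_bounds(1)[of m] m_in
  by (auto simp: row_sum of_bool_def)

lemma column_alt: "j \<in> {1..n} \<Longrightarrow> alt_seq (map (\<lambda>i. A i j) [1..<n + 1])"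
  unfolding alt_seq_map_iff[OF A_values]
  by (erule column_cases; use k_in m_in k_less_m in
    \<open>auto simp: sum.distrib sum_subtractf sum_of_bool_eq_left of_bool_def\<close>)

lemma is_asm_A: "is_asm n A"
  unfolding is_asm_def using A_values A_outside row_alt column_alt by blast

lemma A_in_asm1: "A \<in> asm1 n"
proof -
  have "{(i, j). i \<in> {1..n} \<and> j \<in> {1..n} \<and> A i j = -1} = {(m, b)}"
    using m_in b_in by (auto simp: A_eq_minus)
  then show ?thesis using is_asm_A by (simp add: asms_def)
qed

lemma minus_pos_A: "minus_pos n A = (m, b)"
  unfolding minus_pos_def using m_in b_in by (intro the_equality) (auto simp: A_eq_minus)

lemma closing_row_A [simp]: "closing_row n A = m" and opening_col_A [simp]: "opening_col n A = b"
  by (simp_all add: closing_row_def opening_col_def minus_pos_A)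

lemma opening_row_A [simp]: "opening_row n A = k"
  unfolding opening_row_def closing_row_A opening_col_A
  using k_in k_less_m \<sigma>_k \<sigma>_eq_b_le_m m_le_n
  by (intro the_equality) (auto simp: A_eq_1 simp del: atLeastAtMost_iff, auto)

lemma closing_col_A [simp]: "closing_col n A = d"
  unfolding closing_col_def closing_row_A opening_col_A
  using b_less_d d_le_n \<sigma>_m by (intro the_equality) (auto simp: A_eq_1)

lemma neutral_A: "neutral n A \<longleftrightarrow> m = k + 1"
  by (simp add: neutral_def)

lemma A_above_m: "k + 1 < m \<Longrightarrow> m - 1 \<in> {1..n} \<and> (A (m - 1) j = 1 \<longleftrightarrow> \<sigma> (m - 1) = j)"
  using m_le_n k_pos unfolding A_eq_1 by auto

lemma positive_A: "positive n A \<longleftrightarrow> k + 1 < m \<and> b < \<sigma> (m - 1)"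
  unfolding positive_def opening_row_A closing_row_A opening_col_A
  using A_above_m \<sigma>_range[of "m - 1"] by auto

lemma negative_A: "negative n A \<longleftrightarrow> k + 1 < m \<and> \<sigma> (m - 1) < b"
  unfolding negative_def opening_row_A closing_row_A opening_col_A
  using A_above_m \<sigma>_range[of "m - 1"] by auto

lemma not_negative_A: "\<not> negative n A \<longleftrightarrow> positive n A \<or> neutral n A"
  using \<sigma>_eq_b_le_m[of "m - 1"] k_less_m m_le_n k_pos
  unfolding neutral_A positive_A negative_A by fastforce

text \<open>All cells defining \<open>E\<close>, \<open>c\<close> and \<open>\<ell>\<close> avoid
  the positions \<open>(m, b)\<close> and \<open>(m, d)\<close>, so their sums only count values of
  \<open>\<sigma>\<close>.\<close>

lemma sum_A_code:
  assumes "finite I" "finite J" "m \<in> I \<Longrightarrow> b \<notin> J \<and> d \<notin> J" "I \<subseteq> {1..n}"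
  shows "(\<Sum>i\<in>I. \<Sum>j\<in>J. A i j) = int (card {i \<in> I. \<sigma> i \<in> J})"
proof -
  have "(\<Sum>i\<in>I. \<Sum>j\<in>J. A i j) = (\<Sum>i\<in>I. of_bool (\<sigma> i \<in> J))"
    using assms by (intro sum.cong) (auto simp: row_sum)
  then show ?thesis by (simp only: sum_of_bool_card assms(1))
qed

lemma charge_A: "charge n A = int (card {i \<in> {k<..<m}. b < \<sigma> i})"
proof -
  have "charge n A = int (card {i \<in> {k + 1..<m}. \<sigma> i \<in> {b + 1..n}})"
    unfolding charge_def opening_row_A closing_row_A opening_col_A
    using m_le_n by (intro sum_A_code) auto
  also have "{i \<in> {k + 1..<m}. \<sigma> i \<in> {b + 1..n}} = {i \<in> {k<..<m}. b < \<sigma> i}"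
    using m_le_n \<sigma>_bounds by auto
  finally show ?thesis .
qed

lemma cpar_A: "cpar n A = int (card {i \<in> {m<..n}. b < \<sigma> i \<and> \<sigma> i < d})"
proof -
  have "cpar n A = int (card {i \<in> {m + 1..n}. \<sigma> i \<in> {b + 1..<d}})"
    unfolding cpar_def closing_row_A opening_col_A closing_col_A
    using m_le_n by (intro sum_A_code) auto
  also have "{i \<in> {m + 1..n}. \<sigma> i \<in> {b + 1..<d}} = {i \<in> {m<..n}. b < \<sigma> i \<and> \<sigma> i < d}"
    by auto
  finally show ?thesis .
qed

definition lead :: nat where "lead = (LEAST i. k < i \<and> \<sigma> i < b)"

lemma lead: "k < lead" "\<sigma> lead < b" "lead \<le> m"
  unfolding lead_def using LeastI[of "\<lambda>i. k < i \<and> \<sigma> i < b" m] Least_le[of "\<lambda>i. k < i \<and> \<sigma> i < b" m]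
    k_less_m \<sigma>_m by auto

lemma lead_min: "k < i \<Longrightarrow> i < lead \<Longrightarrow> b \<le> \<sigma> i"
  unfolding lead_def using not_less_Least[of i "\<lambda>i. k < i \<and> \<sigma> i < b"] by auto

lemma leading_row_A: "leading_row n A = lead"
  unfolding leading_row_def opening_row_A opening_col_A
proof (rule Least_equality)
  show "k < lead \<and> (\<exists>j\<ge>1. j < b \<and> A lead j = 1)"
    using lead m_le_n \<sigma>_bounds[of lead] by (auto simp: A_eq_1)
next
  fix y assume "k < y \<and> (\<exists>j\<ge>1. j < b \<and> A y j = 1)"
  then have "k < y" "\<sigma> y < b" using b_less_d by (auto simp: A_eq_1)
  then show "lead \<le> y" using lead_min[of y] by fastforce
qed

lemma leading_col_A: "leading_col n A = \<sigma> lead"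
  unfolding leading_col_def opening_col_A leading_row_A
  using lead m_le_n \<sigma>_bounds[of lead] b_less_d by (intro the_equality) (auto simp: A_eq_1)

lemma lpar_A: "lpar n A = int (card {i \<in> {k<..n}. \<sigma> lead < \<sigma> i \<and> \<sigma> i < b})"
proof -
  have "lpar n A = int (card {i \<in> {k + 1..n}. \<sigma> i \<in> {\<sigma> lead + 1..<b}})"
    unfolding lpar_def opening_row_A opening_col_A leading_col_A
    using b_less_d by (intro sum_A_code) auto
  also have "{i \<in> {k + 1..n}. \<sigma> i \<in> {\<sigma> lead + 1..<b}} = {i \<in> {k<..n}. \<sigma> lead < \<sigma> i \<and> \<sigma> i < b}"
    by auto
  finally show ?thesis .
qed

end

text \<open>The alternation conditions at the -1 give one 1 on each of its four sides; rows and
  columns without the -1 have exactly one 1.\<close>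

lemma asm1_coded:
  assumes "A \<in> asm1 n"
  obtains k m b d \<sigma> where "coded_asm n k m b d \<sigma>" "A = code_mat n m b d \<sigma>"
proof -
  let ?S = "{(i, j). i \<in> {1..n} \<and> j \<in> {1..n} \<and> A i j = -1}"
  have asm: "is_asm n A" and "card ?S = 1" using assms by (auto simp: asms_def)
  then obtain p where "?S = {p}" by (meson card_1_singletonE)
  then obtain m b where "?S = {(m, b)}" by (cases p) auto
  then have minus: "i \<in> {1..n} \<and> j \<in> {1..n} \<and> A i j = -1 \<longleftrightarrow> i = m \<and> j = b" for i j
    by (auto simp: set_eq_iff)
  have vals: "A i j \<in> {-1, 0, 1}" for i j using asm by (auto simp: is_asm_def)
  have outside: "A i j = 0" if "\<not> (i \<in> {1..n} \<and> j \<in> {1..n})" for i j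
    using asm that unfolding is_asm_def by blast
  have ralt: "alt_seq (map (A i) [1..<n + 1])" if "i \<in> {1..n}" for i
    using asm that unfolding is_asm_def by blast
  have calt: "alt_seq (map (\<lambda>i. A i j) [1..<n + 1])" if "j \<in> {1..n}" for j
    using asm that unfolding is_asm_def by blast
  have mb: "m \<in> {1..n}" "b \<in> {1..n}" "A m b = -1" using minus by blast+
  have "\<exists>!j. j \<in> {1..<b} \<and> A m j = 1" "\<exists>!j. j \<in> {b<..n} \<and> A m j = 1"
    by (rule alt_seq_one_minus[OF vals ralt[OF mb(1)] mb(2,3)]; use minus mb in blast)+
  then obtain a d where a: "a \<in> {1..<b}" "A m a = 1" and d: "d \<in> {b<..n}" "A m d = 1"
    and au: "\<And>j. j \<in> {1..<b} \<Longrightarrow> A m j = 1 \<Longrightarrow> j = a" and du: "\<And>j. j \<in> {b<..n} \<Longrightarrow> A m j = 1 \<Longrightarrow> j = d"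
    by (metis (no_types, lifting))
  have "\<exists>!i. i \<in> {1..<m} \<and> A i b = 1" "\<exists>!i. i \<in> {m<..n} \<and> A i b = 1"
    by (rule alt_seq_one_minus[OF vals calt[OF mb(2)] mb(1,3)]; use minus mb in blast)+
  then obtain k k' where k: "k \<in> {1..<m}" "A k b = 1" and k': "k' \<in> {m<..n}" "A k' b = 1"
    and ku: "\<And>i. i \<in> {1..<m} \<Longrightarrow> A i b = 1 \<Longrightarrow> i = k" and k'u: "\<And>i. i \<in> {m<..n} \<Longrightarrow> A i b = 1 \<Longrightarrow> i = k'"
    by (metis (no_types, lifting))
  have row: "\<exists>!j. j \<in> {1..n} \<and> A i j = 1" if "i \<in> {1..n}" "i \<noteq> m" for i
    by (rule alt_seq_no_minus[OF vals ralt[OF that(1)]]) (use minus that in blast)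
  have col: "\<exists>!i. i \<in> {1..n} \<and> A i j = 1" if "j \<in> {1..n}" "j \<noteq> b" for j
    by (rule alt_seq_no_minus[OF vals calt[OF that(1)]]) (use minus that in blast)
  \<comment> \<open>Row \<open>m\<close> has two 1's: \<open>\<sigma>\<close> records the left one,
    and \<open>d\<close> the right one.\<close>
  define \<sigma> where "\<sigma> i = (if i = m then a else THE j. j \<in> {1..n} \<and> A i j = 1)" for i
  have \<sigma>: "\<sigma> i \<in> {1..n} \<and> A i (\<sigma> i) = 1" if "i \<in> {1..n}" for i
    using theI'[OF row[OF that]] a mb by (auto simp: \<sigma>_def)
  have \<sigma>u: "j = \<sigma> i" if "i \<in> {1..n}" "i \<noteq> m" "A i j = 1" for i j
    using \<sigma>[of i] row[of i] outside[of i j] that by (metis zero_neq_one)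
  have \<sigma>m: "\<sigma> m = a" by (simp add: \<sigma>_def)
  have "coded_asm n k m b d \<sigma>"
  proof
    show "1 \<le> k" "k < m" "m \<le> n" "b < d" "d \<le> n" using k mb d by auto
    show "\<sigma> k = b" "\<sigma> m < b" using \<sigma>u[of k b] k mb a \<sigma>m by auto
    show "\<exists>i\<in>{m<..n}. \<sigma> i = b" using \<sigma>u[of k' b] k' mb by (intro bexI[of _ k']) auto
    show "\<sigma> i \<in> {1..n}" if "i \<in> {1..n}" for i using \<sigma> that by blast
    show "\<sigma> i \<noteq> d" if i: "i \<in> {1..n}" for i
    proof
      assume s: "\<sigma> i = d"
      have "A i d = 1" using \<sigma>[OF i] s by simp
      then have "i = m" using col[of d] d i mb by auto
      then show False using s \<sigma>m a d by auto
    qed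
    show "inj_on \<sigma> ({1..n} - {k})"
    proof (rule inj_onI)
      fix x y assume x: "x \<in> {1..n} - {k}" and y: "y \<in> {1..n} - {k}" and e: "\<sigma> x = \<sigma> y"
      have one: "A x (\<sigma> x) = 1" "A y (\<sigma> x) = 1" "\<sigma> x \<in> {1..n}" using \<sigma>[of x] \<sigma>[of y] x y e by auto
      show "x = y"
      proof (cases "\<sigma> x = b")
        case True
        have "z = k'" if "z \<in> {1..n} - {k}" "A z b = 1" for z
          using that ku[of z] k'u[of z] mb by (cases z m rule: linorder_cases) auto
        then show ?thesis using one x y True by metis
      next
        case False
        then show ?thesis using col[of "\<sigma> x"] one x y by blast
      qed
    qed
  qed
  moreover have "A = code_mat n m b d \<sigma>"
  proof (intro ext)
    fix i j
    show "A i j = code_mat n m b d \<sigma> i j"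
    proof (cases "i \<in> {1..n} \<and> j \<in> {1..n}")
      case False
      then show ?thesis using outside[OF False] \<sigma>[of i] mb(1,2) d(1) by (auto simp: code_mat_def)
    next
      case in_n: True
      show ?thesis
      proof (cases "i = m")
        case False
        then have "A i j = 1 \<longleftrightarrow> \<sigma> i = j" "A i j \<noteq> -1"
          using in_n \<sigma>[of i] \<sigma>u[of i j] minus[of i j] by auto
        then show ?thesis using vals[of i j] False in_n by (auto simp: code_mat_def)
      next
        case True
        have "A i j = 1 \<longleftrightarrow> j = a \<or> j = d"
          using in_n True a d au[of j] du[of j] mb by (cases j b rule: linorder_cases) auto
        moreover have "A i j = -1 \<longleftrightarrow> j = b" using minus[of i j] in_n True by blast
        ultimately show ?thesis using vals[of i j] True a d mb \<sigma>m by (auto simp: code_mat_def)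
      qed
    qed
  qed
  ultimately show thesis using that by blast
qed

section \<open>Successor and predecessor in a finite set\<close>

definition nxt :: "nat set \<Rightarrow> nat \<Rightarrow> nat" where "nxt S x = Min {y \<in> S. x < y}"

definition prv :: "nat set \<Rightarrow> nat \<Rightarrow> nat" where "prv S x = Max {y \<in> S. y < x}"

lemma nxt:
  assumes "finite S" "y \<in> S" "x < y"
  shows "nxt S x \<in> S" "x < nxt S x" "nxt S x \<le> y"
proof -
  have "finite {y \<in> S. x < y}" "{y \<in> S. x < y} \<noteq> {}" using assms by auto
  from Min_in[OF this] Min_le[OF this(1), of y] show "nxt S x \<in> S" "x < nxt S x" "nxt S x \<le> y"
    using assms by (auto simp: nxt_def)
qed

lemma prv:
  assumes "finite S" "y \<in> S" "y < x"
  shows "prv S x \<in> S" "prv S x < x" "y \<le> prv S x"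
proof -
  have "finite {y \<in> S. y < x}" "{y \<in> S. y < x} \<noteq> {}" using assms by auto
  from Max_in[OF this] Max_ge[OF this(1), of y] show "prv S x \<in> S" "prv S x < x" "y \<le> prv S x"
    using assms by (auto simp: prv_def)
qed

lemma nxt_eqI:
  assumes "finite S" "y \<in> S" "x < y" "\<And>z. z \<in> S \<Longrightarrow> x < z \<Longrightarrow> y \<le> z"
  shows "nxt S x = y"
  using nxt[OF assms(1-3)] assms(4)[of "nxt S x"] by simp

lemma prv_eqI:
  assumes "finite S" "y \<in> S" "y < x" "\<And>z. z \<in> S \<Longrightarrow> z < x \<Longrightarrow> z \<le> y"
  shows "prv S x = y"
  using prv[OF assms(1-3)] assms(4)[of "prv S x"] by simp

lemma prv_nxt:
  assumes "finite S" "x \<in> S" "y \<in> S" "x < y"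
  shows "prv S (nxt S x) = x"
  using assms nxt[OF assms(1,3,4)] by (intro prv_eqI) (auto simp: not_less[symmetric] dest: nxt(3)[OF assms(1)])

lemma nxt_prv:
  assumes "finite S" "x \<in> S" "y \<in> S" "y < x"
  shows "nxt S (prv S x) = x"
  using assms prv[OF assms(1,3,4)] by (intro nxt_eqI) (auto simp: not_less[symmetric] dest: prv(3)[OF assms(1)])

section \<open>The displacements \<open>Hdisp\<close> and \<open>Vdisp\<close> as successor and
  predecessor maps\<close>

lemma nxt_shift:
  assumes "finite S" "y \<in> S" "x < y"
  shows "nxt ((\<lambda>z. z + a) ` S) (x + a) = nxt S x + a"
  using assms nxt[OF assms] nxt(3)[OF assms(1)] by (intro nxt_eqI) auto

lemma prv_shift:
  assumes "finite S" "y \<in> S" "y < x"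
  shows "prv ((\<lambda>z. z + a) ` S) (x + a) = prv S x + a"
  using assms prv[OF assms] prv(3)[OF assms(1)] by (intro prv_eqI) auto

text \<open>In \<open>Hdisp\<close> the list of nonzero columns is paired with its own tail, closed
  by \<open>q\<close>. Each column is thus paired with the next one, \<open>q\<close> counting as a
  further column.\<close>

lemma nth_tl_append_eq_nxt:
  assumes S: "finite S" "\<And>x. x \<in> S \<Longrightarrow> x < q" and s: "s < card S"
  shows "(tl (sorted_list_of_set S) @ [q]) ! s = nxt (insert q S) (sorted_list_of_set S ! s)"
proof -
  let ?L = "sorted_list_of_set S"
  have L: "length ?L = card S" "set ?L = S" "sorted_wrt (<) ?L" using S(1) by auto
  have mono: "?L ! x < ?L ! y" if "x < y" "y < card S" for x y
    using sorted_wrt_nth_less[OF L(3)] that L(1) by auto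
  have nS: "?L ! x \<in> S" if "x < card S" for x using that L nth_mem by metis
  show ?thesis
  proof (cases "Suc s < card S")
    case True
    then have e: "(tl ?L @ [q]) ! s = ?L ! Suc s" using L(1) by (auto simp: nth_append nth_tl)
    have "?L ! Suc s \<le> z" if z: "z \<in> S" "?L ! s < z" for z
    proof -
      obtain t where t: "t < card S" "z = ?L ! t" using z L by (metis in_set_conv_nth)
      have "s < t"
        using z(2) t mono[of t s] s by (metis linorder_neqE_nat order_less_irrefl order_less_trans)
      then have "Suc s = t \<or> Suc s < t" by auto
      then show ?thesis using mono[of "Suc s" t] t by auto
    qed
    then show ?thesis unfolding e
      using S nS[OF True] mono[of s "Suc s"] True by (intro nxt_eqI[symmetric]) (auto intro: less_imp_le)
  next
    case False
    then have s': "s = card S - 1" using s by simp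
    have e: "(tl ?L @ [q]) ! s = q" using L(1) s' by (simp add: nth_append)
    have "\<not> ?L ! s < z" if z: "z \<in> S" for z
    proof -
      obtain t where t: "t < card S" "z = ?L ! t" using z L by (metis in_set_conv_nth)
      then have "t = s \<or> t < s" using s' by auto
      then show ?thesis using mono[of t s] t s by auto
    qed
    then show ?thesis unfolding e using S nS[OF s] by (intro nxt_eqI[symmetric]) auto
  qed
qed

text \<open>Mirror image for \<open>Vdisp\<close>: each nonzero row is paired with the previous one,
  the first with the added row \<open>p\<close>.\<close>

lemma nth_Cons_butlast_eq_prv:
  assumes S: "finite S" "\<And>x. x \<in> S \<Longrightarrow> p < x" and s: "s < card S"
  shows "(p # butlast (sorted_list_of_set S)) ! s = prv (insert p S) (sorted_list_of_set S ! s)"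
proof -
  let ?L = "sorted_list_of_set S"
  have L: "length ?L = card S" "set ?L = S" "sorted_wrt (<) ?L" using S(1) by auto
  have mono: "?L ! x < ?L ! y" if "x < y" "y < card S" for x y
    using sorted_wrt_nth_less[OF L(3)] that L(1) by auto
  have nS: "?L ! x \<in> S" if "x < card S" for x using that L nth_mem by metis
  show ?thesis
  proof (cases s)
    case (Suc r)
    then have e: "(p # butlast ?L) ! s = ?L ! r" using L(1) s by (simp add: nth_butlast)
    have "z \<le> ?L ! r" if z: "z \<in> S" "z < ?L ! s" for z
    proof -
      obtain t where t: "t < card S" "z = ?L ! t" using z L by (metis in_set_conv_nth)
      have "t < s"
        using z(2) t mono[of s t] by (metis linorder_neqE_nat order_less_irrefl order_less_trans)
      then have "t = r \<or> t < r" using Suc by auto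
      then show ?thesis using mono[of t r] t s Suc by auto
    qed
    then show ?thesis unfolding e
      using S nS[of r] mono[of r s] Suc s by (intro prv_eqI[symmetric]) (auto intro: less_imp_le)
  next
    case 0
    have "\<not> z < ?L ! 0" if z: "z \<in> S" for z
    proof -
      obtain t where t: "t < card S" "z = ?L ! t" using z L by (metis in_set_conv_nth)
      then show ?thesis using mono[of 0 t] by (cases t) auto
    qed
    then show ?thesis using S nS[OF s] 0 by (auto intro!: prv_eqI[symmetric])
  qed
qed

lemma sum_nth_sorted_list_of_set:
  "finite S \<Longrightarrow> (\<Sum>s<card S. g (sorted_list_of_set S ! s)) = sum g S"
  by (rule sum.reindex_bij_betw, rule bij_betw_nth) auto

lemma Hdisp_eq:
  assumes S: "S = {j' \<in> {1..q}. \<exists>i'\<in>{1..m}. P i' j' \<noteq> 0}" "q \<notin> S" and ij: "i \<in> {1..m}" "j \<in> {1..q}"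
  shows "Hdisp m q P i j = (\<Sum>x\<in>S. if nxt (insert q S) x = j then P i x else 0)"
proof -
  have fin: "finite S" using S by auto
  have "x < q" if "x \<in> S" for x using that S by (metis (no_types, lifting) atLeastAtMost_iff mem_Collect_eq nat_less_le)
  note nth = nth_tl_append_eq_nxt[OF fin this]
  have "Hdisp m q P i j = (\<Sum>s<card S. if (tl (sorted_list_of_set S) @ [q]) ! s = j
      then P i (sorted_list_of_set S ! s) else 0)"
    using ij fin unfolding Hdisp_def Let_def S(1)[symmetric] by auto
  also have "\<dots> = (\<Sum>s<card S. if nxt (insert q S) (sorted_list_of_set S ! s) = j
      then P i (sorted_list_of_set S ! s) else 0)"
    by (intro sum.cong refl) (simp add: nth)
  finally show ?thesis by (simp only: sum_nth_sorted_list_of_set[OF fin, of "\<lambda>x. if nxt (insert q S) x = j then P i x else 0"])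
qed

lemma Vdisp_eq:
  assumes S: "S = {i' \<in> {1..m}. \<exists>j'\<in>{1..q}. P i' j' \<noteq> 0}" "1 \<notin> S" and ij: "i \<in> {1..m}" "j \<in> {1..q}"
  shows "Vdisp m q P i j = (\<Sum>x\<in>S. if prv (insert 1 S) x = i then P x j else 0)"
proof -
  have fin: "finite S" using S by auto
  have "1 < x" if "x \<in> S" for x using that S by (metis (no_types, lifting) atLeastAtMost_iff mem_Collect_eq nat_less_le)
  note nth = nth_Cons_butlast_eq_prv[OF fin this]
  have "Vdisp m q P i j = (\<Sum>s<card S. if (1 # butlast (sorted_list_of_set S)) ! s = i
      then P (sorted_list_of_set S ! s) j else 0)"
    using ij fin unfolding Vdisp_def Let_def S(1)[symmetric] by auto
  also have "\<dots> = (\<Sum>s<card S. if prv (insert 1 S) (sorted_list_of_set S ! s) = i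
      then P (sorted_list_of_set S ! s) j else 0)"
    by (intro sum.cong refl) (simp only: lessThan_iff nth)
  finally show ?thesis by (simp only: sum_nth_sorted_list_of_set[OF fin, of "\<lambda>x. if prv (insert 1 S) x = i then P x j else 0"])
qed


section \<open>The discharging procedure on codes\<close>

definition perm_mat :: "nat \<Rightarrow> (nat \<Rightarrow> nat) \<Rightarrow> mat" where
  "perm_mat n \<pi> = (\<lambda>i j. of_bool (i \<in> {1..n} \<and> \<pi> i = j))"

text \<open>The net effect of steps (3) and (4) on a row between the opening and the closing row:
  displaced upwards inside \<open>T\<close> and then lowered by one.\<close>

definition lower :: "nat set \<Rightarrow> nat \<Rightarrow> nat" where
  "lower T i = (if i \<in> T then prv T i + 1 else i + 1)"

lemma lower_range:
  assumes T: "finite T" "k \<in> T" "m \<in> T" and i: "i \<in> {k<..m}"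
  shows "lower T i \<in> {k<..m}"
  using prv[OF T(1,2), of i] T(3) i by (cases "i = m") (auto simp: lower_def)

text \<open>The row just above \<open>lower T i\<close> belongs to \<open>T\<close> exactly when
  \<open>i\<close> does, so the two branches cannot collide; inside \<open>T\<close> the successor
  undoes the predecessor.\<close>

lemma lower_inj:
  assumes T: "finite T" "k \<in> T"
  shows "inj_on (lower T) {k<..m}"
proof (rule inj_onI)
  fix i i' assume i: "i \<in> {k<..m}" "i' \<in> {k<..m}" "lower T i = lower T i'"
  have p: "prv T i \<in> T" "prv T i' \<in> T" using prv(1)[OF T] i by auto
  show "i = i'"
  proof (cases "i \<in> T \<and> i' \<in> T")
    case True
    then have "prv T i = prv T i'" using i by (simp add: lower_def)
    moreover have "nxt T (prv T i) = i" "nxt T (prv T i') = i'"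
      using True i by (auto intro: nxt_prv[OF T(1) _ T(2)])
    ultimately show ?thesis by metis
  next
    case False
    then show ?thesis using i p by (auto simp: lower_def split: if_splits)
  qed
qed

lemma lower_image:
  assumes T: "finite T" "k \<in> T" "m \<in> T"
  shows "lower T ` {k<..m} = {k<..m}"
  using lower_range[OF T] lower_inj[OF T(1,2)] by (intro endo_inj_surj) auto

context coded_asm
begin

text \<open>\<open>Tr\<close> lists the rows whose left part is moved by the vertical displacement, together with the
  opening row; \<open>Tc\<close> the columns moved by the horizontal displacement, together with the closing
  column.\<close>

definition Tr :: "nat set" where "Tr = insert k {i \<in> {k<..m}. \<sigma> i < b}"

definition Tc :: "nat set" where "Tc = insert d {v. b \<le> v \<and> v < d \<and> (\<exists>i\<in>{m<..n}. \<sigma> i = v)}"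

abbreviation row_move :: "nat \<Rightarrow> nat" where
  "row_move \<equiv> lower Tr"

definition col_move :: "nat \<Rightarrow> nat" where
  "col_move i = (if m < i \<and> b \<le> \<sigma> i \<and> \<sigma> i < d then nxt Tc (\<sigma> i) else \<sigma> i)"

text \<open>Stated as a relation, with the moved row as argument of \<open>\<pi>\<close>, so that
  \<open>row_move\<close> need not be inverted.\<close>

definition discharges_to :: "(nat \<Rightarrow> nat) \<Rightarrow> bool" where
  "discharges_to \<pi> \<longleftrightarrow> (\<forall>i\<in>{1..k}. \<pi> i = \<sigma> i) \<and> (\<forall>i\<in>{k<..m}. \<pi> (row_move i) = \<sigma> i) \<and>
     (\<forall>i\<in>{m<..n}. \<pi> i = col_move i)"

lemma Tr: "finite Tr" "k \<in> Tr" "m \<in> Tr" "Tr \<subseteq> {k..m}"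
  using k_less_m \<sigma>_m by (auto simp: Tr_def)

lemma Tr_iff: "i \<in> {k<..m} \<Longrightarrow> i \<in> Tr \<longleftrightarrow> \<sigma> i < b"
  by (auto simp: Tr_def)

lemma \<sigma>_neq_b: "i \<in> {k<..m} \<Longrightarrow> \<sigma> i \<noteq> b"
  using \<sigma>_eq_b_le_m[of i] k_pos by auto

lemma prv_Tr: "i \<in> {k<..m} \<Longrightarrow> prv Tr i \<in> Tr" "i \<in> {k<..m} \<Longrightarrow> k \<le> prv Tr i" "i \<in> {k<..m} \<Longrightarrow> prv Tr i < i"
  using prv[OF Tr(1,2), of i] by auto

lemmas row_move_range = lower_range[OF Tr(1,2,3)]
  and row_move_inj = lower_inj[OF Tr(1,2), of m]
  and row_move_image = lower_image[OF Tr(1,2,3)]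

lemma lead_eq_nxt: "lead = nxt Tr k"
proof (rule nxt_eqI[symmetric])
  show "lead \<in> Tr" using lead by (auto simp: Tr_def)
  show "lead \<le> z" if "z \<in> Tr" "k < z" for z
    using that lead_min[of z] by (fastforce simp: Tr_def)
qed (use Tr lead in auto)

text \<open>The leading 1 is the first left entry below row \<open>k\<close>: it is displaced up to
  row \<open>k\<close> and then lowered by one. This later makes \<open>\<pi> k\<close> a
  descent.\<close>

lemma row_move_lead: "row_move lead = k + 1"
proof -
  have "lead \<in> Tr" using lead by (auto simp: Tr_def)
  moreover have "prv Tr lead = k"
    unfolding lead_eq_nxt using Tr k_less_m by (intro prv_nxt) auto
  ultimately show ?thesis by (simp add: lower_def)
qed

lemma Tc: "finite Tc" "b \<in> Tc" "d \<in> Tc" "Tc \<subseteq> {b..d}"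
  using b_less_d b_below by (auto simp: Tc_def)

lemma Tc_\<sigma>: "i \<in> {m<..n} \<Longrightarrow> b \<le> \<sigma> i \<Longrightarrow> \<sigma> i < d \<Longrightarrow> \<sigma> i \<in> Tc"
  by (auto simp: Tc_def)

lemma nxt_Tc: "v < d \<Longrightarrow> nxt Tc v \<in> Tc" "v < d \<Longrightarrow> v < nxt Tc v" "v < d \<Longrightarrow> nxt Tc v \<le> d"
  using nxt[OF Tc(1,3), of v] by auto

text \<open>The steps of the procedure are followed one at a time: each intermediate matrix is a 0-1
  matrix described by \<open>\<sigma>\<close>, \<open>col_move\<close> or predecessors in
  \<open>Tr\<close>.\<close>

lemma delta_A:
  assumes "discharges_to \<pi>"
  shows "delta n A = perm_mat n \<pi>"
proof -
  have \<pi>1: "\<pi> i = \<sigma> i" if "i \<in> {1..k}" for i using that assms by (simp add: discharges_to_def)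
  have \<pi>2: "\<pi> (row_move i) = \<sigma> i" if "i \<in> {k<..m}" for i using that assms by (simp add: discharges_to_def)
  have \<pi>3: "\<pi> i = col_move i" if "i \<in> {m<..n}" for i using that assms by (simp add: discharges_to_def)
  \<comment> \<open>These definitions copy the bindings inside \<open>delta\<close>, with the
    positions already evaluated.\<close>
  define A1 where "A1 = (\<lambda>i j. if i = m \<and> (j = b \<or> j = d) then 0 else A i j)"
  define P2 where "P2 = (\<lambda>i j. if 1 \<le> i \<and> i \<le> n - m \<and> 1 \<le> j \<and> j \<le> d - b + 1 then A1 (m + i) (b - 1 + j) else 0)"
  define H2 where "H2 = Hdisp (n - m) (d - b + 1) P2"
  define A2 where "A2 = (\<lambda>i j. if m < i \<and> i \<le> n \<and> b \<le> j \<and> j \<le> d then H2 (i - m) (j - b + 1) else A1 i j)"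
  define P3 where "P3 = (\<lambda>i j. if 1 \<le> i \<and> i \<le> m - k + 1 \<and> 1 \<le> j \<and> j \<le> b - 1 then A2 (k - 1 + i) j else 0)"
  define V3 where "V3 = Vdisp (m - k + 1) (b - 1) P3"
  define A3 where "A3 = (\<lambda>i j. if k \<le> i \<and> i \<le> m \<and> 1 \<le> j \<and> j < b then V3 (i - k + 1) j else A2 i j)"
  have delta: "delta n A = (\<lambda>t j.
          if 1 \<le> j \<and> j < b \<and> k + 1 \<le> t \<and> t \<le> m then A3 (t - 1) j
          else if 1 \<le> j \<and> j < b \<and> t = k then 0
          else if b < j \<and> j \<le> n \<and> k + 2 \<le> t \<and> t \<le> m then A3 (t - 1) j
          else if b < j \<and> j \<le> n \<and> t = k + 1 then 0
          else A3 t j)"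
    unfolding delta_def Let_def closing_row_A opening_row_A opening_col_A closing_col_A
    by (simp only: A1_def P2_def H2_def A2_def P3_def V3_def A3_def)
  have A1: "A1 i j = of_bool (i \<in> {1..n} \<and> \<sigma> i = j)" for i j
    using \<sigma>_m \<sigma>_neq_d[OF m_in] by (auto simp: A1_def code_mat_def)
  have b1: "1 \<le> b" using b_in by simp
  have H2: "H2 (i - m) (j - b + 1) = of_bool (col_move i = j)"
    if i: "m < i" "i \<le> n" and j: "b \<le> j" "j \<le> d" for i j
  proof -
    define S where "S = {j' \<in> {1..d - b + 1}. \<exists>i'\<in>{1..n - m}. P2 i' j' \<noteq> 0}"
    have P2: "P2 i' x = of_bool (\<sigma> (m + i') = b - 1 + x)" if "i' \<in> {1..n - m}" "x \<in> {1..d - b + 1}" for i' x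
      using that by (auto simp: P2_def A1)
    have S_iff: "x \<in> S \<longleftrightarrow> 1 \<le> x \<and> x \<le> d - b + 1 \<and> (\<exists>i\<in>{m<..n}. \<sigma> i = b - 1 + x)" for x
    proof -
      have "(\<exists>i'\<in>{1..n - m}. \<sigma> (m + i') = b - 1 + x) \<longleftrightarrow> (\<exists>i\<in>{m<..n}. \<sigma> i = b - 1 + x)"
      proof
        assume "\<exists>i\<in>{m<..n}. \<sigma> i = b - 1 + x"
        then obtain i where "i \<in> {m<..n}" "\<sigma> i = b - 1 + x" by blast
        then show "\<exists>i'\<in>{1..n - m}. \<sigma> (m + i') = b - 1 + x" by (intro bexI[of _ "i - m"]) auto
      qed (auto intro!: bexI[of _ "m + _"])
      moreover have "(\<exists>i'\<in>{1..n - m}. P2 i' x \<noteq> 0) \<longleftrightarrow> (\<exists>i'\<in>{1..n - m}. \<sigma> (m + i') = b - 1 + x)"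
        if "x \<in> {1..d - b + 1}" using P2 that by simp
      ultimately show ?thesis by (auto simp only: S_def mem_Collect_eq atLeastAtMost_iff)
    qed
    \<comment> \<open>Column \<open>d\<close> is empty below row \<open>m\<close> because
      \<open>\<sigma>\<close> misses \<open>d\<close>, as the horizontal displacement
      requires.\<close>
    have qS: "d - b + 1 \<notin> S"
    proof
      assume "d - b + 1 \<in> S"
      then obtain i where "i \<in> {m<..n}" "\<sigma> i = b - 1 + (d - b + 1)" unfolding S_iff by blast
      then show False using \<sigma>_neq_d[of i] b_less_d b1 by auto
    qed
    \<comment> \<open>Column \<open>x\<close> of the extended closing cell is column
      \<open>b - 1 + x\<close> of the matrix.\<close>
    have Tc_S: "Tc = (\<lambda>z. z + (b - 1)) ` insert (d - b + 1) S"
    proof (intro set_eqI iffI)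
      fix v assume "v \<in> Tc"
      then have "v - (b - 1) \<in> insert (d - b + 1) S \<and> v = v - (b - 1) + (b - 1)"
        using b1 b_less_d by (auto simp: Tc_def S_iff)
      then show "v \<in> (\<lambda>z. z + (b - 1)) ` insert (d - b + 1) S" by blast
    next
      fix v assume "v \<in> (\<lambda>z. z + (b - 1)) ` insert (d - b + 1) S"
      then obtain z where z: "v = z + (b - 1)" "z = d - b + 1 \<or> z \<in> S" by blast
      from z(2) show "v \<in> Tc"
      proof
        assume "z = d - b + 1"
        then show ?thesis using z(1) b1 b_less_d by (simp add: Tc_def)
      next
        assume zS: "z \<in> S"
        then have "z \<noteq> d - b + 1" using qS by blast
        moreover obtain i where "i \<in> {m<..n}" "\<sigma> i = v"
          using zS z(1) unfolding S_iff by (auto simp: add.commute)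
        moreover have "1 \<le> z" "z \<le> d - b + 1" using zS unfolding S_iff by auto
        ultimately show ?thesis using z(1) b1 by (auto simp: Tc_def)
      qed
    qed
    have finS: "finite S" by (simp add: S_def)
    have "H2 (i - m) (j - b + 1) =
        (\<Sum>x\<in>S. if nxt (insert (d - b + 1) S) x = j - b + 1 then P2 (i - m) x else 0)"
      unfolding H2_def using i j by (intro Hdisp_eq[OF S_def qS]) auto
    also have "\<dots> = (\<Sum>x\<in>S. of_bool (nxt (insert (d - b + 1) S) x = j - b + 1 \<and> \<sigma> i = b - 1 + x))"
    proof (intro sum.cong refl)
      fix x assume "x \<in> S"
      then have "P2 (i - m) x = of_bool (\<sigma> i = b - 1 + x)"
        using P2[of "i - m" x] i by (simp add: S_iff Suc_leI)
      then show "(if nxt (insert (d - b + 1) S) x = j - b + 1 then P2 (i - m) x else 0) =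
        of_bool (nxt (insert (d - b + 1) S) x = j - b + 1 \<and> \<sigma> i = b - 1 + x)" by simp
    qed
    also have "\<dots> = of_bool (col_move i = j)"
    proof (cases "b \<le> \<sigma> i \<and> \<sigma> i < d")
      case True
      define x where "x = \<sigma> i - (b - 1)"
      have x: "\<sigma> i = b - 1 + x" "x \<in> S" using True b1 i by (auto simp: x_def S_iff)
      have "nxt Tc (x + (b - 1)) = nxt (insert (d - b + 1) S) x + (b - 1)"
        unfolding Tc_S using finS x True by (intro nxt_shift[of _ "d - b + 1"]) auto
      then have c: "col_move i = nxt (insert (d - b + 1) S) x + (b - 1)"
        using True i x(1) by (simp add: col_move_def add.commute)
      have "(\<Sum>y\<in>S. of_bool (nxt (insert (d - b + 1) S) y = j - b + 1 \<and> \<sigma> i = b - 1 + y)) =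
         (\<Sum>y\<in>S. of_bool (nxt (insert (d - b + 1) S) x = j - b + 1 \<and> x = y) :: int)"
        using x by (intro sum.cong) auto
      also have "\<dots> = of_bool (nxt (insert (d - b + 1) S) x = j - b + 1)"
        using x finS by (subst sum_of_bool_eq_right) auto
      also have "\<dots> = of_bool (col_move i = j)"
        using c j b1 by auto
      finally show ?thesis .
    next
      case False
      then have "col_move i \<noteq> j" using j \<sigma>_neq_d[of i] i by (auto simp: col_move_def)
      moreover have "\<sigma> i \<noteq> b - 1 + x" if "x \<in> S" for x
        using that False \<sigma>_neq_d[of i] i b1 b_less_d by (auto simp: S_iff)
      ultimately show ?thesis by simp
    qed
    finally show ?thesis .
  qed
  have A2: "A2 i j = of_bool (i \<in> {1..n} \<and> col_move i = j)" for i j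
  proof (cases "m < i \<and> i \<le> n \<and> b \<le> j \<and> j \<le> d")
    case True
    then show ?thesis using H2 by (simp add: A2_def)
  next
    case False
    then have "i \<in> {1..n} \<and> \<sigma> i = j \<longleftrightarrow> i \<in> {1..n} \<and> col_move i = j"
      using nxt_Tc[of "\<sigma> i"] by (auto simp: col_move_def)
    then show ?thesis using False by (auto simp: A2_def A1)
  qed
  have A2': "A2 i j = of_bool (i \<in> {1..n} \<and> \<sigma> i = j)" if "i \<le> m" for i j
    using that by (simp add: A2 col_move_def)
  have V3: "V3 (i - k + 1) j = of_bool (\<exists>r\<in>{k<..m}. prv Tr r = i \<and> \<sigma> r = j)"
    if i: "k \<le> i" "i \<le> m" and j: "1 \<le> j" "j < b" for i j
  proof -
    define S where "S = {i' \<in> {1..m - k + 1}. \<exists>j'\<in>{1..b - 1}. P3 i' j' \<noteq> 0}"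
    have P3: "P3 x j' = of_bool (\<sigma> (k - 1 + x) = j')" if "x \<in> {1..m - k + 1}" "j' \<in> {1..b - 1}" for x j'
      using that A2'[of "k - 1 + x" j'] k_pos k_less_m m_le_n by (auto simp: P3_def)
    have S_iff: "x \<in> S \<longleftrightarrow> 1 \<le> x \<and> x \<le> m - k + 1 \<and> \<sigma> (k - 1 + x) < b" for x
    proof -
      have "(\<exists>j'\<in>{1..b - 1}. \<sigma> (k - 1 + x) = j') \<longleftrightarrow> \<sigma> (k - 1 + x) < b" if "1 \<le> x" "x \<le> m - k + 1"
        using \<sigma>_bounds(1)[of "k - 1 + x"] that k_less_m m_le_n k_pos b1 by auto
      then show ?thesis by (auto simp: S_def P3)
    qed
    \<comment> \<open>The left part of the opening row is empty since its 1 is in column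
      \<open>b\<close>; the vertical displacement can move into it.\<close>
    have oneS: "1 \<notin> S" using \<sigma>_k k_pos by (simp add: S_iff)
    have Tr_S: "Tr = (\<lambda>z. z + (k - 1)) ` insert 1 S"
    proof (intro set_eqI iffI)
      fix v assume "v \<in> Tr"
      then have "v - (k - 1) \<in> insert 1 S \<and> v = v - (k - 1) + (k - 1)"
        using k_pos k_less_m by (auto simp: Tr_def S_iff)
      then show "v \<in> (\<lambda>z. z + (k - 1)) ` insert 1 S" by blast
    next
      fix v assume "v \<in> (\<lambda>z. z + (k - 1)) ` insert 1 S"
      then obtain z where z: "v = z + (k - 1)" "z = 1 \<or> z \<in> S" by blast
      have "z \<in> S \<Longrightarrow> z \<noteq> 1" using oneS by blast
      with z show "v \<in> Tr" using k_pos k_less_m by (auto simp: Tr_def S_iff add.commute)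
    qed
    have finS: "finite S" by (simp add: S_def)
    have prvS: "prv Tr (k - 1 + x) = prv (insert 1 S) x + (k - 1)" if "x \<in> S" for x
    proof -
      have "1 < x" using that oneS by (metis S_iff le_neq_implies_less)
      then show ?thesis
        unfolding Tr_S add.commute[of "k - 1" x] using finS that by (intro prv_shift[of _ 1]) auto
    qed
    have "V3 (i - k + 1) j = (\<Sum>x\<in>S. if prv (insert 1 S) x = i - k + 1 then P3 x j else 0)"
      unfolding V3_def using i j by (intro Vdisp_eq[OF S_def oneS]) auto
    also have "\<dots> = (\<Sum>x\<in>S. of_bool (prv Tr (k - 1 + x) = i \<and> \<sigma> (k - 1 + x) = j))"
    proof (intro sum.cong refl)
      fix x assume x: "x \<in> S"
      then have "P3 x j = of_bool (\<sigma> (k - 1 + x) = j)" using P3[of x j] j by (simp add: S_iff)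
      moreover have "prv (insert 1 S) x = i - k + 1 \<longleftrightarrow> prv Tr (k - 1 + x) = i"
        using prvS[OF x] i k_pos by linarith
      ultimately show "(if prv (insert 1 S) x = i - k + 1 then P3 x j else 0) =
        of_bool (prv Tr (k - 1 + x) = i \<and> \<sigma> (k - 1 + x) = j)" by simp
    qed
    also have "\<dots> = of_bool (\<exists>r\<in>{k<..m}. prv Tr r = i \<and> \<sigma> r = j)"
    proof (cases "\<exists>r\<in>{k<..m}. \<sigma> r = j")
      case True
      then obtain r where r: "r \<in> {k<..m}" "\<sigma> r = j" by blast
      have ru: "r' = r" if "r' \<in> {k<..m}" "\<sigma> r' = j" for r'
        using that r \<sigma>_injD[of r' r] k_pos m_le_n by auto
      define x where "x = r - (k - 1)"
      have x: "x \<in> S" "r = k - 1 + x" using r j by (auto simp: x_def S_iff)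
      have "(\<Sum>y\<in>S. of_bool (prv Tr (k - 1 + y) = i \<and> \<sigma> (k - 1 + y) = j)) =
          (\<Sum>y\<in>S. of_bool (prv Tr r = i \<and> x = y) :: int)"
      proof (intro sum.cong refl)
        fix y assume y: "y \<in> S"
        then have "k - 1 + y \<in> {k<..m}" using oneS k_pos k_less_m by (cases "y = 1") (auto simp: S_iff)
        then have "\<sigma> (k - 1 + y) = j \<longleftrightarrow> x = y" using ru[of "k - 1 + y"] r x by auto
        then show "of_bool (prv Tr (k - 1 + y) = i \<and> \<sigma> (k - 1 + y) = j) = (of_bool (prv Tr r = i \<and> x = y) :: int)"
          using x by auto
      qed
      also have "\<dots> = of_bool (prv Tr r = i)" using x finS by (subst sum_of_bool_eq_right) auto
      also have "prv Tr r = i \<longleftrightarrow> (\<exists>r\<in>{k<..m}. prv Tr r = i \<and> \<sigma> r = j)"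
      proof
        assume "\<exists>r\<in>{k<..m}. prv Tr r = i \<and> \<sigma> r = j"
        then obtain r' where "r' \<in> {k<..m}" "prv Tr r' = i" "\<sigma> r' = j" by blast
        then show "prv Tr r = i" using ru[of r'] by simp
      qed (use r in blast)
      finally show ?thesis .
    next
      case False
      have "\<sigma> (k - 1 + y) \<noteq> j" if y: "y \<in> S" for y
      proof -
        have "k - 1 + y \<in> {k<..m}" using y oneS k_pos k_less_m by (cases "y = 1") (auto simp: S_iff)
        then show ?thesis using False by blast
      qed
      then show ?thesis using False by (auto intro!: sum.neutral)
    qed
    finally show ?thesis .
  qed
  have A3: "A3 i j = of_bool (\<exists>r\<in>{k<..m}. prv Tr r = i \<and> \<sigma> r = j)" if "k \<le> i" "i \<le> m" "1 \<le> j" "j < b" for i j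
    using V3[OF that] that by (simp add: A3_def)
  have A3': "A3 i j = A2 i j" if "\<not> (k \<le> i \<and> i \<le> m \<and> 1 \<le> j \<and> j < b)" for i j
    using that by (auto simp: A3_def)
  have "delta n A t j = of_bool (t \<in> {1..n} \<and> \<pi> t = j)" for t j
  proof (cases "t \<in> {k<..m}")
    case True
    then have "t \<in> row_move ` {k<..m}" unfolding row_move_image .
    \<comment> \<open>\<open>r\<close> is the row whose 1 should end up in row \<open>t\<close>; the
      columns of row \<open>t\<close> are now compared with row \<open>r\<close> of the
      code.\<close>
    then obtain r where r: "r \<in> {k<..m}" "row_move r = t" by (elim imageE) auto
    have \<pi>t: "\<pi> t = \<sigma> r" using \<pi>2[OF r(1)] r(2) by simp
    have tn: "t \<in> {1..n}" using True k_pos m_le_n by auto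
    have \<sigma>r: "\<sigma> r \<in> {1..n}" using r(1) m_le_n k_pos by (intro \<sigma>_range) auto
    consider "1 \<le> j" "j < b" | "j = b" | "b < j" "j \<le> n" "t = k + 1" | "b < j" "j \<le> n" "k + 2 \<le> t" | "j = 0 \<or> n < j"
      using True by force
    then show ?thesis
    proof cases
      case 1
      have "(\<exists>r'\<in>{k<..m}. prv Tr r' = t - 1 \<and> \<sigma> r' = j) \<longleftrightarrow> \<sigma> r = j"
      proof
        assume "\<exists>r'\<in>{k<..m}. prv Tr r' = t - 1 \<and> \<sigma> r' = j"
        then obtain r' where r': "r' \<in> {k<..m}" "prv Tr r' = t - 1" "\<sigma> r' = j" by blast
        then have "row_move r' = t" using 1 True Tr_iff[of r'] by (auto simp: lower_def)
        then have "r' = r" using inj_onD[OF row_move_inj _ r'(1) r(1)] r(2) by simp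
        then show "\<sigma> r = j" using r' by simp
      next
        assume "\<sigma> r = j"
        then have "prv Tr r = t - 1" using r 1 Tr_iff[of r] by (auto simp: lower_def split: if_splits)
        then show "\<exists>r'\<in>{k<..m}. prv Tr r' = t - 1 \<and> \<sigma> r' = j" using r \<open>\<sigma> r = j\<close> by blast
      qed
      moreover have "k \<le> t - 1" "t - 1 \<le> m" using True by auto
      ultimately show ?thesis using 1 True tn \<pi>t A3[of "t - 1" j] unfolding delta by simp
    next
      case 2
      then show ?thesis using True tn \<pi>t \<sigma>_neq_b[OF r(1)] \<sigma>_neq_b[OF True] A2'[of t j] A3'[of t j]
        unfolding delta by simp
    next
      case 3
      \<comment> \<open>A right entry reaching row \<open>k + 1\<close> would come from row
        \<open>k\<close>, which lies above the moved block. So \<open>r\<close> is a left row and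
        the zero prescribed by step (4) is correct.\<close>
      have "r \<in> Tr" using r 3 by (auto simp: lower_def split: if_splits)
      then show ?thesis using 3 \<pi>t Tr_iff[OF r(1)] unfolding delta by simp
    next
      case 4
      \<comment> \<open>Right entries fall by one row. If \<open>r\<close> is a left row, then row
        \<open>t - 1\<close> is in \<open>Tr\<close> as well, and neither row has a 1 in the right
        side.\<close>
      have "\<sigma> (t - 1) = j \<longleftrightarrow> \<sigma> r = j"
      proof (cases "r \<in> Tr")
        case True
        then have "t - 1 \<in> Tr" using r prv_Tr(1)[of r] by (auto simp: lower_def)
        then have "\<sigma> (t - 1) \<le> b" using \<sigma>_k by (auto simp: Tr_def)
        then show ?thesis using True Tr_iff[OF r(1)] 4 by auto
      next
        case False
        then show ?thesis using r by (auto simp: lower_def)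
      qed
      moreover have "t - 1 \<in> {1..n}" "t - 1 \<le> m" using 4 True m_le_n by auto
      ultimately show ?thesis
        using 4 True tn \<pi>t A3'[of "t - 1" j] A2'[of "t - 1" j] unfolding delta by simp
    next
      case 5
      have "\<sigma> t \<noteq> j" using \<sigma>_bounds[of t] tn 5 by auto
      then show ?thesis using 5 True \<pi>t \<sigma>r b_in A3'[of t j] A2'[of t j] unfolding delta by auto
    qed
  next
    case False
    show ?thesis
    proof (cases "t = k")
      case True
      then have "\<pi> t = b" using \<pi>1[of k] \<sigma>_k k_pos by simp
      then show ?thesis
        using True k_in k_less_m \<sigma>_k b1 A3'[of t j] A2'[of t j] unfolding delta by auto
    next
      case tk: False
      then have "delta n A t j = of_bool (t \<in> {1..n} \<and> col_move t = j)"
        using False k_less_m A3'[of t j] A2[of t j] unfolding delta by auto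
      moreover have "\<pi> t = col_move t" if "t \<in> {1..n}"
        using that False tk \<pi>1[of t] \<pi>3[of t] k_less_m by (cases "t < k") (auto simp: col_move_def)
      ultimately show ?thesis by auto
    qed
  qed
  then show ?thesis by (simp add: perm_mat_def fun_eq_iff)
qed

end

section \<open>The discharged code is a permutation\<close>

context coded_asm
begin

lemma col_move_le_m: "i \<le> m \<Longrightarrow> col_move i = \<sigma> i"
  by (simp add: col_move_def)

lemma col_move_cases:
  assumes i: "i \<in> {m<..n}"
  obtains "b \<le> \<sigma> i" "\<sigma> i < d" "\<sigma> i \<in> Tc" "col_move i = nxt Tc (\<sigma> i)" "nxt Tc (\<sigma> i) \<in> Tc"
    "\<sigma> i < col_move i" "col_move i \<le> d" "prv Tc (col_move i) = \<sigma> i"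
  | "\<sigma> i < b \<or> d < \<sigma> i" "col_move i = \<sigma> i"
proof (cases "b \<le> \<sigma> i \<and> \<sigma> i < d")
  case True
  then have "\<sigma> i \<in> Tc" using Tc_\<sigma> i by blast
  moreover have "prv Tc (nxt Tc (\<sigma> i)) = \<sigma> i"
    using calculation True by (intro prv_nxt[OF Tc(1) _ Tc(3)]) auto
  ultimately show thesis
    using that(1) True i nxt_Tc[of "\<sigma> i"] by (simp add: col_move_def)
next
  case False
  moreover have "\<sigma> i \<noteq> d" using \<sigma>_neq_d[of i] i by auto
  ultimately show thesis using that(2) by (auto simp: col_move_def)
qed

lemma col_move_mid: "i \<in> {m<..n} \<Longrightarrow> b < col_move i \<and> col_move i \<le> d \<longleftrightarrow> b \<le> \<sigma> i \<and> \<sigma> i < d"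
  by (erule col_move_cases) (use b_less_d in auto)

lemma col_move_range: "i \<in> {1..n} \<Longrightarrow> col_move i \<in> {1..n}"
proof (cases "i \<le> m")
  case True
  then show "i \<in> {1..n} \<Longrightarrow> ?thesis" using \<sigma>_range[of i] by (simp only: col_move_le_m)
next
  case False
  assume "i \<in> {1..n}"
  with False have i: "i \<in> {m<..n}" by simp
  have "1 \<le> \<sigma> i" "\<sigma> i \<le> n" using \<sigma>_bounds[of i] i by auto
  then show ?thesis using i d_le_n by (elim col_move_cases) auto
qed

text \<open>When both values move, the successor of the smaller is at most the larger, which itself
  moves up; an unmoved value lies outside the interval from \<open>b\<close> to
  \<open>d\<close>.\<close>

lemma col_move_less:
  assumes i: "i \<in> {m<..n}" and i': "i' \<in> {m<..n}" and less: "\<sigma> i < \<sigma> i'"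
  shows "col_move i < col_move i'"
  using i
proof (cases rule: col_move_cases)
  case 1
  note first = this
  from i' show ?thesis
  proof (cases rule: col_move_cases)
    case 1
    then have "nxt Tc (\<sigma> i) \<le> \<sigma> i'" using nxt(3)[OF Tc(1) _ less] by blast
    then show ?thesis using first 1 by simp
  next
    case 2
    then show ?thesis using first less by auto
  qed
next
  case 2
  note first = this
  from i' show ?thesis by (cases rule: col_move_cases) (use first less in auto)
qed

lemma col_move_less_iff:
  assumes i: "i \<in> {m<..n}" and i': "i' \<in> {m<..n}"
  shows "col_move i < col_move i' \<longleftrightarrow> \<sigma> i < \<sigma> i'"
proof (cases "\<sigma> i" "\<sigma> i'" rule: linorder_cases)
  case equal
  then have "i = i'" using \<sigma>_injD[of i i'] i i' k_less_m by auto
  then show ?thesis by simp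
qed (use col_move_less[OF i i'] col_move_less[OF i' i] in auto)

lemma Tc_cases: "v \<in> Tc \<Longrightarrow> v \<noteq> d \<Longrightarrow> \<exists>i\<in>{m<..n}. \<sigma> i = v"
  by (auto simp: Tc_def)

lemma col_move_inj: "inj_on col_move {1..n}"
proof -
  \<comment> \<open>A moved value is either \<open>d\<close>, which \<open>\<sigma>\<close> misses,
    or again a value of \<open>\<sigma>\<close> below row \<open>m\<close>. The only such value also
    taken by a row up to \<open>m\<close> is \<open>b\<close>, and moved values exceed
    \<open>b\<close>.\<close>
  have mixed: "\<sigma> i \<noteq> col_move i'" if i: "i \<in> {1..m}" and i': "i' \<in> {m<..n}" for i i'
    using i'
  proof (cases rule: col_move_cases)
    case 1
    show ?thesis
    proof
      assume e: "\<sigma> i = col_move i'"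
      have "col_move i' \<noteq> d" using \<sigma>_neq_d[of i] i m_le_n e by auto
      then obtain i'' where i'': "i'' \<in> {m<..n}" "\<sigma> i'' = \<sigma> i"
        using Tc_cases[of "col_move i'"] 1 e by auto
      have "i \<noteq> k" using e 1 \<sigma>_k by auto
      then have "i = i''" using \<sigma>_injD[of i i''] i i'' k_less_m m_le_n by auto
      then show False using i i'' by auto
    qed
  next
    case 2
    show ?thesis
    proof
      assume e: "\<sigma> i = col_move i'"
      have "i \<noteq> k" using e 2 \<sigma>_k b_less_d by auto
      then show False using \<sigma>_injD[of i i'] i i' k_less_m m_le_n e 2 by auto
    qed
  qed
  have upper: "i = i'" if "i \<in> {1..m}" "i' \<in> {1..m}" "\<sigma> i = \<sigma> i'" for i i'
    using that \<sigma>_injD[of i i'] \<sigma>_eq_b_le_m[of i] \<sigma>_eq_b_le_m[of i'] \<sigma>_k m_le_n by auto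
  have lower: "i = i'" if i: "i \<in> {m<..n}" "i' \<in> {m<..n}" "col_move i = col_move i'" for i i'
  proof -
    have "\<sigma> i = \<sigma> i'"
      using col_move_less[OF i(1,2)] col_move_less[OF i(2,1)] i(3)
      by (cases "\<sigma> i" "\<sigma> i'" rule: linorder_cases) auto
    then show ?thesis using \<sigma>_injD[of i i'] i k_less_m by auto
  qed
  show ?thesis
  proof (rule inj_onI)
    fix x y assume xy: "x \<in> {1..n}" "y \<in> {1..n}" "col_move x = col_move y"
    show "x = y"
    proof (cases "x \<le> m"; cases "y \<le> m")
      assume "x \<le> m" "y \<le> m"
      then show ?thesis using upper[of x y] xy by (simp add: col_move_le_m)
    next
      assume "x \<le> m" "\<not> y \<le> m"
      then show ?thesis using mixed[of x y] xy by (simp add: col_move_le_m)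
    next
      assume "\<not> x \<le> m" "y \<le> m"
      then show ?thesis using mixed[of y x] xy by (simp add: col_move_le_m)
    next
      assume "\<not> x \<le> m" "\<not> y \<le> m"
      then show ?thesis using lower[of x y] xy by simp
    qed
  qed
qed

definition row_perm :: "nat \<Rightarrow> nat" where
  "row_perm i = (if i \<in> {k<..m} then row_move i else i)"

lemma row_perm_block: "row_perm i \<in> {k<..m} \<longleftrightarrow> i \<in> {k<..m}"
  using row_move_range[of i] by (auto simp: row_perm_def)

lemma row_perm_range: "row_perm i \<in> {1..n} \<longleftrightarrow> i \<in> {1..n}"
  using row_move_range[of i] k_pos m_le_n by (auto simp: row_perm_def)

lemma row_perm_inj: "inj_on row_perm S"
proof (rule inj_onI)
  fix x y assume xy: "row_perm x = row_perm y"
  show "x = y"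
  proof (cases "x \<in> {k<..m}")
    case True
    then have "y \<in> {k<..m}" using xy row_perm_block by metis
    then show ?thesis using xy True inj_onD[OF lower_inj[OF Tr(1,2), of m], of x y] by (simp add: row_perm_def)
  next
    case False
    then have "y \<notin> {k<..m}" using xy row_perm_block by metis
    then show ?thesis using xy False by (auto simp: row_perm_def)
  qed
qed

lemma row_perm_surj: "t \<in> {1..n} \<Longrightarrow> \<exists>i\<in>{1..n}. row_perm i = t"
proof -
  have "row_perm ` {1..n} = {1..n}"
    by (intro endo_inj_surj row_perm_inj) (use row_perm_range in blast)+
  then show "t \<in> {1..n} \<Longrightarrow> \<exists>i\<in>{1..n}. row_perm i = t" by (metis imageE)
qed

text \<open>Extending \<open>row_move\<close> by the identity merges the three clauses into one
  equation, since \<open>col_move\<close> agrees with \<open>\<sigma>\<close> on rows up to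
  \<open>m\<close>. Two injectivity facts then show that \<open>\<pi>\<close> is a
  permutation.\<close>

lemma discharges_to_iff: "discharges_to \<pi> \<longleftrightarrow> (\<forall>i\<in>{1..n}. \<pi> (row_perm i) = col_move i)"
proof
  assume d: "discharges_to \<pi>"
  show "\<forall>i\<in>{1..n}. \<pi> (row_perm i) = col_move i"
  proof
    fix i assume "i \<in> {1..n}"
    then consider "i \<in> {1..k}" | "i \<in> {k<..m}" | "i \<in> {m<..n}" by force
    then show "\<pi> (row_perm i) = col_move i"
      using d k_less_m by cases (auto simp: discharges_to_def row_perm_def col_move_le_m)
  qed
next
  assume d: "\<forall>i\<in>{1..n}. \<pi> (row_perm i) = col_move i"
  show "discharges_to \<pi>"
    unfolding discharges_to_def
  proof (intro conjI ballI)
    fix i assume "i \<in> {1..k}"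
    then show "\<pi> i = \<sigma> i" using bspec[OF d, of i] k_less_m m_le_n by (auto simp: row_perm_def col_move_le_m)
  next
    fix i assume "i \<in> {k<..m}"
    then show "\<pi> (row_move i) = \<sigma> i"
      using bspec[OF d, of i] k_less_m m_le_n by (auto simp: row_perm_def col_move_le_m)
  next
    fix i assume "i \<in> {m<..n}"
    then show "\<pi> i = col_move i" using bspec[OF d, of i] k_less_m by (auto simp: row_perm_def)
  qed
qed

lemma discharges_to_ex: "\<exists>\<pi>. discharges_to \<pi>"
proof
  show "discharges_to (\<lambda>t. col_move (inv_into {1..n} row_perm t))"
    unfolding discharges_to_iff by (simp add: inv_into_f_f[OF row_perm_inj] del: atLeastAtMost_iff)
qed

lemma discharges_to_cong:
  assumes "discharges_to \<pi>" "\<And>i. i \<in> {1..n} \<Longrightarrow> \<pi>' i = \<pi> i"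
  shows "discharges_to \<pi>'"
  using assms row_perm_range unfolding discharges_to_iff by simp

end

lemma card_image_filter:
  assumes "inj_on f S" "f ` S = T" "\<And>i. i \<in> S \<Longrightarrow> Q (f i) \<longleftrightarrow> P i"
  shows "card {t \<in> T. Q t} = card {i \<in> S. P i}"
proof -
  have "{t \<in> T. Q t} = f ` {i \<in> S. P i}" using assms(2,3) by auto
  moreover have "inj_on f {i \<in> S. P i}" using assms(1) by (auto intro: inj_on_subset)
  ultimately show ?thesis by (simp add: card_image)
qed

section \<open>Parameters and displaced sets read off from the permutation\<close>

locale discharged = coded_asm +
  fixes \<pi> :: "nat \<Rightarrow> nat"
  assumes discharges: "discharges_to \<pi>"
begin

lemma \<pi>_upper: "i \<in> {1..k} \<Longrightarrow> \<pi> i = \<sigma> i"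
  and \<pi>_middle: "i \<in> {k<..m} \<Longrightarrow> \<pi> (row_move i) = \<sigma> i"
  and \<pi>_lower: "i \<in> {m<..n} \<Longrightarrow> \<pi> i = col_move i"
  using discharges by (auto simp: discharges_to_def)

lemma \<pi>_row_perm: "i \<in> {1..n} \<Longrightarrow> \<pi> (row_perm i) = col_move i"
  using discharges unfolding discharges_to_iff by blast

lemma \<pi>_k: "\<pi> k = b"
  using \<pi>_upper[of k] k_pos \<sigma>_k by simp

lemma \<pi>_Suc_k: "\<pi> (k + 1) = \<sigma> lead"
  using \<pi>_middle[of lead] lead row_move_lead by simp

lemma \<pi>_range: "i \<in> {1..n} \<Longrightarrow> \<pi> i \<in> {1..n}"
  using row_perm_surj[of i] \<pi>_row_perm col_move_range by metis

lemma \<pi>_inj: "inj_on \<pi> {1..n}"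
proof (rule inj_onI)
  fix x y assume "x \<in> {1..n}" "y \<in> {1..n}" and e: "\<pi> x = \<pi> y"
  then obtain i j where i: "i \<in> {1..n}" "row_perm i = x" and j: "j \<in> {1..n}" "row_perm j = y"
    using row_perm_surj by metis
  then have "col_move i = col_move j" using e \<pi>_row_perm by metis
  then show "x = y" using inj_onD[OF col_move_inj] i j by metis
qed

text \<open>\<open>row_move\<close> permutes the rows from \<open>k + 1\<close> to \<open>m\<close>
  and carries values along. Row \<open>m\<close> may be included because its left 1 is not
  counted.\<close>

lemma charge_eq: "charge n A = int (card {t \<in> {k<..m}. b < \<pi> t})"
proof -
  have "{i \<in> {k<..<m}. b < \<sigma> i} = {i \<in> {k<..m}. b < \<sigma> i}"
    using \<sigma>_m by (auto simp: less_le)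
  moreover have "card {t \<in> {k<..m}. b < \<pi> t} = card {i \<in> {k<..m}. b < \<sigma> i}"
    by (rule card_image_filter[OF row_move_inj row_move_image]) (simp add: \<pi>_middle del: greaterThanAtMost_iff)
  ultimately show ?thesis by (simp add: charge_A)
qed

lemma mid_\<pi>: "{i \<in> {m<..n}. b < \<pi> i \<and> \<pi> i \<le> d} = {i \<in> {m<..n}. b \<le> \<sigma> i \<and> \<sigma> i < d}"
proof -
  have "b < \<pi> i \<and> \<pi> i \<le> d \<longleftrightarrow> b \<le> \<sigma> i \<and> \<sigma> i < d" if "i \<in> {m<..n}" for i
    using col_move_mid[OF that] \<pi>_lower[OF that] by simp
  then show ?thesis by blast
qed

text \<open>The additional row is the one below \<open>m\<close> with value
  \<open>b\<close>.\<close>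

lemma card_mid_\<sigma>: "int (card {i \<in> {m<..n}. b \<le> \<sigma> i \<and> \<sigma> i < d}) = cpar n A + 1"
proof -
  obtain k' where k': "k' \<in> {m<..n}" "\<sigma> k' = b" using b_below by blast
  have "b = \<sigma> i \<longleftrightarrow> i = k'" if i: "i \<in> {m<..n}" for i
  proof
    have "i \<in> {1..n}" "k' \<in> {1..n}" "i \<noteq> k" "k' \<noteq> k" using i k'(1) k_less_m by auto
    then show "b = \<sigma> i \<Longrightarrow> i = k'" using \<sigma>_injD k'(2) by metis
  qed (use k' in simp)
  then have "b \<le> \<sigma> i \<and> \<sigma> i < d \<longleftrightarrow> i = k' \<or> b < \<sigma> i \<and> \<sigma> i < d" if "i \<in> {m<..n}" for i
    using that b_less_d by (metis le_less)
  then have "{i \<in> {m<..n}. b \<le> \<sigma> i \<and> \<sigma> i < d} = insert k' {i \<in> {m<..n}. b < \<sigma> i \<and> \<sigma> i < d}"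
    using k'(1) by blast
  then show ?thesis using k' by (simp add: cpar_A)
qed

lemma cpar_eq: "cpar n A + 1 = int (card {i \<in> {m<..n}. b < \<pi> i \<and> \<pi> i \<le> d})"
  unfolding mid_\<pi> card_mid_\<sigma> ..

lemma d_attained: "\<exists>i\<in>{m<..n}. \<pi> i = d"
proof -
  have p: "prv Tc d \<in> Tc" "prv Tc d < d" "b \<le> prv Tc d" using prv[OF Tc(1,2) b_less_d] by auto
  then obtain i where i: "i \<in> {m<..n}" "\<sigma> i = prv Tc d" using Tc_cases[of "prv Tc d"] by auto
  then have "\<pi> i = d"
    using \<pi>_lower[OF i(1)] p nxt_prv[OF Tc(1,3,2) b_less_d] by (simp add: col_move_def)
  with i show ?thesis by blast
qed

text \<open>\<open>row_perm\<close> permutes the rows below \<open>k\<close>, and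
  \<open>col_move\<close> neither changes a value below \<open>b\<close> nor creates one. As
  \<open>lead\<close> goes to \<open>k + 1\<close>, the leading column is
  \<open>\<pi> (k + 1)\<close>, so \<open>\<ell>\<close> depends on \<open>k\<close> and
  \<open>\<pi>\<close> alone.\<close>

lemma lpar_eq: "lpar n A = int (card {i \<in> {k<..n}. \<pi> (k + 1) < \<pi> i \<and> \<pi> i < b})"
proof -
  have im: "row_perm ` {k<..n} = {k<..n}"
  proof (rule endo_inj_surj)
    show "row_perm ` {k<..n} \<subseteq> {k<..n}"
      using row_move_range m_le_n by (fastforce simp: row_perm_def)
  qed (simp_all add: row_perm_inj)
  have "\<pi> (k + 1) < \<pi> (row_perm i) \<and> \<pi> (row_perm i) < b \<longleftrightarrow> \<sigma> lead < \<sigma> i \<and> \<sigma> i < b" if i: "i \<in> {k<..n}" for i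
  proof -
    have e: "\<pi> (row_perm i) = col_move i" using i by (intro \<pi>_row_perm) auto
    show ?thesis
    proof (cases "i \<le> m")
      case True
      then show ?thesis using e \<pi>_Suc_k by (simp add: col_move_le_m)
    next
      case False
      then have "i \<in> {m<..n}" using i by simp
      then show ?thesis unfolding e \<pi>_Suc_k by (rule col_move_cases) (use b_less_d in auto)
    qed
  qed
  from card_image_filter[OF row_perm_inj im, of "\<lambda>x. \<pi> (k + 1) < \<pi> x \<and> \<pi> x < b", OF this]
  show ?thesis by (simp add: lpar_A)
qed

text \<open>A left entry lands one row below an element of \<open>Tr\<close>, a right entry one row
  below a non-element. The left entries of \<open>\<pi>\<close> therefore reveal \<open>Tr\<close>,
  except for \<open>m\<close>, which always belongs to it.\<close>

lemma Tr_eq: "Tr = insert m {i \<in> {k..<m}. \<pi> (i + 1) < b}"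
proof -
  have "\<pi> t < b \<longleftrightarrow> t - 1 \<in> Tr" if "t \<in> {k<..m}" for t
  proof -
    have "t \<in> row_move ` {k<..m}" unfolding row_move_image by (rule that)
    then obtain r where r: "r \<in> {k<..m}" "row_move r = t" by (elim imageE) auto
    have "\<pi> t < b \<longleftrightarrow> r \<in> Tr" using \<pi>_middle[OF r(1)] r(2) Tr_iff[OF r(1)] by simp
    then show ?thesis using r prv_Tr(1)[OF r(1)] by (auto simp: lower_def split: if_splits)
  qed
  note * = this
  have **: "i \<in> Tr \<longleftrightarrow> \<pi> (i + 1) < b" if "i \<in> {k..<m}" for i
    using *[of "i + 1"] that by simp
  show ?thesis
  proof (intro set_eqI iffI)
    fix i assume i: "i \<in> Tr"
    then have "i \<in> {k..m}" using Tr(4) by blast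
    then show "i \<in> insert m {i \<in> {k..<m}. \<pi> (i + 1) < b}" using **[of i] i by (cases "i = m") auto
  next
    fix i assume "i \<in> insert m {i \<in> {k..<m}. \<pi> (i + 1) < b}"
    then show "i \<in> Tr" using **[of i] Tr(3) by auto
  qed
qed

text \<open>The successor map carries \<open>Tc\<close> without \<open>d\<close> onto
  \<open>Tc\<close> without \<open>b\<close>, so the moved values recover everything but
  \<open>b\<close>.\<close>

lemma Tc_eq: "Tc = insert b {v \<in> {b<..d}. \<exists>i\<in>{m<..n}. \<pi> i = v}"
proof (intro set_eqI iffI)
  fix v assume v: "v \<in> Tc"
  then have bd: "v \<in> {b..d}" using Tc(4) by blast
  show "v \<in> insert b {v \<in> {b<..d}. \<exists>i\<in>{m<..n}. \<pi> i = v}"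
  proof (cases "v = b")
    case False
    then have bv: "b < v" using bd by auto
    have p: "prv Tc v \<in> Tc" "prv Tc v < v" "b \<le> prv Tc v" using prv[OF Tc(1,2) bv] by auto
    then obtain i where i: "i \<in> {m<..n}" "\<sigma> i = prv Tc v" using Tc_cases[of "prv Tc v"] bd by auto
    then have "\<pi> i = v"
      using \<pi>_lower[OF i(1)] p bd nxt_prv[OF Tc(1) v Tc(2) bv] by (simp add: col_move_def)
    with i bv bd show ?thesis by auto
  qed simp
next
  fix v assume "v \<in> insert b {v \<in> {b<..d}. \<exists>i\<in>{m<..n}. \<pi> i = v}"
  then show "v \<in> Tc"
  proof
    assume "v \<in> {v \<in> {b<..d}. \<exists>i\<in>{m<..n}. \<pi> i = v}"
    then obtain i where i: "i \<in> {m<..n}" "\<pi> i = v" "b < v" "v \<le> d" by auto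
    from i(1) show ?thesis by (cases rule: col_move_cases) (use i \<pi>_lower[OF i(1)] in auto)
  qed (use Tc in auto)
qed

end

text \<open>The inverse of discharging. The displaced sets are parameters, so the formula makes
  sense for a permutation that is not yet known to come from a matrix.\<close>

definition recharge :: "nat \<Rightarrow> nat \<Rightarrow> nat \<Rightarrow> nat \<Rightarrow> nat set \<Rightarrow> nat set \<Rightarrow> (nat \<Rightarrow> nat) \<Rightarrow> nat \<Rightarrow> nat" where
  "recharge k m b d T C \<pi> i =
    (if i \<le> k then \<pi> i else if i \<le> m then \<pi> (lower T i)
     else if b < \<pi> i \<and> \<pi> i \<le> d then prv C (\<pi> i) else \<pi> i)"

context discharged
begin

lemma \<sigma>_eq_recharge: "i \<in> {1..n} \<Longrightarrow> \<sigma> i = recharge k m b d Tr Tc \<pi> i"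
proof -
  assume "i \<in> {1..n}"
  then consider "i \<in> {1..k}" | "i \<in> {k<..m}" | "i \<in> {m<..n}" by force
  then show ?thesis
  proof cases
    case 3
    note i = 3
    from i show ?thesis
      by (cases rule: col_move_cases) (use i k_less_m \<pi>_lower[OF i] in \<open>auto simp: recharge_def\<close>)
  qed (auto simp: recharge_def \<pi>_upper \<pi>_middle)
qed

end

section \<open>Positive and neutral matrices; injectivity of complete discharging\<close>

locale charged = discharged +
  assumes last_right: "m = k + 1 \<or> b < \<sigma> (m - 1)"
begin

lemma positive_or_neutral_A: "positive n A \<or> neutral n A"
  using last_right k_less_m by (auto simp: positive_A neutral_A)

lemma Epar_A: "Epar n A = charge n A"
  using positive_or_neutral_A unfolding Epar_def charge_A positive_A neutral_A by auto

lemma neutral_iff_Epar: "neutral n A \<longleftrightarrow> Epar n A = 0"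
proof
  assume "neutral n A"
  then have "\<not> positive n A" unfolding neutral_A positive_A by simp
  with \<open>neutral n A\<close> show "Epar n A = 0" by (simp add: Epar_def)
next
  assume "Epar n A = 0"
  then have "{i \<in> {k<..<m}. b < \<sigma> i} = {}" by (simp add: Epar_A charge_A)
  then have "\<not> (k < m - 1 \<and> m - 1 < m \<and> b < \<sigma> (m - 1))" by auto
  then show "neutral n A" using last_right k_less_m by (auto simp: neutral_A)
qed

text \<open>In the positive case row \<open>m - 1\<close> holds a right entry, which is only lowered
  and so arrives in row \<open>m\<close>. This is what locates \<open>m\<close> among the rows of
  \<open>\<pi>\<close>.\<close>

lemma \<pi>_m: "m = k + 1 \<or> b < \<pi> m"
proof (cases "m = k + 1")
  case False
  then have r: "m - 1 \<in> {k<..m}" "b < \<sigma> (m - 1)" using last_right k_less_m by auto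
  then have "m - 1 \<notin> Tr" using Tr_iff by auto
  then have "row_move (m - 1) = m" using k_less_m by (simp add: lower_def)
  then show ?thesis using \<pi>_middle[OF r(1)] r(2) by simp
qed simp

text \<open>\<open>E\<close> counts such rows up to \<open>m\<close>, and \<open>c + 1\<close>
  counts some of those below \<open>m\<close>.\<close>

lemma c_E_bound: "cpar n A + Epar n A + 1 \<le> int (card {i \<in> {k<..n}. b < \<pi> i})"
proof -
  have "card ({t \<in> {k<..m}. b < \<pi> t} \<union> {i \<in> {m<..n}. b < \<pi> i \<and> \<pi> i \<le> d}) \<le> card {i \<in> {k<..n}. b < \<pi> i}"
    using k_less_m m_le_n by (intro card_mono) auto
  moreover have "card ({t \<in> {k<..m}. b < \<pi> t} \<union> {i \<in> {m<..n}. b < \<pi> i \<and> \<pi> i \<le> d}) =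
      card {t \<in> {k<..m}. b < \<pi> t} + card {i \<in> {m<..n}. b < \<pi> i \<and> \<pi> i \<le> d}"
    by (intro card_Un_disjoint) auto
  ultimately show ?thesis unfolding Epar_A charge_eq using cpar_eq by linarith
qed

lemma Delta_A: "Delta n A = (k, perm_mat n \<pi>, cpar n A, Epar n A)"
  by (simp add: Delta_def delta_A[OF discharges])

end

lemma asm1_charged:
  assumes "A \<in> asm1 n" "positive n A \<or> neutral n A"
  obtains k m b d \<sigma> \<pi> where "charged n k m b d \<sigma> \<pi>" "A = code_mat n m b d \<sigma>"
proof -
  obtain k m b d \<sigma> where c: "coded_asm n k m b d \<sigma>" and A: "A = code_mat n m b d \<sigma>"
    using asm1_coded[OF assms(1)] by blast
  interpret coded_asm n k m b d \<sigma> by (rule c)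
  obtain \<pi> where "discharges_to \<pi>" using discharges_to_ex by blast
  moreover have "m = k + 1 \<or> b < \<sigma> (m - 1)"
    using assms(2) unfolding A by (auto simp: positive_A neutral_A)
  ultimately have "charged n k m b d \<sigma> \<pi>" by unfold_locales
  then show thesis using that A by blast
qed

text \<open>A closing row \<open>m2\<close> below \<open>m1\<close> would be different from row
  \<open>k + 1\<close>, so row \<open>m2\<close> itself would have a value above \<open>b\<close>
  and raise the count.\<close>

lemma charged_m_le:
  assumes "charged n k m1 b1 d1 \<sigma>1 \<pi>" "charged n k m2 b2 d2 \<sigma>2 \<pi>"
    and "charge n (code_mat n m1 b1 d1 \<sigma>1) = charge n (code_mat n m2 b2 d2 \<sigma>2)"
  shows "m2 \<le> m1"
proof (rule ccontr)
  interpret A1: charged n k m1 b1 d1 \<sigma>1 \<pi> by fact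
  interpret A2: charged n k m2 b2 d2 \<sigma>2 \<pi> by fact
  assume less: "\<not> m2 \<le> m1"
  have "b1 = b2" using A1.\<pi>_k A2.\<pi>_k by simp
  moreover have "b2 < \<pi> m2" using A2.\<pi>_m A1.k_less_m less by auto
  ultimately have "{t \<in> {k<..m1}. b1 < \<pi> t} \<subset> {t \<in> {k<..m2}. b2 < \<pi> t}"
    using less A2.k_less_m by auto
  then have "card {t \<in> {k<..m1}. b1 < \<pi> t} < card {t \<in> {k<..m2}. b2 < \<pi> t}"
    by (intro psubset_card_mono) auto
  then show False using assms(3) A1.charge_eq A2.charge_eq by simp
qed

text \<open>A larger \<open>d2\<close> would be a counted value that the first matrix does not
  count, since \<open>d2\<close> is attained below \<open>m\<close>.\<close>

lemma charged_d_le: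
  assumes "charged n k m b1 d1 \<sigma>1 \<pi>" "charged n k m b2 d2 \<sigma>2 \<pi>"
    and "cpar n (code_mat n m b1 d1 \<sigma>1) = cpar n (code_mat n m b2 d2 \<sigma>2)"
  shows "d2 \<le> d1"
proof (rule ccontr)
  interpret A1: charged n k m b1 d1 \<sigma>1 \<pi> by fact
  interpret A2: charged n k m b2 d2 \<sigma>2 \<pi> by fact
  assume less: "\<not> d2 \<le> d1"
  have b: "b1 = b2" using A1.\<pi>_k A2.\<pi>_k by simp
  obtain i where "i \<in> {m<..n}" "\<pi> i = d2" using A2.d_attained by blast
  then have "{i \<in> {m<..n}. b1 < \<pi> i \<and> \<pi> i \<le> d1} \<subset> {i \<in> {m<..n}. b2 < \<pi> i \<and> \<pi> i \<le> d2}"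
    using less b A2.b_less_d by auto
  then have "card {i \<in> {m<..n}. b1 < \<pi> i \<and> \<pi> i \<le> d1} < card {i \<in> {m<..n}. b2 < \<pi> i \<and> \<pi> i \<le> d2}"
    by (intro psubset_card_mono) auto
  then show False using assms(3) A1.cpar_eq A2.cpar_eq by simp
qed

lemma perm_mat_eqD:
  assumes "perm_mat n \<pi> = perm_mat n \<pi>'" and i: "i \<in> {1..n}"
  shows "\<pi>' i = \<pi> i"
proof -
  have "perm_mat n \<pi>' i (\<pi> i) = perm_mat n \<pi> i (\<pi> i)" using assms(1) by simp
  then show ?thesis using i by (simp add: perm_mat_def)
qed

lemma charged_cong:
  assumes "charged n k m b d \<sigma> \<pi>" "\<And>i. i \<in> {1..n} \<Longrightarrow> \<pi>' i = \<pi> i"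
  shows "charged n k m b d \<sigma> \<pi>'"
proof -
  interpret charged n k m b d \<sigma> \<pi> by fact
  show ?thesis
    using last_right discharges_to_cong[OF discharges assms(2)] by unfold_locales auto
qed

lemma Delta_inj:
  assumes "A1 \<in> asm1 n" "positive n A1 \<or> neutral n A1" "A2 \<in> asm1 n" "positive n A2 \<or> neutral n A2"
    and Delta: "Delta n A1 = Delta n A2"
  shows "A1 = A2"
proof -
  obtain k m1 b1 d1 \<sigma>1 \<pi> where c1: "charged n k m1 b1 d1 \<sigma>1 \<pi>" and A1: "A1 = code_mat n m1 b1 d1 \<sigma>1"
    using asm1_charged[OF assms(1,2)] by blast
  obtain k2 m2 b2 d2 \<sigma>2 \<pi>2 where c2: "charged n k2 m2 b2 d2 \<sigma>2 \<pi>2" and A2: "A2 = code_mat n m2 b2 d2 \<sigma>2"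
    using asm1_charged[OF assms(3,4)] by blast
  have D: "k2 = k" "perm_mat n \<pi>2 = perm_mat n \<pi>" "cpar n A1 = cpar n A2" "Epar n A1 = Epar n A2"
    using Delta charged.Delta_A[OF c1] charged.Delta_A[OF c2] by (simp_all add: A1 A2)
  \<comment> \<open>The two permutations agree on all rows, so both matrices can be taken to
    discharge to the same function. Then \<open>E\<close> fixes the closing row, \<open>c\<close>
    the closing column, and these fix both displaced sets.\<close>
  have c2: "charged n k m2 b2 d2 \<sigma>2 \<pi>"
    using charged_cong[OF c2 perm_mat_eqD[OF D(2)]] D(1) by simp
  interpret A1: charged n k m1 b1 d1 \<sigma>1 \<pi> by (rule c1)
  interpret A2: charged n k m2 b2 d2 \<sigma>2 \<pi> by (rule c2)
  have b: "b1 = b2" using A1.\<pi>_k A2.\<pi>_k by simp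
  have charge: "charge n (code_mat n m1 b1 d1 \<sigma>1) = charge n (code_mat n m2 b2 d2 \<sigma>2)"
    using D(4) A1.Epar_A A2.Epar_A A1 A2 by simp
  have m: "m1 = m2" using charged_m_le[OF c1 c2 charge] charged_m_le[OF c2 c1 charge[symmetric]] by simp
  have d: "d1 = d2"
    using charged_d_le[of n k m1 b1 d1 \<sigma>1 \<pi> b2 d2 \<sigma>2] charged_d_le[of n k m1 b2 d2 \<sigma>2 \<pi> b1 d1 \<sigma>1] c1 c2 D(3)
    unfolding m A1 A2 by simp
  have "A1.Tr = A2.Tr" using A1.Tr_eq A2.Tr_eq b m by simp
  moreover have "A1.Tc = A2.Tc" using A1.Tc_eq A2.Tc_eq b m d by simp
  ultimately have "\<sigma>1 i = \<sigma>2 i" if "i \<in> {1..n}" for i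
    using A1.\<sigma>_eq_recharge[OF that] A2.\<sigma>_eq_recharge[OF that] b m d by simp
  then show ?thesis unfolding A1 A2 code_mat_def b m d by (intro ext) (auto simp del: atLeastAtMost_iff)
qed

section \<open>Recharging: which data come from a matrix\<close>

lemma card_le_attained:
  assumes "finite T" "1 \<le> e" "e \<le> card (T :: nat set)"
  shows "\<exists>x\<in>T. card {t \<in> T. t \<le> x} = e"
  using assms(2,3)
proof (induction e rule: dec_induct)
  case base
  have "T \<noteq> {}" using base by auto
  then have M: "Min T \<in> T" using assms(1) by (intro Min_in)
  then have "{t \<in> T. t \<le> Min T} = {Min T}" using Min_le[OF assms(1)] by (auto intro: antisym)
  then have "card {t \<in> T. t \<le> Min T} = 1" by simp
  with M show ?case by blast
next
  case (step e)
  then obtain x where x: "x \<in> T" "card {t \<in> T. t \<le> x} = e" by force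
  have "\<not> T \<subseteq> {t \<in> T. t \<le> x}"
  proof
    assume "T \<subseteq> {t \<in> T. t \<le> x}"
    then have "card T \<le> card {t \<in> T. t \<le> x}" using assms(1) by (intro card_mono) auto
    then show False using step x by simp
  qed
  then obtain y where y: "y \<in> T" "x < y" unfolding subset_iff by (auto simp: not_le)
  note N = nxt[OF assms(1) y]
  \<comment> \<open>Passing from the e-th smallest element to its successor adds exactly one
    element.\<close>
  have "{t \<in> T. t \<le> nxt T x} = insert (nxt T x) {t \<in> T. t \<le> x}"
    using N nxt(3)[OF assms(1), of _ x] by (force simp: not_le[symmetric])
  then have "card {t \<in> T. t \<le> nxt T x} = Suc e"
    using N x assms(1) by (simp add: card_insert_if)
  then show ?case using N(1) by blast
qed

text \<open>The hypotheses collect what was derived for the discharge of a positive or neutral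
  matrix; here they are shown to suffice for rebuilding it.\<close>

locale recharging =
  fixes n k m b d :: nat and \<pi> :: "nat \<Rightarrow> nat"
  assumes k_pos: "1 \<le> k" and k_less_m: "k < m" and m_le_n: "m \<le> n"
    and \<pi>_range: "i \<in> {1..n} \<Longrightarrow> \<pi> i \<in> {1..n}" and \<pi>_inj: "inj_on \<pi> {1..n}"
    and \<pi>_k: "\<pi> k = b" and \<pi>_Suc_k: "\<pi> (k + 1) < b" and \<pi>_m: "m = k + 1 \<or> b < \<pi> m"
    and b_less_d: "b < d" and d_attained: "\<exists>i\<in>{m<..n}. \<pi> i = d"
begin

text \<open>\<open>T\<close> and \<open>C\<close> follow the descriptions in \<open>Tr_eq\<close>
  and \<open>Tc_eq\<close>, which mention only \<open>\<pi>\<close>.\<close>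

definition T :: "nat set" where "T = insert m {i \<in> {k..<m}. \<pi> (i + 1) < b}"

definition C :: "nat set" where "C = insert b {v \<in> {b<..d}. \<exists>i\<in>{m<..n}. \<pi> i = v}"

abbreviation \<sigma> :: "nat \<Rightarrow> nat" where "\<sigma> \<equiv> recharge k m b d T C \<pi>"

lemma T: "finite T" "k \<in> T" "m \<in> T" "T \<subseteq> {k..m}"
  using k_less_m \<pi>_Suc_k by (auto simp: T_def)

lemma C: "finite C" "b \<in> C" "d \<in> C" "C \<subseteq> {b..d}"
  using b_less_d d_attained by (auto simp: C_def)

lemma \<pi>_injD: "i \<in> {1..n} \<Longrightarrow> i' \<in> {1..n} \<Longrightarrow> \<pi> i = \<pi> i' \<Longrightarrow> i = i'"
  using \<pi>_inj by (rule inj_onD)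

lemma upper: "i \<in> {1..k} \<Longrightarrow> \<sigma> i = \<pi> i"
  by (simp add: recharge_def)

lemma middle: "i \<in> {k<..m} \<Longrightarrow> \<sigma> i = \<pi> (lower T i)"
  by (simp add: recharge_def)

lemma middle_range: "i \<in> {k<..m} \<Longrightarrow> lower T i \<in> {k<..m}"
  by (rule lower_range[OF T(1,2,3)])

lemma below_cases:
  assumes i: "i \<in> {m<..n}"
  obtains "b < \<pi> i" "\<pi> i \<le> d" "\<pi> i \<in> C" "\<sigma> i = prv C (\<pi> i)" "\<sigma> i \<in> C" "b \<le> \<sigma> i" "\<sigma> i < d"
      "nxt C (\<sigma> i) = \<pi> i"
  | "\<pi> i < b \<or> d < \<pi> i" "\<sigma> i = \<pi> i"
proof (cases "b < \<pi> i \<and> \<pi> i \<le> d")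
  case True
  then have c: "\<pi> i \<in> C" using i by (auto simp: C_def)
  have "\<sigma> i = prv C (\<pi> i)" using True i k_less_m by (simp add: recharge_def)
  then show thesis
    using that(1) True c prv[OF C(1,2), of "\<pi> i"] nxt_prv[OF C(1) c C(2)] by simp
next
  case False
  moreover have "\<pi> i \<noteq> b" using \<pi>_injD[of i k] \<pi>_k i k_pos k_less_m by auto
  ultimately show thesis using that(2) i k_less_m by (auto simp: recharge_def)
qed

text \<open>The value at \<open>i\<close> is read one row below an element of \<open>T\<close> if
  \<open>i\<close> is in \<open>T\<close>, and one row below \<open>i\<close> itself otherwise; by
  definition of \<open>T\<close> these are a left and a non-left value.\<close>

lemma T_iff: "i \<in> {k<..m} \<Longrightarrow> i \<in> T \<longleftrightarrow> \<sigma> i < b"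
proof -
  assume i: "i \<in> {k<..m}"
  show ?thesis
  proof (cases "i \<in> T")
    case True
    have p: "prv T i \<in> T" "prv T i < i" using prv[OF T(1,2), of i] i by auto
    then have "\<pi> (prv T i + 1) < b" using i by (auto simp: T_def)
    then show ?thesis using True middle[OF i] by (simp add: lower_def)
  next
    case False
    then have "i < m" using T(3) i by (cases "i = m") auto
    then have "\<not> \<pi> (i + 1) < b" using False i by (auto simp: T_def)
    then show ?thesis using False middle[OF i] by (simp add: lower_def)
  qed
qed

lemma rows: "i \<in> {1..n} \<Longrightarrow> i \<in> {1..k} \<or> i \<in> {k<..m} \<or> i \<in> {m<..n}"
  by auto

lemma \<sigma>_range: "i \<in> {1..n} \<Longrightarrow> \<sigma> i \<in> {1..n}"
proof -
  assume i: "i \<in> {1..n}"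
  have bd: "1 \<le> b" "d \<le> n"
    using \<pi>_range[of k] \<pi>_k k_pos k_less_m m_le_n d_attained \<pi>_range by fastforce+
  from rows[OF i] show ?thesis
  proof (elim disjE)
    assume "i \<in> {1..k}"
    then show ?thesis using \<pi>_range[OF i] upper by simp
  next
    assume m: "i \<in> {k<..m}"
    have "lower T i \<in> {1..n}" using middle_range[OF m] m_le_n by auto
    then show ?thesis unfolding middle[OF m] by (rule \<pi>_range)
  next
    assume "i \<in> {m<..n}"
    then show ?thesis by (cases rule: below_cases) (use bd \<pi>_range[OF i] in auto)
  qed
qed

text \<open>\<open>\<pi>\<close> takes \<open>d\<close> only below row \<open>m\<close>, and there
  the values in the interval up to \<open>d\<close> are moved down.\<close>

lemma \<sigma>_neq_d: "i \<in> {1..n} \<Longrightarrow> \<sigma> i \<noteq> d"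
proof -
  assume i: "i \<in> {1..n}"
  obtain i0 where i0: "i0 \<in> {m<..n}" "\<pi> i0 = d" using d_attained by blast
  have nd: "\<pi> t \<noteq> d" if "t \<in> {1..m}" for t
    using \<pi>_injD[of t i0] that i0 m_le_n by auto
  from rows[OF i] show ?thesis
  proof (elim disjE)
    assume "i \<in> {1..k}"
    then show ?thesis using nd[of i] upper k_less_m by simp
  next
    assume m: "i \<in> {k<..m}"
    then show ?thesis using nd[of "lower T i"] middle_range[OF m] middle[OF m] by simp
  next
    assume "i \<in> {m<..n}"
    then show ?thesis by (cases rule: below_cases) (use b_less_d in auto)
  qed
qed

lemma upper_source:
  assumes "i \<in> {1..m}" "i \<noteq> k"
  obtains t where "t \<in> {1..m}" "t \<noteq> k" "\<sigma> i = \<pi> t" "t = (if i \<in> {k<..m} then lower T i else i)"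
proof (cases "i \<in> {k<..m}")
  case True
  then show thesis using that[of "lower T i"] middle_range[OF True] middle[OF True] by auto
next
  case False
  then show thesis using that[of i] assms by (auto simp: upper)
qed

lemma C_cases: "v \<in> C \<Longrightarrow> v \<noteq> b \<Longrightarrow> \<exists>i\<in>{m<..n}. \<pi> i = v"
  by (auto simp: C_def)

lemma \<sigma>_inj_below: "i \<in> {m<..n} \<Longrightarrow> i' \<in> {m<..n} \<Longrightarrow> \<sigma> i = \<sigma> i' \<Longrightarrow> i = i'"
proof -
  assume i: "i \<in> {m<..n}" and i': "i' \<in> {m<..n}" and e: "\<sigma> i = \<sigma> i'"
  have "\<pi> i = \<pi> i'"
    using i
  proof (cases rule: below_cases)
    case 1
    note one = this
    from i' show ?thesis
    proof (cases rule: below_cases)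
      case 1
      then show ?thesis using one e by metis
    next
      case 2
      then show ?thesis using one e by auto
    qed
  next
    case 2
    note two = this
    from i' show ?thesis by (cases rule: below_cases) (use two e in auto)
  qed
  then show ?thesis using \<pi>_injD[of i i'] i i' by auto
qed

text \<open>A value moved down is \<open>b\<close>, which \<open>\<pi>\<close> takes only in row
  \<open>k\<close>, or is still a value of \<open>\<pi>\<close> below row \<open>m\<close>.\<close>

lemma \<sigma>_upper_neq_below:
  assumes i: "i \<in> {1..m}" "i \<noteq> k" and i': "i' \<in> {m<..n}"
  shows "\<sigma> i \<noteq> \<sigma> i'"
proof -
  obtain t where t: "t \<in> {1..m}" "t \<noteq> k" "\<sigma> i = \<pi> t" using upper_source[OF i] by blast
  have neq: "\<pi> t \<noteq> \<pi> j" if "j \<in> {m<..n}" for j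
    using \<pi>_injD[of t j] t(1) that m_le_n by auto
  have nb: "\<pi> t \<noteq> b" using \<pi>_injD[of t k] t \<pi>_k k_pos k_less_m m_le_n by auto
  from i' show ?thesis
  proof (cases rule: below_cases)
    case 1
    then show ?thesis using C_cases[of "\<sigma> i'"] neq nb t(3) by metis
  next
    case 2
    then show ?thesis using neq[OF i'] t(3) by simp
  qed
qed

lemma \<sigma>_inj: "inj_on \<sigma> ({1..n} - {k})"
proof -
  have up: "x = y" if x: "x \<in> {1..m}" "x \<noteq> k" and y: "y \<in> {1..m}" "y \<noteq> k" and e: "\<sigma> x = \<sigma> y" for x y
  proof -
    obtain t where t: "t \<in> {1..m}" "\<sigma> x = \<pi> t" "t = (if x \<in> {k<..m} then lower T x else x)"
      using upper_source[OF x] by blast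
    obtain u where u: "u \<in> {1..m}" "\<sigma> y = \<pi> u" "u = (if y \<in> {k<..m} then lower T y else y)"
      using upper_source[OF y] by blast
    have "t = u" using \<pi>_injD[of t u] t u e m_le_n by auto
    then show ?thesis
      using t(3) u(3) middle_range[of x] middle_range[of y] inj_onD[OF lower_inj[OF T(1,2)], of x y m]
      by (auto split: if_splits)
  qed
  show ?thesis
  proof (rule inj_onI)
    fix x y assume "x \<in> {1..n} - {k}" "y \<in> {1..n} - {k}" and e: "\<sigma> x = \<sigma> y"
    then have "x \<in> {1..m} \<and> x \<noteq> k \<or> x \<in> {m<..n}" "y \<in> {1..m} \<and> y \<noteq> k \<or> y \<in> {m<..n}" by auto
    then show "x = y"
      using up[of x y] \<sigma>_inj_below[of x y] \<sigma>_upper_neq_below[of x y] \<sigma>_upper_neq_below[of y x] e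
      by metis
  qed
qed

sublocale coded_asm n k m b d \<sigma>
proof
  show "\<sigma> k = b" using upper[of k] k_pos \<pi>_k by simp
  have "m \<in> {k<..m}" using k_less_m by simp
  then show "\<sigma> m < b" using T_iff[of m] T(3) by blast
  show "d \<le> n" using d_attained \<pi>_range by force
  \<comment> \<open>The least value in \<open>C\<close> above \<open>b\<close> is attained by
    \<open>\<pi>\<close> below \<open>m\<close> and is moved down to \<open>b\<close>; its row
    supplies the lower 1 of the opening column.\<close>
  have N: "nxt C b \<in> C" "b < nxt C b" "prv C (nxt C b) = b"
    using nxt[OF C(1,3) b_less_d] prv_nxt[OF C(1,2,3) b_less_d] by auto
  then obtain i where i: "i \<in> {m<..n}" "\<pi> i = nxt C b" using C_cases[of "nxt C b"] by auto
  have "\<sigma> i = b"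
    using i(1)
  proof (cases rule: below_cases)
    case 1
    then show ?thesis using i N by simp
  next
    case 2
    then show ?thesis using i N C(4) by auto
  qed
  with i show "\<exists>i\<in>{m<..n}. \<sigma> i = b" by blast
qed (use k_pos k_less_m m_le_n b_less_d \<sigma>_range \<sigma>_neq_d \<sigma>_inj in blast)+

text \<open>The sets from which \<open>\<sigma>\<close> was built must be the ones its own discharge
  uses; only then does discharging return \<open>\<pi>\<close>. The same is needed for
  \<open>C\<close>.\<close>

lemma Tr_eq_T: "Tr = T"
proof -
  have "i \<in> T \<longleftrightarrow> i = k \<or> i \<in> {k<..m} \<and> \<sigma> i < b" for i
    using T_iff[of i] T(2,4) by fastforce
  then show ?thesis unfolding Tr_def by blast
qed

lemma Tc_eq_C: "Tc = C"
proof (intro set_eqI iffI)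
  fix v assume "v \<in> Tc"
  then show "v \<in> C"
  proof (cases "v = d")
    case False
    then obtain i where i: "i \<in> {m<..n}" "\<sigma> i = v" "b \<le> v" "v < d" using \<open>v \<in> Tc\<close> by (auto simp: Tc_def)
    from i(1) show ?thesis by (cases rule: below_cases) (use i in auto)
  qed (use C in auto)
next
  fix v assume v: "v \<in> C"
  show "v \<in> Tc"
  proof (cases "v = d")
    case False
    then have vd: "b \<le> v" "v < d" using C(4) v by auto
    have N: "nxt C v \<in> C" "v < nxt C v" "prv C (nxt C v) = v"
      using nxt[OF C(1,3) vd(2)] prv_nxt[OF C(1) v C(3) vd(2)] by auto
    then obtain i where i: "i \<in> {m<..n}" "\<pi> i = nxt C v" using C_cases[of "nxt C v"] vd by auto
    from i(1) have "\<sigma> i = v"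
    proof (cases rule: below_cases)
      case 1
      then show ?thesis using i N by simp
    next
      case 2
      then show ?thesis using i N C(4) vd by auto
    qed
    then show ?thesis using i vd unfolding Tc_def by blast
  qed (simp add: Tc_def)
qed

sublocale charged n k m b d \<sigma> \<pi>
proof
  show "discharges_to \<pi>"
    unfolding discharges_to_def
  proof (intro conjI ballI)
    fix i assume "i \<in> {1..k}"
    then show "\<pi> i = \<sigma> i" using upper by simp
  next
    fix i assume "i \<in> {k<..m}"
    then show "\<pi> (lower Tr i) = \<sigma> i" using middle Tr_eq_T by simp
  next
    fix i assume i: "i \<in> {m<..n}"
    then show "\<pi> i = col_move i"
      by (cases rule: below_cases) (use i Tc_eq_C in \<open>auto simp: col_move_def\<close>)
  qed
  show "m = k + 1 \<or> b < \<sigma> (m - 1)"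
  proof (cases "m = k + 1")
    case False
    then have "b < \<pi> m" "m - 1 \<in> {k<..m}" using \<pi>_m k_less_m by auto
    then have "m - 1 \<notin> T" using k_less_m by (auto simp: T_def)
    then show ?thesis using middle[of "m - 1"] \<open>m - 1 \<in> {k<..m}\<close> \<open>b < \<pi> m\<close> k_less_m
      by (simp add: lower_def)
  qed simp
qed

end

lemma recharging_ex:
  assumes k: "1 \<le> k" "k < n" and \<pi>: "\<And>i. i \<in> {1..n} \<Longrightarrow> \<pi> i \<in> {1..n}" "inj_on \<pi> {1..n}"
    and descent: "\<pi> (k + 1) < \<pi> k" and bound: "c + e + 1 \<le> card {i \<in> {k<..n}. \<pi> k < \<pi> i}"
  obtains m d where "recharging n k m (\<pi> k) d \<pi>" "card {i \<in> {k<..m}. \<pi> k < \<pi> i} = e"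
    "card {i \<in> {m<..n}. \<pi> k < \<pi> i \<and> \<pi> i \<le> d} = c + 1"
proof -
  define S where "S = {i \<in> {k<..n}. \<pi> k < \<pi> i}"
  have "\<exists>m. k < m \<and> m \<le> n \<and> (m = k + 1 \<or> \<pi> k < \<pi> m) \<and> card {i \<in> {k<..m}. \<pi> k < \<pi> i} = e"
  proof (cases "e = 0")
    case True
    \<comment> \<open>For \<open>e = 0\<close> the block consists of row \<open>k + 1\<close> alone,
      which the descent makes a left row.\<close>
    have "{i \<in> {k<..k + 1}. \<pi> k < \<pi> i} = {}" using descent by (auto simp: le_Suc_eq)
    then show ?thesis using True k by (intro exI[of _ "k + 1"]) simp
  next
    case False
    then obtain m where m: "m \<in> S" "card {t \<in> S. t \<le> m} = e"
      using card_le_attained[of S e] bound unfolding S_def by fastforce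
    have "{t \<in> S. t \<le> m} = {i \<in> {k<..m}. \<pi> k < \<pi> i}" using m(1) by (auto simp: S_def)
    then show ?thesis using m by (intro exI[of _ m]) (auto simp: S_def)
  qed
  then obtain m where m: "k < m" "m \<le> n" "m = k + 1 \<or> \<pi> k < \<pi> m" "card {i \<in> {k<..m}. \<pi> k < \<pi> i} = e"
    by blast
  define R where "R = {i \<in> {m<..n}. \<pi> k < \<pi> i}"
  have inj: "inj_on \<pi> {m<..n}" using m k by (intro inj_on_subset[OF \<pi>(2)]) auto
  \<comment> \<open>Exactly \<open>e\<close> rows of \<open>S\<close> lie at or above
    \<open>m\<close>, so at least \<open>c + 1\<close> remain in \<open>R\<close>, and
    \<open>d\<close> can be the \<open>(c + 1)\<close>-st smallest of their values.\<close>
  have "S = {i \<in> {k<..m}. \<pi> k < \<pi> i} \<union> R" using m by (auto simp: S_def R_def)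
  then have "card S \<le> e + card R" using card_Un_le m(4) by metis
  moreover have "card (\<pi> ` R) = card R" by (intro card_image inj_on_subset[OF inj]) (auto simp: R_def)
  ultimately obtain d where d: "d \<in> \<pi> ` R" "card {v \<in> \<pi> ` R. v \<le> d} = c + 1"
    using card_le_attained[of "\<pi> ` R" "c + 1"] bound unfolding S_def[symmetric] by (auto simp: R_def)
  have "{v \<in> \<pi> ` R. v \<le> d} = \<pi> ` {i \<in> {m<..n}. \<pi> k < \<pi> i \<and> \<pi> i \<le> d}" by (auto simp: R_def)
  moreover have "card (\<pi> ` {i \<in> {m<..n}. \<pi> k < \<pi> i \<and> \<pi> i \<le> d}) = card {i \<in> {m<..n}. \<pi> k < \<pi> i \<and> \<pi> i \<le> d}"
    by (intro card_image inj_on_subset[OF inj]) auto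
  ultimately have "card {i \<in> {m<..n}. \<pi> k < \<pi> i \<and> \<pi> i \<le> d} = c + 1" using d(2) by simp
  moreover have "recharging n k m (\<pi> k) d \<pi>"
    using k m \<pi> descent d(1) by unfold_locales (auto simp: R_def)
  ultimately show thesis using that m(4) by blast
qed

text \<open>The bound on \<open>c + e\<close> involves only \<open>k\<close> and
  \<open>\<pi>\<close>, so every split of the same sum into nonnegative parts is realized. The split
  with second part 0 gives the neutralization, the others invert it.\<close>

lemma Delta_exchange:
  assumes "A \<in> asm1 n" "positive n A \<or> neutral n A" "Delta n A = (k, P, c, e)"
    and "0 \<le> c'" "0 \<le> e'" "c' + e' = c + e"
  shows "\<exists>A'\<in>asm1 n. (positive n A' \<or> neutral n A') \<and> Delta n A' = (k, P, c', e')"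
proof -
  obtain k1 m b d \<sigma> \<pi> where ch: "charged n k1 m b d \<sigma> \<pi>" and A: "A = code_mat n m b d \<sigma>"
    using asm1_charged[OF assms(1,2)] by blast
  interpret charged n k1 m b d \<sigma> \<pi> by (rule ch)
  have D: "k1 = k" "P = perm_mat n \<pi>" "cpar n A = c" "Epar n A = e"
    using assms(3) Delta_A by (simp_all add: A)
  define c1 e1 where "c1 = nat c'" and "e1 = nat e'"
  have ce: "c' = int c1" "e' = int e1" using assms(4,5) by (simp_all add: c1_def e1_def)
  have "\<pi> (k1 + 1) < \<pi> k1" using \<pi>_Suc_k \<pi>_k lead(2) by simp
  moreover have "c1 + e1 + 1 \<le> card {i \<in> {k1<..n}. \<pi> k1 < \<pi> i}"
    using c_E_bound D(3,4) ce assms(6) \<pi>_k unfolding A by simp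
  moreover have "k1 < n" using k_less_m m_le_n by simp
  ultimately obtain m' d' where rc: "recharging n k1 m' (\<pi> k1) d' \<pi>"
    "card {i \<in> {k1<..m'}. \<pi> k1 < \<pi> i} = e1" "card {i \<in> {m'<..n}. \<pi> k1 < \<pi> i \<and> \<pi> i \<le> d'} = c1 + 1"
    using recharging_ex[of k1 n \<pi> c1 e1] k_pos \<pi>_range \<pi>_inj by blast
  interpret R: recharging n k1 m' "\<pi> k1" d' \<pi> by (rule rc(1))
  have "cpar n R.A = int c1" using R.cpar_eq rc(3) by simp
  moreover have "Epar n R.A = int e1" using R.Epar_A R.charge_eq rc(2) by simp
  ultimately have "Delta n R.A = (k, P, c', e')" using R.Delta_A D ce by simp
  then show ?thesis using R.A_in_asm1 R.positive_or_neutral_A by blast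
qed

lemma lpar_rows_eq_of_Delta:
  assumes "A \<in> asm1 n" "positive n A \<or> neutral n A" "Delta n A = (k, P, c, e)"
    and "A' \<in> asm1 n" "positive n A' \<or> neutral n A'" "Delta n A' = (k, P, c', e')"
  shows "lpar n A = lpar n A'" "i \<in> {1..k} \<Longrightarrow> A i = A' i"
proof -
  obtain k1 m b d \<sigma> \<pi> where ch: "charged n k1 m b d \<sigma> \<pi>" and A: "A = code_mat n m b d \<sigma>"
    using asm1_charged[OF assms(1,2)] by blast
  obtain k2 m2 b2 d2 \<sigma>2 \<pi>2 where ch2: "charged n k2 m2 b2 d2 \<sigma>2 \<pi>2" and A': "A' = code_mat n m2 b2 d2 \<sigma>2"
    using asm1_charged[OF assms(4,5)] by blast
  have D: "k1 = k" "k2 = k" "perm_mat n \<pi>2 = perm_mat n \<pi>"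
    using assms(3,6) charged.Delta_A[OF ch] charged.Delta_A[OF ch2] by (simp_all add: A A')
  have ch2: "charged n k m2 b2 d2 \<sigma>2 \<pi>"
    using charged_cong[OF ch2 perm_mat_eqD[OF D(3)]] D(2) by simp
  have ch: "charged n k m b d \<sigma> \<pi>" using ch D by simp
  interpret A1: charged n k m b d \<sigma> \<pi> by (rule ch)
  interpret A2: charged n k m2 b2 d2 \<sigma>2 \<pi> by (rule ch2)
  have "b = b2" using A1.\<pi>_k A2.\<pi>_k by simp
  then show "lpar n A = lpar n A'" using A1.lpar_eq A2.lpar_eq by (simp add: A A')
  show "A i = A' i" if i: "i \<in> {1..k}"
  proof -
    have "\<sigma> i = \<sigma>2 i" using A1.\<pi>_upper[OF i] A2.\<pi>_upper[OF i] by simp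
    moreover have "i \<noteq> m" "i \<noteq> m2" using i A1.k_less_m A2.k_less_m by auto
    ultimately show ?thesis by (simp add: A A' code_mat_def)
  qed
qed

section \<open>Inversions\<close>

lemma ipar_row_form:
  "ipar n A = (\<Sum>i\<in>{1..n}. \<Sum>i'\<in>{i + 1..n}. \<Sum>j\<in>{1..n}. A i j * (\<Sum>l\<in>{1..<j}. A i' l))"
  unfolding ipar_def by (rule sum.cong[OF refl], subst sum.swap) (simp add: sum_distrib_left)

lemma sum_pairs_card:
  fixes n :: nat
  shows "(\<Sum>i\<in>{1..n}. \<Sum>i'\<in>{i + 1..n}. of_bool (P i i')) =
    int (card {(i, i'). i \<in> {1..n} \<and> i' \<in> {1..n} \<and> i < i' \<and> P i i'})"
proof -
  have "(\<Sum>i\<in>{1..n}. \<Sum>i'\<in>{i + 1..n}. of_bool (P i i')) =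
    (\<Sum>p\<in>(SIGMA i:{1..n}. {i + 1..n}). of_bool (P (fst p) (snd p)) :: int)"
    by (subst sum.Sigma) (auto simp: case_prod_unfold)
  also have "\<dots> = int (card {p \<in> (SIGMA i:{1..n}. {i + 1..n}). P (fst p) (snd p)})"
    by (intro sum_of_bool_card) auto
  also have "{p \<in> (SIGMA i:{1..n}. {i + 1..n}). P (fst p) (snd p)} =
    {(i, i'). i \<in> {1..n} \<and> i' \<in> {1..n} \<and> i < i' \<and> P i i'}" by auto
  finally show ?thesis .
qed

text \<open>Positions are read through \<open>r\<close>. Inversions before and after a permutation
  of the rows can thus be compared as sets of pairs of the same row labels.\<close>

definition invs :: "nat \<Rightarrow> (nat \<Rightarrow> nat) \<Rightarrow> (nat \<Rightarrow> nat) \<Rightarrow> (nat \<times> nat) set" where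
  "invs n r f = {(i, i'). i \<in> {1..n} \<and> i' \<in> {1..n} \<and> r i < r i' \<and> f i' < f i}"

lemma finite_invs: "finite (invs n r f)"
  by (rule finite_subset[of _ "{1..n} \<times> {1..n}"]) (auto simp: invs_def)

lemma invs_comp:
  assumes "inj_on r {1..n}" "r ` {1..n} = {1..n}"
  shows "card (invs n id f) = card (invs n r (f \<circ> r))"
proof -
  have "invs n id f = map_prod r r ` invs n r (f \<circ> r)"
  proof (intro set_eqI iffI)
    fix p assume "p \<in> invs n id f"
    then obtain t t' where p: "p = (t, t')" "t \<in> {1..n}" "t' \<in> {1..n}" "t < t'" "f t' < f t"
      by (auto simp: invs_def)
    obtain i i' where "i \<in> {1..n}" "t = r i" "i' \<in> {1..n}" "t' = r i'"
      using p(2,3) assms(2) by (metis imageE)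
    then show "p \<in> map_prod r r ` invs n r (f \<circ> r)" using p by (force simp: invs_def)
  qed (use assms(2) in \<open>auto simp: invs_def simp del: atLeastAtMost_iff\<close>)
  moreover have "inj_on (map_prod r r) (invs n r (f \<circ> r))"
    using assms(1) by (intro inj_on_subset[OF map_prod_inj_on]) (auto simp: invs_def)
  ultimately show ?thesis by (simp add: card_image)
qed

section \<open>How the coding and the two displacements change the inversions\<close>

context coded_asm
begin

lemma row_weighted_sum:
  assumes i: "i \<in> {1..n}"
  shows "(\<Sum>j\<in>{1..n}. A i j * g j) = g (\<sigma> i) + of_bool (i = m) * (g d - g b)"
proof -
  have d: "d \<in> {1..n}" using b_less_d d_le_n by auto
  have "A i j * g j = (if \<sigma> i = j then g j else 0) +
      of_bool (i = m) * ((if d = j then g j else 0) - (if b = j then g j else 0))" for j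
    using i by (auto simp: code_mat_def algebra_simps)
  then have "(\<Sum>j\<in>{1..n}. A i j * g j) = (\<Sum>j\<in>{1..n}. if \<sigma> i = j then g j else 0) +
      of_bool (i = m) * ((\<Sum>j\<in>{1..n}. if d = j then g j else 0) - (\<Sum>j\<in>{1..n}. if b = j then g j else 0))"
    by (simp only: sum.distrib sum_distrib_left[symmetric] sum_subtractf)
  then show ?thesis using \<sigma>_range[OF i] d b_in by (simp only: sum.delta finite_atLeastAtMost if_True sum.delta')
qed

text \<open>Row \<open>m\<close> has an extra -1 at \<open>b\<close> and an extra 1 at
  \<open>d\<close>. As the lower row of a pair this lowers its prefix sums on \<open>(b, d]\<close>
  by one; as the upper row it adds the entries of the lower row in \<open>[b, d)\<close>.\<close>

lemma ipar_\<sigma>: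
  "ipar n A = int (card (invs n id \<sigma>)) - int (card {i \<in> {1..<m}. b < \<sigma> i \<and> \<sigma> i \<le> d}) +
     int (card {i \<in> {m<..n}. b \<le> \<sigma> i \<and> \<sigma> i < d})"
proof -
  define g where "g i' j = (of_bool (\<sigma> i' < j) + of_bool (i' = m) * (of_bool (d < j) - of_bool (b < j)) :: int)" for i' j
  have g: "(\<Sum>l\<in>{1..<j}. A i' l) = g i' j" if "i' \<in> {1..n}" for i' j
    using \<sigma>_bounds(1)[of i'] that b_in b_less_d by (auto simp: row_sum g_def)
  have "ipar n A = (\<Sum>i\<in>{1..n}. \<Sum>i'\<in>{i + 1..n}. g i' (\<sigma> i) + of_bool (i = m) * (g i' d - g i' b))"
    unfolding ipar_row_form
  proof (intro sum.cong refl)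
    fix i i' assume i: "i \<in> {1..n}" "i' \<in> {i + 1..n}"
    then have "(\<Sum>l\<in>{1..<j}. A i' l) = g i' j" for j by (intro g) auto
    then show "(\<Sum>j\<in>{1..n}. A i j * (\<Sum>l\<in>{1..<j}. A i' l)) = g i' (\<sigma> i) + of_bool (i = m) * (g i' d - g i' b)"
      by (simp only: row_weighted_sum[OF i(1)])
  qed
  also have "\<dots> = (\<Sum>i\<in>{1..n}. \<Sum>i'\<in>{i + 1..n}. of_bool (\<sigma> i' < \<sigma> i)
       - of_bool (i' = m) * of_bool (b < \<sigma> i \<and> \<sigma> i \<le> d)
       + of_bool (i = m) * of_bool (b \<le> \<sigma> i' \<and> \<sigma> i' < d))"
    using b_less_d by (intro sum.cong refl) (auto simp: g_def of_bool_def)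
  also have "\<dots> = (\<Sum>i\<in>{1..n}. \<Sum>i'\<in>{i + 1..n}. of_bool (\<sigma> i' < \<sigma> i))
       - (\<Sum>i\<in>{1..n}. \<Sum>i'\<in>{i + 1..n}. of_bool (i' = m) * of_bool (b < \<sigma> i \<and> \<sigma> i \<le> d))
       + (\<Sum>i\<in>{1..n}. \<Sum>i'\<in>{i + 1..n}. of_bool (i = m) * of_bool (b \<le> \<sigma> i' \<and> \<sigma> i' < d))"
    by (simp only: sum.distrib sum_subtractf)
  also have "(\<Sum>i\<in>{1..n}. \<Sum>i'\<in>{i + 1..n}. of_bool (\<sigma> i' < \<sigma> i)) = int (card (invs n id \<sigma>))"
    unfolding sum_pairs_card invs_def by simp
  also have "(\<Sum>i\<in>{1..n}. \<Sum>i'\<in>{i + 1..n}. of_bool (i' = m) * of_bool (b < \<sigma> i \<and> \<sigma> i \<le> d)) =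
      (\<Sum>i\<in>{1..n}. of_bool (i < m \<and> b < \<sigma> i \<and> \<sigma> i \<le> d) :: int)"
  proof (intro sum.cong refl)
    fix i
    show "(\<Sum>i'\<in>{i + 1..n}. of_bool (i' = m) * of_bool (b < \<sigma> i \<and> \<sigma> i \<le> d)) =
      (of_bool (i < m \<and> b < \<sigma> i \<and> \<sigma> i \<le> d) :: int)"
      unfolding sum_distrib_right[symmetric] using m_le_n by (simp add: sum_of_bool_eq_left Suc_le_eq)
  qed
  also have "\<dots> = int (card {i \<in> {1..<m}. b < \<sigma> i \<and> \<sigma> i \<le> d})"
  proof -
    have "{i \<in> {1..n}. i < m \<and> b < \<sigma> i \<and> \<sigma> i \<le> d} = {i \<in> {1..<m}. b < \<sigma> i \<and> \<sigma> i \<le> d}"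
      using m_le_n by auto
    then show ?thesis by (simp only: sum_of_bool_card finite_atLeastAtMost)
  qed
  also have "(\<Sum>i\<in>{1..n}. \<Sum>i'\<in>{i + 1..n}. of_bool (i = m) * of_bool (b \<le> \<sigma> i' \<and> \<sigma> i' < d)) =
      (\<Sum>i\<in>{1..n}. if i = m then \<Sum>i'\<in>{i + 1..n}. of_bool (b \<le> \<sigma> i' \<and> \<sigma> i' < d) else 0 :: int)"
    by (intro sum.cong) auto
  also have "\<dots> = (\<Sum>i'\<in>{m + 1..n}. of_bool (b \<le> \<sigma> i' \<and> \<sigma> i' < d))"
    using m_in by (simp only: sum.delta finite_atLeastAtMost if_True)
  also have "\<dots> = int (card {i \<in> {m<..n}. b \<le> \<sigma> i \<and> \<sigma> i < d})"
    by (simp only: sum_of_bool_card finite_atLeastAtMost) (simp add: atLeastSucAtMost_greaterThanAtMost)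
  finally show ?thesis .
qed

text \<open>The horizontal displacement keeps the order inside the rows below \<open>m\<close>; it destroys one inversion
  for each row above \<open>m\<close> whose 1 lies between the opening and the closing column.\<close>

lemma card_invs_col_move:
  "card (invs n id \<sigma>) = card (invs n id col_move) + card {i \<in> {1..<m}. b < \<sigma> i \<and> \<sigma> i \<le> d}"
proof -
  \<comment> \<open>The destroyed inversions: the value of the lower row reaches or passes that of
    the upper row.\<close>
  define X where "X = {(i, i'). i \<in> {1..m} \<and> i' \<in> {m<..n} \<and> \<sigma> i' < \<sigma> i \<and> \<sigma> i \<le> col_move i'}"
  have mono: "\<sigma> i \<le> col_move i" if "i \<in> {m<..n}" for i
    using that by (cases rule: col_move_cases) auto
  have split: "(i, i') \<in> invs n id \<sigma> \<longleftrightarrow> (i, i') \<in> invs n id col_move \<or> (i, i') \<in> X"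
    and disj: "\<not> ((i, i') \<in> invs n id col_move \<and> (i, i') \<in> X)" for i i'
  proof -
    consider "\<not> (i \<in> {1..n} \<and> i' \<in> {1..n} \<and> i < i')" | "i \<in> {1..m}" "i' \<in> {1..m}" "i < i'" | "i \<in> {1..m}" "i' \<in> {m<..n}"
      | "i \<in> {m<..n}" "i' \<in> {m<..n}" "i < i'" by force
    then have "((i, i') \<in> invs n id \<sigma> \<longleftrightarrow> (i, i') \<in> invs n id col_move \<or> (i, i') \<in> X) \<and>
        \<not> ((i, i') \<in> invs n id col_move \<and> (i, i') \<in> X)"
    proof cases
      case 1
      then show ?thesis using m_le_n by (auto simp: invs_def X_def)
    next
      case 2
      then show ?thesis by (auto simp: invs_def X_def col_move_le_m)
    next
      case 3
      then show ?thesis using mono[of i'] m_le_n by (auto simp: invs_def X_def col_move_le_m)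
    next
      case 4
      then show ?thesis using col_move_less_iff[of i' i] by (auto simp: invs_def X_def)
    qed
    then show "(i, i') \<in> invs n id \<sigma> \<longleftrightarrow> (i, i') \<in> invs n id col_move \<or> (i, i') \<in> X"
      and "\<not> ((i, i') \<in> invs n id col_move \<and> (i, i') \<in> X)" by blast+
  qed
  have U: "invs n id \<sigma> = invs n id col_move \<union> X" using split by auto
  have D: "invs n id col_move \<inter> X = {}" using disj by auto
  have finX: "finite X" by (rule finite_subset[of _ "{1..m} \<times> {m<..n}"]) (auto simp: X_def)
  have moved: "b \<le> \<sigma> i' \<and> \<sigma> i' < d \<and> \<sigma> i' \<in> Tc \<and> col_move i' = nxt Tc (\<sigma> i') \<and> col_move i' \<le> d"
    if "(i, i') \<in> X" for i i'
  proof -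
    have "i' \<in> {m<..n}" "\<sigma> i' < col_move i'" using that by (auto simp: X_def)
    then show ?thesis by (elim col_move_cases) auto
  qed
  \<comment> \<open>If \<open>\<sigma> u < \<sigma> v\<close> for two partners of \<open>i\<close>,
    then \<open>u\<close> would move at most to \<open>\<sigma> v\<close>, which is still below
    \<open>\<sigma> i\<close>.\<close>
  have "inj_on fst X"
  proof (rule inj_onI)
    fix p q assume p: "p \<in> X" and q: "q \<in> X" and e: "fst p = fst q"
    obtain i x y where xy: "p = (i, x)" "q = (i, y)" using e by (cases p; cases q) auto
    have no: "\<not> \<sigma> u < \<sigma> v" if "(i, u) \<in> X" "(i, v) \<in> X" for u v
    proof
      assume "\<sigma> u < \<sigma> v"
      then have "nxt Tc (\<sigma> u) \<le> \<sigma> v" using nxt(3)[OF Tc(1)] moved[OF that(2)] by blast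
      then show False using moved[OF that(1)] that by (auto simp: X_def)
    qed
    have "\<sigma> x = \<sigma> y" using no[of x y] no[of y x] p q xy by auto
    moreover have "x \<in> {1..n}" "y \<in> {1..n}" "x \<noteq> k" "y \<noteq> k" using p q xy k_less_m by (auto simp: X_def)
    ultimately show "p = q" using \<sigma>_injD[of x y] xy by blast
  qed
  moreover have "fst ` X = {i \<in> {1..<m}. b < \<sigma> i \<and> \<sigma> i \<le> d}"
  proof (intro set_eqI iffI)
    fix i assume "i \<in> fst ` X"
    then obtain i' where i: "(i, i') \<in> X" by auto
    then have "b < \<sigma> i" "\<sigma> i \<le> d" "i \<in> {1..m}" using moved[OF i] by (auto simp: X_def)
    moreover have "i \<noteq> m" using \<sigma>_m \<open>b < \<sigma> i\<close> by auto
    ultimately show "i \<in> {i \<in> {1..<m}. b < \<sigma> i \<and> \<sigma> i \<le> d}" by auto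
  next
    fix i assume i: "i \<in> {i \<in> {1..<m}. b < \<sigma> i \<and> \<sigma> i \<le> d}"
    then have bi: "b < \<sigma> i" by simp
    \<comment> \<open>The partner of \<open>i\<close> is the row below \<open>m\<close> whose value
      precedes \<open>\<sigma> i\<close> in \<open>Tc\<close>.\<close>
    note p = prv[OF Tc(1,2) bi]
    have "\<sigma> i \<noteq> d" using \<sigma>_neq_d[of i] i m_le_n by auto
    then have pd: "prv Tc (\<sigma> i) < d" using p i by auto
    then obtain i' where i': "i' \<in> {m<..n}" "\<sigma> i' = prv Tc (\<sigma> i)" using Tc_cases[OF p(1)] by auto
    then have c: "col_move i' = nxt Tc (prv Tc (\<sigma> i))" using p pd by (simp add: col_move_def)
    have "\<not> nxt Tc (prv Tc (\<sigma> i)) < \<sigma> i"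
      using prv(3)[OF Tc(1), of "nxt Tc (prv Tc (\<sigma> i))" "\<sigma> i"] nxt_Tc[OF pd] by auto
    then have "(i, i') \<in> X" using i i' p c by (auto simp: X_def)
    then show "i \<in> fst ` X" by force
  qed
  ultimately have "card X = card {i \<in> {1..<m}. b < \<sigma> i \<and> \<sigma> i \<le> d}" by (metis card_image)
  then show ?thesis unfolding U using card_Un_disjoint[OF finite_invs finX D] by simp
qed

text \<open>The order can change only inside the block. There a right entry drops by one row and a
  left entry rises to just below the previous left row, so it passes precisely the right entries
  between the two.\<close>

lemma row_perm_less:
  assumes less: "i < i'"
  shows "row_perm i < row_perm i' \<or> i \<in> {k<..m} - Tr \<and> i' = nxt Tr i \<and> row_perm i' < row_perm i"
proof (cases "i \<in> {k<..m} \<and> i' \<in> {k<..m}")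
  case False
  then show ?thesis
    using less row_move_range[of i] row_move_range[of i'] by (auto simp: row_perm_def)
next
  case True
  then have r: "row_perm i = row_move i" "row_perm i' = row_move i'" by (simp_all add: row_perm_def)
  have p: "prv Tr i < i" "prv Tr i' < i'" "prv Tr i' \<in> Tr" using prv_Tr[of i] prv_Tr[of i'] True by auto
  show ?thesis
  proof (cases "i \<in> Tr")
    case iT: True
    then have "i' \<in> Tr \<Longrightarrow> i \<le> prv Tr i'" using prv(3)[OF Tr(1) iT less] by simp
    then show ?thesis using iT p less r by (auto simp: lower_def)
  next
    case iT: False
    show ?thesis
    proof (cases "i' \<in> Tr \<and> prv Tr i' \<le> i")
      case i'T: True
      then have "prv Tr i' < i" using p(3) iT by (metis le_neq_implies_less)
      moreover have "nxt Tr i = i'"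
      proof (rule nxt_eqI)
        fix z assume z: "z \<in> Tr" "i < z"
        show "i' \<le> z"
        proof (rule ccontr)
          assume "\<not> i' \<le> z"
          then have "z \<le> prv Tr i'" using prv(3)[OF Tr(1) z(1)] by simp
          then show False using z i'T by simp
        qed
      qed (use i'T less Tr in auto)
      ultimately show ?thesis using True iT i'T r by (auto simp: lower_def)
    next
      case False
      then show ?thesis using iT less r by (auto simp: lower_def)
    qed
  qed
qed

text \<open>Among the rows from \<open>k + 1\<close> to \<open>m\<close>, each right entry is overtaken by exactly one left entry,
  namely the next one below it.\<close>

lemma card_invs_row_perm:
  "card (invs n id col_move) = card (invs n row_perm col_move) + card {i \<in> {k<..<m}. b < \<sigma> i}"
proof -
  define X where "X = (\<lambda>i. (i, nxt Tr i)) ` ({k<..m} - Tr)"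
  have R: "{k<..m} - Tr = {i \<in> {k<..<m}. b < \<sigma> i}"
  proof (intro set_eqI iffI)
    fix i assume i: "i \<in> {k<..m} - Tr"
    then have "i \<noteq> m" "b < \<sigma> i" using Tr(3) Tr_iff[of i] \<sigma>_neq_b[of i] by auto
    then show "i \<in> {i \<in> {k<..<m}. b < \<sigma> i}" using i by auto
  next
    fix i assume "i \<in> {i \<in> {k<..<m}. b < \<sigma> i}"
    then show "i \<in> {k<..m} - Tr" using Tr_iff[of i] by auto
  qed
  have X: "i < nxt Tr i \<and> nxt Tr i \<in> {k<..m} \<and> col_move (nxt Tr i) < col_move i"
    if i: "i \<in> {k<..m} - Tr" for i
  proof -
    have i': "i \<in> {k<..<m}" "b < \<sigma> i" using i unfolding R by auto
    then have N: "nxt Tr i \<in> Tr" "i < nxt Tr i" "nxt Tr i \<le> m" using nxt[OF Tr(1,3), of i] by auto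
    moreover have "\<sigma> (nxt Tr i) < b" using Tr_iff[of "nxt Tr i"] N i' by auto
    ultimately show ?thesis using i' by (auto simp: col_move_le_m)
  qed
  have XI: "X \<subseteq> invs n id col_move" 
  proof
    fix p assume "p \<in> X"
    then obtain i where "p = (i, nxt Tr i)" and i: "i \<in> {k<..m} - Tr" by (auto simp: X_def)
    then show "p \<in> invs n id col_move" using X[OF i] m_le_n unfolding invs_def by auto
  qed
  have "(i, i') \<in> invs n id col_move \<longleftrightarrow> (i, i') \<in> invs n row_perm col_move \<or> (i, i') \<in> X" for i i'
  proof
    assume "(i, i') \<in> invs n id col_move"
    then show "(i, i') \<in> invs n row_perm col_move \<or> (i, i') \<in> X"
      using row_perm_less[of i i'] unfolding invs_def X_def by auto
  next
    assume "(i, i') \<in> invs n row_perm col_move \<or> (i, i') \<in> X"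
    then show "(i, i') \<in> invs n id col_move"
    proof
      assume I: "(i, i') \<in> invs n row_perm col_move"
      \<comment> \<open>In a pair whose order is reversed, the left entry comes to lie above the
        right one and has the smaller value, so no new inversion arises.\<close>
      have "\<not> i' < i"
      proof
        assume less: "i' < i"
        have "row_perm i < row_perm i'" "col_move i' < col_move i" using I by (auto simp: invs_def)
        then show False using row_perm_less[OF less] X[of i'] by auto
      qed
      moreover have "i \<noteq> i'" using I by (auto simp: invs_def)
      ultimately show ?thesis using I by (auto simp: invs_def)
    qed (use XI in blast)
  qed
  then have U: "invs n id col_move = invs n row_perm col_move \<union> X" by auto
  have "\<not> row_perm i < row_perm (nxt Tr i)" if i: "i \<in> {k<..m} - Tr" for i
  proof -
    have i': "i \<in> {k<..<m}" using i unfolding R by auto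
    have N: "nxt Tr i \<in> Tr" "i < nxt Tr i" "nxt Tr i \<in> {k<..m}" using X[OF i] i' nxt[OF Tr(1,3), of i] by auto
    have "prv Tr (nxt Tr i) \<le> i"
    proof (rule ccontr)
      have "prv Tr (nxt Tr i) \<in> Tr" "prv Tr (nxt Tr i) < nxt Tr i" using prv_Tr N(3) by blast+
      moreover assume "\<not> prv Tr (nxt Tr i) \<le> i"
      ultimately show False using nxt(3)[OF Tr(1), of "prv Tr (nxt Tr i)" i] by auto
    qed
    then show ?thesis using i N by (auto simp: row_perm_def lower_def)
  qed
  then have D: "invs n row_perm col_move \<inter> X = {}" unfolding X_def invs_def by auto
  have "card X = card ({k<..m} - Tr)" unfolding X_def by (rule card_image) (auto simp: inj_on_def)
  moreover have "finite X" by (simp add: X_def)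
  ultimately show ?thesis unfolding U using card_Un_disjoint[OF finite_invs _ D] R by simp
qed

end

text \<open>The inversions lost by the horizontal displacement cancel the negative correction in
  \<open>ipar_\<sigma>\<close>; the positive one is \<open>c + 1\<close>, and the vertical moves
  lose \<open>E\<close>.\<close>

lemma (in charged) ipar_eq:
  "ipar n A = int (card (invs n id \<pi>)) + cpar n A + Epar n A + 1"
proof -
  have "row_perm ` {1..n} = {1..n}"
    using row_perm_surj row_perm_range by (auto simp del: atLeastAtMost_iff)
  then have "card (invs n id \<pi>) = card (invs n row_perm (\<pi> \<circ> row_perm))"
    by (intro invs_comp row_perm_inj)
  moreover have "invs n row_perm (\<pi> \<circ> row_perm) = invs n row_perm col_move"
    using \<pi>_row_perm by (auto simp: invs_def simp del: atLeastAtMost_iff)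
  ultimately show ?thesis
    using ipar_\<sigma> card_mid_\<sigma> card_invs_col_move card_invs_row_perm charge_A Epar_A by simp
qed

lemma ipar_eq_of_Delta:
  assumes "A \<in> asm1 n" "positive n A \<or> neutral n A" "Delta n A = (k, P, c, e)"
    and "A' \<in> asm1 n" "positive n A' \<or> neutral n A'" "Delta n A' = (k, P, c', e')"
    and "c + e = c' + e'"
  shows "ipar n A = ipar n A'"
proof -
  obtain k1 m b d \<sigma> \<pi> where ch: "charged n k1 m b d \<sigma> \<pi>" and A: "A = code_mat n m b d \<sigma>"
    using asm1_charged[OF assms(1,2)] by blast
  obtain k2 m2 b2 d2 \<sigma>2 \<pi>2 where ch2: "charged n k2 m2 b2 d2 \<sigma>2 \<pi>2" and A': "A' = code_mat n m2 b2 d2 \<sigma>2"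
    using asm1_charged[OF assms(4,5)] by blast
  have D: "perm_mat n \<pi>2 = perm_mat n \<pi>" "cpar n A + Epar n A = cpar n A' + Epar n A'"
    using assms(3,6,7) charged.Delta_A[OF ch] charged.Delta_A[OF ch2] by (simp_all add: A A')
  have "invs n id \<pi> = invs n id \<pi>2"
    using perm_mat_eqD[OF D(1)] by (auto simp: invs_def simp del: atLeastAtMost_iff)
  then show ?thesis using charged.ipar_eq[OF ch] charged.ipar_eq[OF ch2] D(2) by (simp add: A A')
qed

section \<open>Vertical reflection\<close>

context coded_asm
begin

text \<open>Reflection exchanges the two 1's of row \<open>m\<close>: the image of the closing 1
  becomes the left one and enters the code.\<close>

definition refl_code :: "nat \<Rightarrow> nat" where
  "refl_code i = n + 1 - (if i = m then d else \<sigma> i)"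

lemma refl_coded: "coded_asm n k m (n + 1 - b) (n + 1 - \<sigma> m) refl_code"
proof
  have bn: "b \<le> n" "1 \<le> d" using b_in b_less_d by auto
  show "refl_code k = n + 1 - b" using \<sigma>_k k_neq_m by (simp add: refl_code_def)
  show "refl_code m < n + 1 - b" using b_less_d bn by (simp add: refl_code_def)
  show "n + 1 - b < n + 1 - \<sigma> m" using \<sigma>_m bn by simp
  show "n + 1 - \<sigma> m \<le> n" using \<sigma>_bounds(1)[of m] m_in by auto
  show "refl_code i \<in> {1..n}" if "i \<in> {1..n}" for i
    using \<sigma>_range[OF that] bn d_le_n by (auto simp: refl_code_def)
  show "refl_code i \<noteq> n + 1 - \<sigma> m" if i: "i \<in> {1..n}" for i
  proof (cases "i = m")
    case True
    then show ?thesis using \<sigma>_m b_less_d bn d_le_n by (simp add: refl_code_def)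
  next
    case False
    have "\<sigma> i \<noteq> \<sigma> m"
      using \<sigma>_injD[OF i m_in] False k_neq_m \<sigma>_k \<sigma>_m by (cases "i = k") auto
    then show ?thesis using False \<sigma>_range[OF i] \<sigma>_range[OF m_in] by (auto simp: refl_code_def)
  qed
  show "inj_on refl_code ({1..n} - {k})"
  proof (rule inj_onI)
    fix x y assume x: "x \<in> {1..n} - {k}" and y: "y \<in> {1..n} - {k}" and e: "refl_code x = refl_code y"
    have "\<sigma> x \<le> n" "\<sigma> y \<le> n" "\<sigma> x \<noteq> d" "\<sigma> y \<noteq> d"
      using \<sigma>_range[of x] \<sigma>_range[of y] \<sigma>_neq_d[of x] \<sigma>_neq_d[of y] x y by auto
    then show "x = y"
      using e \<sigma>_injD[of x y] x y d_le_n by (auto simp: refl_code_def split: if_splits)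
  qed
  obtain k' where "k' \<in> {m<..n}" "\<sigma> k' = b" using b_below by blast
  then show "\<exists>i\<in>{m<..n}. refl_code i = n + 1 - b"
    by (intro bexI[of _ k']) (auto simp: refl_code_def)
qed (use k_pos k_less_m m_le_n in auto)

lemma vrefl_A: "vrefl n A = code_mat n m (n + 1 - b) (n + 1 - \<sigma> m) refl_code"
proof (intro ext)
  fix i j
  interpret R: coded_asm n k m "n + 1 - b" "n + 1 - \<sigma> m" refl_code by (rule refl_coded)
  show "vrefl n A i j = R.A i j"
  proof (cases "1 \<le> j \<and> j \<le> n")
    case False
    then show ?thesis using R.A_outside[of i j] by (auto simp: vrefl_def)
  next
    case j: True
    have e: "x = n + 1 - j \<longleftrightarrow> n + 1 - x = j" "n + 1 - j = x \<longleftrightarrow> j = n + 1 - x" if "x \<le> n" for x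
      using that j by auto
    show ?thesis
    proof (cases "i = m")
      case True
      then show ?thesis
        using j m_in \<sigma>_range[OF m_in] b_in d_le_n e[of "\<sigma> m"] e[of b] e[of d]
        by (auto simp: vrefl_def code_mat_def refl_code_def)
    next
      case False
      then show ?thesis
        using j \<sigma>_range[of i] e[of "\<sigma> i"] by (auto simp: vrefl_def code_mat_def refl_code_def)
    qed
  qed
qed

lemma vrefl_vrefl_A: "vrefl n (vrefl n A) = A"
proof (intro ext)
  fix i j
  show "vrefl n (vrefl n A) i j = A i j"
    using A_outside[of i j] by (cases "1 \<le> j \<and> j \<le> n") (auto simp: vrefl_def)
qed

lemma vrefl_A_in_asm1: "vrefl n A \<in> asm1 n"
  unfolding vrefl_A by (rule coded_asm.A_in_asm1[OF refl_coded])

lemma opening_row_vrefl_A: "opening_row n (vrefl n A) = opening_row n A"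
  unfolding vrefl_A opening_row_A by (rule coded_asm.opening_row_A[OF refl_coded])

lemma neutral_vrefl_A: "neutral n (vrefl n A) \<longleftrightarrow> neutral n A"
  unfolding vrefl_A coded_asm.neutral_A[OF refl_coded] neutral_A ..

lemma positive_vrefl_A: "positive n (vrefl n A) \<longleftrightarrow> negative n A"
proof -
  have "n + 1 - b < refl_code (m - 1) \<longleftrightarrow> \<sigma> (m - 1) < b" if "k + 1 < m"
    using that \<sigma>_range[of "m - 1"] m_le_n k_pos b_in by (auto simp: refl_code_def)
  then show ?thesis
    unfolding vrefl_A coded_asm.positive_A[OF refl_coded] negative_A by blast
qed

text \<open>Without enclosed rows the leading 1 lies in the closing row, so its mirror image is the
  closing 1 of the reflection and the leading cell is reflected onto the closing cell, up to row
  \<open>m\<close>, which contributes nothing.\<close>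

lemma cpar_vrefl_neutral_A:
  assumes "neutral n A"
  shows "cpar n (vrefl n A) = lpar n A"
proof -
  have m: "m = k + 1" using assms by (simp only: neutral_A)
  then have lead_m: "lead = m" using lead by simp
  have rc: "refl_code i = n + 1 - \<sigma> i" if "i \<noteq> m" for i using that by (simp add: refl_code_def)
  have "{i \<in> {m<..n}. n + 1 - b < refl_code i \<and> refl_code i < n + 1 - \<sigma> m} =
    {i \<in> {k<..n}. \<sigma> lead < \<sigma> i \<and> \<sigma> i < b}" (is "?L = ?R")
  proof (intro set_eqI iffI)
    fix i assume "i \<in> ?L"
    then show "i \<in> ?R" using rc[of i] m lead_m by auto
  next
    fix i assume i: "i \<in> ?R"
    then have "i \<noteq> m" unfolding lead_m by auto
    then have "i \<in> {m<..n}" using i m by auto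
    then show "i \<in> ?L" using rc[of i] i lead_m \<sigma>_range[OF m_in] b_in m by auto
  qed
  then show ?thesis unfolding vrefl_A coded_asm.cpar_A[OF refl_coded] lpar_A by simp
qed

lemma cpar_A_nonneg: "0 \<le> cpar n A" and lpar_A_nonneg: "0 \<le> lpar n A"
  unfolding cpar_A lpar_A by simp_all

text \<open>A column with one 1 has no pair of nonzero entries. The entries 1, -1, 1 of column
  \<open>b\<close> give the products -1, 1, -1.\<close>

lemma column_pairs:
  assumes "j \<in> {1..n}"
  shows "(\<Sum>i\<in>{1..n}. A i j * (\<Sum>i'\<in>{i + 1..n}. A i' j)) = - of_bool (j = b)"
  using assms
proof (cases rule: column_cases)
  case (1 i0)
  have "j \<noteq> b" using 1(2)[of m] A_eq_minus[of m b] by (cases "m = i0") auto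
  moreover have "A i j * (\<Sum>i'\<in>{i + 1..n}. A i' j) = 0" for i
    by (simp add: 1(2) sum_of_bool_eq_left)
  then have "(\<Sum>i\<in>{1..n}. A i j * (\<Sum>i'\<in>{i + 1..n}. A i' j)) = 0" by (intro sum.neutral ballI)
  ultimately show ?thesis by (simp only: of_bool_eq minus_zero)
next
  case (2 k')
  define G where "G i = (\<Sum>i'\<in>{i + 1..n}. A i' j)" for i
  have G: "G i = of_bool (k \<in> {i + 1..n}) + of_bool (k' \<in> {i + 1..n}) - of_bool (m \<in> {i + 1..n})" for i
    unfolding G_def 2(3) sum.distrib sum_subtractf by (simp only: sum_of_bool_eq_left finite_atLeastAtMost)
  have "A i j * G i = (if i = k then G i else 0) + (if i = k' then G i else 0) - (if i = m then G i else 0)" for i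
    by (simp add: 2(3) algebra_simps)
  then have "(\<Sum>i\<in>{1..n}. A i j * G i) = G k + G k' - G m"
    using k_in m_in 2(2) by (simp add: sum.distrib sum_subtractf)
  also have "\<dots> = -1" using k_less_m m_le_n 2(2) by (auto simp: G)
  finally show ?thesis using 2(1) by (simp add: G_def)
qed

text \<open>Each row sums to 1, so for two rows the products of their entries sum to 1. Pairs with
  the lower entry to the left count for \<open>A\<close>, those to the right for its reflection, and
  pairs in one column total -1 over all rows.\<close>

lemma ipar_vrefl_A: "ipar n A + ipar n (vrefl n A) = (\<Sum>i\<in>{1..n}. \<Sum>i'\<in>{i + 1..n}. 1) + 1"
proof -
  have total: "sum (A i) {1..n} = 1" if "i \<in> {1..n}" for i
    using that \<sigma>_range[OF that] b_in d_le_n b_less_d by (auto simp: row_sum)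
  have flip: "(\<Sum>j\<in>{1..n}. vrefl n A i j * (\<Sum>l\<in>{1..<j}. vrefl n A i' l)) =
      (\<Sum>j\<in>{1..n}. A i j * (\<Sum>l\<in>{j + 1..n}. A i' l))" for i i'
  proof (rule sum.reindex_bij_witness[where i = "\<lambda>j. n + 1 - j" and j = "\<lambda>j. n + 1 - j"])
    fix j assume j: "j \<in> {1..n}"
    have "(\<Sum>l\<in>{n + 1 - j + 1..n}. A i' l) = (\<Sum>l\<in>{1..<j}. vrefl n A i' l)"
      by (rule sum.reindex_bij_witness[where i = "\<lambda>l. n + 1 - l" and j = "\<lambda>l. n + 1 - l"])
        (use j in \<open>auto simp: vrefl_def\<close>)
    then show "A i (n + 1 - j) * (\<Sum>l\<in>{n + 1 - j + 1..n}. A i' l) =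
        vrefl n A i j * (\<Sum>l\<in>{1..<j}. vrefl n A i' l)"
      using j by (simp add: vrefl_def)
  qed auto
  have pair: "(\<Sum>j\<in>{1..n}. A i j * (\<Sum>l\<in>{1..<j}. A i' l)) + (\<Sum>j\<in>{1..n}. A i j * (\<Sum>l\<in>{j + 1..n}. A i' l)) =
      1 - (\<Sum>j\<in>{1..n}. A i j * A i' j)" if i: "i \<in> {1..n}" and i': "i' \<in> {1..n}" for i i'
  proof -
    have "(\<Sum>l\<in>{1..<j}. A i' l) + (\<Sum>l\<in>{j + 1..n}. A i' l) = 1 - A i' j" if j: "j \<in> {1..n}" for j
    proof -
      have disj: "{1..<j} \<inter> {j + 1..n} = {}" by auto
      have "{1..n} = insert j ({1..<j} \<union> {j + 1..n})" using j by auto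
      then have "sum (A i') {1..n} = A i' j + ((\<Sum>l\<in>{1..<j}. A i' l) + (\<Sum>l\<in>{j + 1..n}. A i' l))"
        by (simp only:) (subst sum.insert; simp add: sum.union_disjoint[OF _ _ disj[simplified]])
      then show ?thesis using total[OF i'] by simp
    qed
    then have "(\<Sum>j\<in>{1..n}. A i j * (\<Sum>l\<in>{1..<j}. A i' l)) + (\<Sum>j\<in>{1..n}. A i j * (\<Sum>l\<in>{j + 1..n}. A i' l)) =
        (\<Sum>j\<in>{1..n}. A i j * (1 - A i' j))"
      unfolding sum.distrib[symmetric] distrib_left[symmetric] by (intro sum.cong refl) simp
    then show ?thesis using total[OF i] by (simp add: right_diff_distrib sum_subtractf)
  qed
  have "(\<Sum>i\<in>{1..n}. \<Sum>i'\<in>{i + 1..n}. \<Sum>j\<in>{1..n}. A i j * A i' j) =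
      (\<Sum>i\<in>{1..n}. \<Sum>j\<in>{1..n}. A i j * (\<Sum>i'\<in>{i + 1..n}. A i' j))"
    by (rule sum.cong[OF refl], subst sum.swap) (simp add: sum_distrib_left)
  also have "\<dots> = (\<Sum>j\<in>{1..n}. - of_bool (j = b))"
    by (subst sum.swap) (intro sum.cong refl column_pairs)
  also have "\<dots> = -1" using b_in by (simp add: sum_negf sum_of_bool_eq_left del: atLeastAtMost_iff)
  finally have cols: "(\<Sum>i\<in>{1..n}. \<Sum>i'\<in>{i + 1..n}. \<Sum>j\<in>{1..n}. A i j * A i' j) = -1" .
  have "ipar n A + ipar n (vrefl n A) =
      (\<Sum>i\<in>{1..n}. \<Sum>i'\<in>{i + 1..n}. 1 - (\<Sum>j\<in>{1..n}. A i j * A i' j))"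
  proof -
    have "ipar n A + ipar n (vrefl n A) = (\<Sum>i\<in>{1..n}. \<Sum>i'\<in>{i + 1..n}.
        (\<Sum>j\<in>{1..n}. A i j * (\<Sum>l\<in>{1..<j}. A i' l)) + (\<Sum>j\<in>{1..n}. A i j * (\<Sum>l\<in>{j + 1..n}. A i' l)))"
      by (simp only: ipar_row_form flip sum.distrib)
    also have "\<dots> = (\<Sum>i\<in>{1..n}. \<Sum>i'\<in>{i + 1..n}. 1 - (\<Sum>j\<in>{1..n}. A i j * A i' j))"
      by (intro sum.cong refl pair) auto
    finally show ?thesis .
  qed
  then show ?thesis unfolding sum_subtractf cols by simp
qed

end

lemma vrefl_vrefl: "A \<in> asm1 n \<Longrightarrow> vrefl n (vrefl n A) = A"
  using asm1_coded coded_asm.vrefl_vrefl_A by metis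

lemma vrefl_in_asm1: "A \<in> asm1 n \<Longrightarrow> vrefl n A \<in> asm1 n"
  using asm1_coded coded_asm.vrefl_A_in_asm1 by metis

lemma opening_row_vrefl: "A \<in> asm1 n \<Longrightarrow> opening_row n (vrefl n A) = opening_row n A"
  using asm1_coded coded_asm.opening_row_vrefl_A by metis

lemma neutral_vrefl: "A \<in> asm1 n \<Longrightarrow> neutral n (vrefl n A) \<longleftrightarrow> neutral n A"
  using asm1_coded coded_asm.neutral_vrefl_A by metis

lemma positive_vrefl: "A \<in> asm1 n \<Longrightarrow> positive n (vrefl n A) \<longleftrightarrow> negative n A"
  using asm1_coded coded_asm.positive_vrefl_A by metis

lemma negative_vrefl: "A \<in> asm1 n \<Longrightarrow> negative n (vrefl n A) \<longleftrightarrow> positive n A"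
  using positive_vrefl[of "vrefl n A"] vrefl_in_asm1 vrefl_vrefl by metis

lemma not_negative_iff: "A \<in> asm1 n \<Longrightarrow> \<not> negative n A \<longleftrightarrow> positive n A \<or> neutral n A"
  using asm1_coded coded_asm.not_negative_A by metis

lemma cpar_vrefl_neutral: "A \<in> asm1 n \<Longrightarrow> neutral n A \<Longrightarrow> cpar n (vrefl n A) = lpar n A"
  using asm1_coded coded_asm.cpar_vrefl_neutral_A by metis

lemma lpar_vrefl_neutral: "A \<in> asm1 n \<Longrightarrow> neutral n A \<Longrightarrow> lpar n (vrefl n A) = cpar n A"
  using cpar_vrefl_neutral[of "vrefl n A" n] vrefl_in_asm1 vrefl_vrefl neutral_vrefl by metis

lemma ipar_vrefl:
  "A \<in> asm1 n \<Longrightarrow> ipar n A + ipar n (vrefl n A) = (\<Sum>i\<in>{1..n}. \<Sum>i'\<in>{i + 1..n}. 1) + 1"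
  using asm1_coded coded_asm.ipar_vrefl_A by metis

lemma opening_row_pos: "A \<in> asm1 n \<Longrightarrow> 1 \<le> opening_row n A"
  using asm1_coded coded_asm.opening_row_A coded_asm.k_pos by metis

lemma cpar_nonneg: "A \<in> asm1 n \<Longrightarrow> 0 \<le> cpar n A"
  using asm1_coded coded_asm.cpar_A_nonneg by metis

lemma lpar_nonneg: "A \<in> asm1 n \<Longrightarrow> 0 \<le> lpar n A"
  using asm1_coded coded_asm.lpar_A_nonneg by metis

lemma neutral_iff_Epar_0: "A \<in> asm1 n \<Longrightarrow> positive n A \<or> neutral n A \<Longrightarrow> neutral n A \<longleftrightarrow> Epar n A = 0"
  using asm1_charged charged.neutral_iff_Epar by metis

lemma Epar_nonneg: "A \<in> asm1 n \<Longrightarrow> positive n A \<or> neutral n A \<Longrightarrow> 0 \<le> Epar n A"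
proof -
  assume "A \<in> asm1 n" "positive n A \<or> neutral n A"
  then obtain k m b d \<sigma> \<pi> where c: "charged n k m b d \<sigma> \<pi>" and A: "A = code_mat n m b d \<sigma>"
    using asm1_charged by blast
  interpret charged n k m b d \<sigma> \<pi> by (rule c)
  show ?thesis unfolding A Epar_A charge_A by simp
qed

section \<open>The neutralizing procedure\<close>

text \<open>\<open>Delta_exchange\<close> with the split \<open>(c + E, 0)\<close> supplies
  \<open>N\<close>, and injectivity of \<open>Delta\<close> makes it the described one. It is
  neutral because its charge is 0.\<close>

lemma Lambda_pn:
  assumes A: "A \<in> asm1 n" "positive n A \<or> neutral n A"
  obtains N where "N \<in> asm1 n" "neutral n N"
    "Delta n N = (opening_row n A, delta n A, cpar n A + Epar n A, 0)" "Lambda_pn n A = (N, Epar n A)"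
proof -
  have "Delta n A = (opening_row n A, delta n A, cpar n A, Epar n A)" by (simp add: Delta_def)
  from Delta_exchange[OF A this, of "cpar n A + Epar n A" 0]
  obtain N where N: "N \<in> asm1 n" "positive n N \<or> neutral n N"
    "Delta n N = (opening_row n A, delta n A, cpar n A + Epar n A, 0)"
    using cpar_nonneg[OF A(1)] Epar_nonneg[OF A] by auto
  have "(THE N. N \<in> asm1 n \<and> (positive n N \<or> neutral n N) \<and>
      Delta n N = (opening_row n A, delta n A, cpar n A + Epar n A, 0)) = N"
    using N Delta_inj by (intro the_equality) force+
  moreover have "neutral n N" using N neutral_iff_Epar_0[OF N(1,2)] by (simp add: Delta_def)
  ultimately show thesis using that N by (simp add: Lambda_pn_def)
qed

lemma Lambda_pn_neutral:
  assumes "A \<in> asm1 n" "neutral n A"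
  shows "Lambda_pn n A = (A, 0)"
proof -
  obtain N where N: "N \<in> asm1 n" "neutral n N"
    "Delta n N = (opening_row n A, delta n A, cpar n A + Epar n A, 0)" "Lambda_pn n A = (N, Epar n A)"
    using Lambda_pn assms by blast
  have E: "Epar n A = 0" using neutral_iff_Epar_0 assms by blast
  then have "Delta n N = Delta n A" using N(3) by (simp add: Delta_def)
  then have "N = A" using Delta_inj N assms by blast
  then show ?thesis using N(4) E by simp
qed

text \<open>Charge \<open>e\<close> is taken out of \<open>c(N)\<close> by an exchange; neutralizing
  puts it back, and injectivity of \<open>Delta\<close> identifies the result with
  \<open>N\<close>.\<close>

lemma Lambda_pn_ex:
  assumes N: "N \<in> asm1 n" "neutral n N" and e: "0 \<le> e" "e \<le> cpar n N"
  shows "\<exists>A\<in>asm1 n. (positive n A \<or> neutral n A) \<and> Lambda_pn n A = (N, e)"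
proof -
  have "Epar n N = 0" using neutral_iff_Epar_0 N by blast
  then have D: "Delta n N = (opening_row n N, delta n N, cpar n N, 0)" by (simp add: Delta_def)
  obtain A where A: "A \<in> asm1 n" "positive n A \<or> neutral n A"
    "Delta n A = (opening_row n N, delta n N, cpar n N - e, e)"
    using Delta_exchange[OF N(1) _ D, of "cpar n N - e" e] N(2) e by auto
  obtain N' where N': "N' \<in> asm1 n" "neutral n N'"
    "Delta n N' = (opening_row n A, delta n A, cpar n A + Epar n A, 0)" "Lambda_pn n A = (N', Epar n A)"
    using Lambda_pn[OF A(1,2)] by blast
  have "Delta n N' = Delta n N" using A(3) N'(3) D by (simp add: Delta_def)
  then have "N' = N" using Delta_inj N N' by blast
  then show ?thesis using A N'(4) by (auto simp: Delta_def)
qed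

text \<open>Everything is expressed through \<open>N\<close> and \<open>E\<close>: \<open>J\<close>,
  the inversions and the top rows depend on \<open>N\<close> alone, and \<open>B\<close> is the
  second component produced by \<open>xi\<close>. The form is stable under reflecting
  \<open>N\<close> and negating \<open>E\<close>.\<close>

definition neutralizes_to :: "nat \<Rightarrow> mat \<Rightarrow> mat \<Rightarrow> bool" where
  "neutralizes_to n A N \<longleftrightarrow> N \<in> asm1 n \<and> neutral n N \<and>
     - lpar n N \<le> Epar n A \<and> Epar n A \<le> cpar n N \<and>
     Bpar n A = cpar n N - lpar n N - Epar n A \<and> Jpar n A = cpar n N + lpar n N + 1 \<and>
     ipar n A = ipar n N \<and> opening_row n A = opening_row n N \<and> (\<forall>i\<in>{1..opening_row n N}. A i = N i) \<and>
     Lambda n A = (N, Epar n A) \<and> Lambda n (vrefl n A) = (vrefl n N, - Epar n A)"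

lemma vrefl_row_cong: "A i = A' i \<Longrightarrow> vrefl n A i = vrefl n A' i"
  by (simp add: vrefl_def fun_eq_iff)

lemma Lambda_not_negative:
  assumes A: "A \<in> asm1 n" "positive n A \<or> neutral n A"
  shows "\<exists>N. neutralizes_to n A N"
proof -
  obtain N where N: "N \<in> asm1 n" "neutral n N"
    "Delta n N = (opening_row n A, delta n A, cpar n A + Epar n A, 0)" "Lambda_pn n A = (N, Epar n A)"
    using Lambda_pn[OF A] by blast
  have neg: "\<not> negative n A" using not_negative_iff A by blast
  have D: "Delta n A = (opening_row n A, delta n A, cpar n A, Epar n A)" by (simp add: Delta_def)
  have pn: "positive n N \<or> neutral n N" using N by blast
  have c: "cpar n N = cpar n A + Epar n A" "opening_row n N = opening_row n A"
    using N(3) by (simp_all add: Delta_def)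
  have l: "lpar n A = lpar n N" and rows: "\<And>i. i \<in> {1..opening_row n A} \<Longrightarrow> A i = N i"
    using lpar_rows_eq_of_Delta[OF A D N(1) pn N(3)] by blast+
  have ip: "ipar n A = ipar n N" using ipar_eq_of_Delta[OF A D N(1) pn N(3)] by simp
  have "Lambda n (vrefl n A) = (vrefl n N, - Epar n A)"
  proof (cases "neutral n A")
    \<comment> \<open>A neutral matrix is its own neutralization, and its reflection is neutral
      again.\<close>
    case True
    then have "\<not> negative n (vrefl n A)" "Epar n A = 0"
      using negative_vrefl[OF A(1)] neutral_iff_Epar_0[OF A] by (auto simp: positive_def neutral_def)
    moreover have "Lambda_pn n (vrefl n A) = (vrefl n A, 0)"
      using Lambda_pn_neutral vrefl_in_asm1 neutral_vrefl A True by blast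
    moreover have "N = A" using Lambda_pn_neutral[OF A(1) True] N(4) by simp
    ultimately show ?thesis by (simp add: Lambda_def)
  next
    case False
    then have "negative n (vrefl n A)" using negative_vrefl[OF A(1)] A(2) by blast
    then show ?thesis using N(4) vrefl_vrefl[OF A(1)] by (simp add: Lambda_def)
  qed
  then have "neutralizes_to n A N"
    using N c l rows ip neg Epar_nonneg[OF A] cpar_nonneg[OF A(1)] lpar_nonneg[OF N(1)]
    by (simp add: neutralizes_to_def Bpar_def Jpar_def Lambda_def)
  then show ?thesis by blast
qed

lemma Epar_vrefl_negative:
  assumes "A \<in> asm1 n" "negative n A"
  shows "Epar n A = - Epar n (vrefl n A)" "0 < Epar n (vrefl n A)"
proof -
  have p: "positive n (vrefl n A)" using positive_vrefl assms by blast
  have "\<not> positive n A" "\<not> neutral n A" using not_negative_iff assms by blast+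
  then show "Epar n A = - Epar n (vrefl n A)" using p by (simp add: Epar_def)
  have "\<not> neutral n (vrefl n A)" using neutral_vrefl assms \<open>\<not> neutral n A\<close> by blast
  then show "0 < Epar n (vrefl n A)"
    using Epar_nonneg[of "vrefl n A"] neutral_iff_Epar_0[of "vrefl n A"] vrefl_in_asm1 p assms(1)
    by (metis less_le)
qed

lemma Lambda_neutralizes:
  assumes A: "A \<in> asm1 n"
  shows "\<exists>N. neutralizes_to n A N"
proof (cases "negative n A")
  case False
  then show ?thesis using Lambda_not_negative not_negative_iff A by blast
next
  case True
  let ?A = "vrefl n A"
  have A': "?A \<in> asm1 n" "positive n ?A" using vrefl_in_asm1 positive_vrefl A True by blast+
  obtain M where M: "neutralizes_to n ?A M" using Lambda_not_negative A' by blast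
  have MN: "M \<in> asm1 n" "neutral n M" using M by (auto simp: neutralizes_to_def)
  have pos: "0 < Epar n ?A" "Epar n A = - Epar n ?A" using Epar_vrefl_negative[OF A True] by auto
  have neg: "\<not> negative n ?A" using not_negative_iff A' by blast
  have B: "Bpar n A = - Bpar n ?A" and J: "Jpar n A = Jpar n ?A"
    using True neg by (simp_all add: Bpar_def Jpar_def)
  have rows: "A i = vrefl n M i" if "i \<in> {1..opening_row n M}" for i
  proof -
    have "?A i = M i" using M that by (simp add: neutralizes_to_def)
    then show ?thesis using vrefl_row_cong vrefl_vrefl[OF A] by metis
  qed
  have "Lambda n A = (vrefl n M, - Epar n ?A)" "Lambda n ?A = (M, Epar n ?A)"
    using M vrefl_vrefl[OF A] by (simp_all add: neutralizes_to_def)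
  \<comment> \<open>Reflecting \<open>M\<close> exchanges \<open>c\<close> and
    \<open>\<ell>\<close>, which matches the sign changes of \<open>E\<close> and \<open>B\<close>;
    the inversion numbers follow from their constant sum under reflection.\<close>
  then have "neutralizes_to n A (vrefl n M)"
    using M pos B J rows opening_row_vrefl[OF A] opening_row_vrefl[OF MN(1)] neutral_vrefl[OF MN(1)]
      vrefl_in_asm1[OF MN(1)] vrefl_vrefl[OF MN(1)] cpar_vrefl_neutral[OF MN] lpar_vrefl_neutral[OF MN]
      lpar_nonneg[OF MN(1)] ipar_vrefl[OF A] ipar_vrefl[OF MN(1)]
    unfolding neutralizes_to_def by auto
  then show ?thesis by blast
qed

section \<open>\<open>Lambda\<close> is a bijection onto the admissible pairs\<close>

lemma negative_iff_Epar: "A \<in> asm1 n \<Longrightarrow> negative n A \<longleftrightarrow> Epar n A < 0"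
  using Epar_vrefl_negative[of A n] Epar_nonneg[of A n] not_negative_iff[of A n] by fastforce

text \<open>\<open>N\<close> determines the opening row, the discharged matrix and
  \<open>c + E\<close>; with \<open>E\<close> known, all of \<open>Delta\<close> is known.\<close>

lemma Lambda_inj_not_negative:
  assumes A: "A \<in> asm1 n" "\<not> negative n A" and A': "A' \<in> asm1 n" "\<not> negative n A'"
    and e: "Lambda n A = Lambda n A'"
  shows "A = A'"
proof -
  have pn: "positive n A \<or> neutral n A" "positive n A' \<or> neutral n A'" using not_negative_iff A A' by blast+
  obtain N where N: "Delta n N = (opening_row n A, delta n A, cpar n A + Epar n A, 0)"
    "Lambda_pn n A = (N, Epar n A)"
    using Lambda_pn[OF A(1) pn(1)] by blast
  obtain N' where N': "Delta n N' = (opening_row n A', delta n A', cpar n A' + Epar n A', 0)"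
    "Lambda_pn n A' = (N', Epar n A')"
    using Lambda_pn[OF A'(1) pn(2)] by blast
  have "N = N'" "Epar n A = Epar n A'" using e N(2) N'(2) A A' by (simp_all add: Lambda_def)
  then have "Delta n A = Delta n A'" using N(1) N'(1) by (simp add: Delta_def)
  then show ?thesis using Delta_inj A A' pn by blast
qed

lemma Lambda_inj: "inj_on (Lambda n) (asm1 n)"
proof (rule inj_onI)
  fix A A' assume A: "A \<in> asm1 n" and A': "A' \<in> asm1 n" and e: "Lambda n A = Lambda n A'"
  obtain N where N: "neutralizes_to n A N" using Lambda_neutralizes A by blast
  obtain N' where N': "neutralizes_to n A' N'" using Lambda_neutralizes A' by blast
  have E: "Epar n A = Epar n A'" "N = N'" using N N' e by (simp_all add: neutralizes_to_def)
  show "A = A'"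
  proof (cases "negative n A")
    case False
    then have "\<not> negative n A'" using negative_iff_Epar A A' E by simp
    then show ?thesis using Lambda_inj_not_negative A A' e False by blast
  next
    case True
    then have "negative n A'" using negative_iff_Epar A A' E by simp
    then have "positive n (vrefl n A)" "positive n (vrefl n A')" using positive_vrefl A A' True by blast+
    then have "\<not> negative n (vrefl n A)" "\<not> negative n (vrefl n A')"
      using not_negative_iff vrefl_in_asm1 A A' by blast+
    moreover have "Lambda n (vrefl n A) = Lambda n (vrefl n A')" using N N' E by (simp add: neutralizes_to_def)
    ultimately have "vrefl n A = vrefl n A'" using Lambda_inj_not_negative vrefl_in_asm1 A A' by blast
    then show ?thesis using vrefl_vrefl A A' by metis
  qed
qed

lemma Lambda_surj:
  assumes N: "N \<in> asm1 n" "neutral n N" and e: "- lpar n N \<le> e" "e \<le> cpar n N"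
  shows "(N, e) \<in> Lambda n ` asm1 n"
proof (cases "0 \<le> e")
  case True
  then obtain A where "A \<in> asm1 n" "positive n A \<or> neutral n A" "Lambda_pn n A = (N, e)"
    using Lambda_pn_ex N e by blast
  then have "A \<in> asm1 n" "Lambda n A = (N, e)" using not_negative_iff by (auto simp: Lambda_def)
  then show ?thesis by (metis image_eqI)
next
  case False
  \<comment> \<open>For negative \<open>e\<close> a matrix of charge \<open>-e\<close> is found over
    the reflected \<open>N\<close> and then reflected; the lower bound on \<open>e\<close> is the
    upper bound needed there.\<close>
  then have "- e \<le> cpar n (vrefl n N)" "0 \<le> - e" using cpar_vrefl_neutral[OF N] e by auto
  moreover have V: "vrefl n N \<in> asm1 n" "neutral n (vrefl n N)" using vrefl_in_asm1 neutral_vrefl N by blast+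
  ultimately obtain A where A: "A \<in> asm1 n" "positive n A \<or> neutral n A" "Lambda_pn n A = (vrefl n N, - e)"
    using Lambda_pn_ex by blast
  obtain M where M: "neutralizes_to n A M" using Lambda_neutralizes A(1) by blast
  have "Lambda n A = (vrefl n N, - e)" using A not_negative_iff by (auto simp: Lambda_def)
  then have "Lambda n (vrefl n A) = (N, e)" using M vrefl_vrefl[OF N(1)] by (auto simp: neutralizes_to_def)
  then show ?thesis using vrefl_in_asm1[OF A(1)] by (metis image_eqI)
qed

section \<open>The involution and its properties\<close>

lemma prime_map_eqI: "A' \<in> asm1 n \<Longrightarrow> Lambda n A' = xi n (Lambda n A) \<Longrightarrow> prime_map n A = A'"
  unfolding prime_map_def by (rule inv_into_f_eq[OF Lambda_inj])

lemma prime_map: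
  assumes "A \<in> asm1 n"
  shows "prime_map n A \<in> asm1 n" "Lambda n (prime_map n A) = xi n (Lambda n A)"
proof -
  obtain N where N: "neutralizes_to n A N" using Lambda_neutralizes assms by blast
  \<comment> \<open>The reflection of the interval from \<open>-\<ell>\<close> to \<open>c\<close>
    about its midpoint preserves it, so \<open>xi\<close> stays in the image of
    \<open>Lambda\<close> and the inverse is genuine.\<close>
  have "(N, cpar n N - lpar n N - Epar n A) \<in> Lambda n ` asm1 n"
    using N by (intro Lambda_surj) (auto simp: neutralizes_to_def)
  then have "xi n (Lambda n A) \<in> Lambda n ` asm1 n"
    using N by (simp add: neutralizes_to_def xi_def)
  then show "prime_map n A \<in> asm1 n" "Lambda n (prime_map n A) = xi n (Lambda n A)"
    unfolding prime_map_def by (rule inv_into_into, rule f_inv_into_f)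
qed

lemma rpar_cong: "A 1 = A' 1 \<Longrightarrow> rpar n A = rpar n A'"
  by (simp add: rpar_def)

lemma prime_map_involution: "A \<in> asm1 n \<Longrightarrow> prime_map n (prime_map n A) = A"
  by (rule prime_map_eqI) (simp_all add: prime_map xi_def)

theorem theorem2:
  fixes n :: nat
  shows "(\<forall>A\<in>asm1 n. prime_map n A \<in> asm1 n \<and> prime_map n (prime_map n A) = A) \<and>
    (\<forall>A\<in>asm1 n.
       opening_row n (prime_map n A) = opening_row n A \<and>
       (\<forall>i\<in>{1..opening_row n A}. \<forall>j. prime_map n A i j = A i j) \<and>
       rpar n (prime_map n A) = rpar n A \<and>
       ipar n (prime_map n A) = ipar n A \<and>
       Jpar n (prime_map n A) = Jpar n A \<and>
       Epar n (prime_map n A) = Bpar n A \<and>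
       Bpar n (prime_map n A) = Epar n A \<and>
       prime_map n (vrefl n A) = vrefl n (prime_map n A))"
proof (rule conjI; rule ballI)
  fix A assume "A \<in> asm1 n"
  then show "prime_map n A \<in> asm1 n \<and> prime_map n (prime_map n A) = A"
    using prime_map(1) prime_map_involution by blast
next
  fix A assume A: "A \<in> asm1 n"
  let ?A' = "prime_map n A"
  have A': "?A' \<in> asm1 n" "Lambda n ?A' = xi n (Lambda n A)" using prime_map[OF A] by blast+
  obtain N where N: "neutralizes_to n A N" using Lambda_neutralizes A by blast
  obtain N' where N': "neutralizes_to n ?A' N'" using Lambda_neutralizes A' by blast
  have NN: "N \<in> asm1 n" "neutral n N" using N by (simp_all add: neutralizes_to_def)
  \<comment> \<open>Both matrices neutralize to the same \<open>N\<close>, and the new charge is the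
    expression for \<open>B\<close> of the old matrix.\<close>
  have e: "N' = N" "Epar n ?A' = cpar n N - lpar n N - Epar n A"
    using N N' A'(2) by (auto simp: neutralizes_to_def xi_def)
  have rows: "?A' i = A i" if "i \<in> {1..opening_row n A}" for i
    using N N' e that by (simp add: neutralizes_to_def)
  then have "rpar n ?A' = rpar n A" using opening_row_pos[OF A] by (intro rpar_cong) simp
  moreover have "prime_map n (vrefl n A) = vrefl n ?A'"
  proof (rule prime_map_eqI)
    show "vrefl n ?A' \<in> asm1 n" using vrefl_in_asm1 A' by blast
    \<comment> \<open>Reflection turns \<open>c - \<ell> - E\<close> into
      \<open>\<ell> - c + E\<close>, its negative, so \<open>xi\<close> commutes with it.\<close>
    show "Lambda n (vrefl n ?A') = xi n (Lambda n (vrefl n A))"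
      using N N' e cpar_vrefl_neutral[OF NN] lpar_vrefl_neutral[OF NN]
      by (simp add: neutralizes_to_def xi_def)
  qed
  ultimately show "opening_row n ?A' = opening_row n A \<and>
       (\<forall>i\<in>{1..opening_row n A}. \<forall>j. ?A' i j = A i j) \<and>
       rpar n ?A' = rpar n A \<and> ipar n ?A' = ipar n A \<and> Jpar n ?A' = Jpar n A \<and>
       Epar n ?A' = Bpar n A \<and> Bpar n ?A' = Epar n A \<and> prime_map n (vrefl n A) = vrefl n ?A'"
    using N N' e rows by (simp add: neutralizes_to_def)
qed

end
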